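(* Let $f:\mathbb{R}^2\to\mathbb{R}$ satisfy (f1)–(f7). Assume that $x'=f(t,x)$ has bounded (globally defined) solutions, and let $a$ and $r$ be the maximal and minimal bounded solutions, as defined in the context. Then the following assertions are equivalent: (a) The solutions $a$ and $r$ are uniformly separated: $\inf_{t\in\mathbb{R}}(a(t)-r(t))>0$. (b) The solutions $a$ and $r$ are hyperbolic, with $a$ attractive and $r$ repulsive. (c) The equation $x'=f(t,x)$ has two different hyperbolic solutions. In this case: (i) Let $(k_a,\beta_a)$ and $(k_r,\beta_r)$ be dichotomy constant pairs for the hyperbolic solutions $a$ and $r$, respectively, and choose any $\bar\beta_a\in(0,\beta_a)$ and any $\bar\beta_r\in(0,\beta_r)$. Then, given $\varepsilon>0$, there exist $k_{a,\varepsilon}\ge 1$ and $k_{r,\varepsilon}\ge 1$ (respectively depending also on the choices of $\bar\beta_a$ and $\bar\beta_r$) such that $$|a(t)-x(t,s,x_0)|\le k_{a,\varepsilon}\,e^{-\bar\beta_a(t-s)}|a(s)-x_0|\quad\text{if }x_0\ge r(s)+\varepsilon\text{ and }t\ge s,$$ $$|r(t)-x(t,s,x_0)|\le k_{r,\varepsilon}\,e^{\bar\beta_r(t-s)}|r(s)-x_0|\quad\text{if }x_0\le a(s)-\varepsilon\text{ and }t\le s.$$ In addition, $$|a(t)-x(t,s,x_0)|\le k_a\,e^{-\beta_a(t-s)}|a(s)-x_0|\quad\text{if }x_0\ge a(s)\text{ and }t\ge s,$$ $$|r(t)-x(t,s,x_0)|\le k_r\,e^{\beta_r(t-s)}|r(s)-x_0|\quad\text{if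 }x_0\le r(s)\text{ and }t\le s.$$ (ii) The equation $x'=f(t,x)$ has no more hyperbolic solutions (than $a$ and $r$), and $a$ and $r$ are the unique bounded solutions of $x'=f(t,x)$ which are uniformly separated.
   Context: Conditions on a function $f:\mathbb{R}^2\to\mathbb{R}$ ("a.e. $t$" refers to Lebesgue measure on $\mathbb{R}$): (f1) $f$ is Borel measurable; (f2) for all $j\in\mathbb{N}$ there exists $m_j\in\mathbb{R}$ such that $\sup_{x\in[-j,j]}|f(t,x)|\le m_j$ for a.e. $t$; (f3) for all $j\in\mathbb{N}$ there exists $l_j\in\mathbb{R}$ such that $\sup_{x_1,x_2\in[-j,j],\,x_1\ne x_2}|f(t,x_2)-f(t,x_1)|/|x_2-x_1|\le l_j$ for a.e. $t$; (f4) for a.e. $t$, the map $x\mapsto f(t,x)$ is $C^1$; (f5) $f_x=\partial f/\partial x$ satisfies condition (f3); (f6) there exist a subset $\mathcal{R}\subseteq\mathbb{R}$ with full Lebesgue measure and $\delta>0$ such that $\limsup_{x\to\pm\infty}f(t,x)/x^2<-\delta$ uniformly on $t\in\mathcal{R}$; (f7) for all $j\in\mathbb{N}$ there exists $\delta_j>0$ such that $\sup_{x_1,x_2\in[-j,j],\,x_1\ne x_2}(f_x(t,x_2)-f_x(t,x_1))/(x_2-x_1)<-\delta_j$ for a.e. $t$. Solutions are Carathéodory solutions (absolutely continuous on compact intervals, satisfying the equation for a.e. $t$). $x(t,s,x_0)$ denotes the maximal solution of $x'=f(t,x)$ with $x(s,s,x_0)=x_0$. Under these conditions, if $x'=f(t,x)$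 has some bounded solution $\mathbb{R}\to\mathbb{R}$, then there exist bounded solutions $r\le a$ defined on $\mathbb{R}$ such that $x(\cdot,s,x_0)$ is globally defined and bounded if and only if $r(s)\le x_0\le a(s)$; these are the functions $a$ and $r$ of the claim. A bounded solution $\tilde b:\mathbb{R}\to\mathbb{R}$ is hyperbolic if there exist $k\ge1$ and $\beta>0$ such that either (attractive case) $\exp\int_s^t f_x(l,\tilde b(l))\,dl\le k\,e^{-\beta(t-s)}$ whenever $t\ge s$, or (repulsive case) $\exp\int_s^t f_x(l,\tilde b(l))\,dl\le k\,e^{\beta(t-s)}$ whenever $t\le s$. In either case $(k,\beta)$ is called a dichotomy constant pair for $\tilde b$. Two bounded solutions $x_1,x_2$ are uniformly separated if $\inf_{t\in\mathbb{R}}|x_1(t)-x_2(t)|>0$. *)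

theory Defs
  imports "HOL-Analysis.Analysis"
begin

text \<open>Suprema are taken in the extended reals, so they need no boundedness side condition and the
  supremum over an empty family (the case \<open>j = 0\<close> of the difference quotients) is \<open>-\<infinity>\<close>.\<close>

definition x_deriv :: "(real \<Rightarrow> real \<Rightarrow> real) \<Rightarrow> real \<Rightarrow> real \<Rightarrow> real" where
  "x_deriv f t x = deriv (f t) x"

definition distinct_pairs :: "nat \<Rightarrow> (real \<times> real) set" where
  "distinct_pairs j = {(x1, x2). x1 \<in> {- real j..real j} \<and> x2 \<in> {- real j..real j} \<and> x1 \<noteq> x2}"

definition cond_f1 :: "(real \<Rightarrow> real \<Rightarrow> real) \<Rightarrow> bool" where
  "cond_f1 f \<longleftrightarrow> (\<lambda>(t, x). f t x) \<in> borel_measurable borel"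

definition cond_f2 :: "(real \<Rightarrow> real \<Rightarrow> real) \<Rightarrow> bool" where
  "cond_f2 f \<longleftrightarrow> (\<forall>j::nat. \<exists>m::real. AE t in lebesgue.
      (SUP x\<in>{- real j..real j}. ereal \<bar>f t x\<bar>) \<le> ereal m)"

definition cond_f3 :: "(real \<Rightarrow> real \<Rightarrow> real) \<Rightarrow> bool" where
  "cond_f3 f \<longleftrightarrow> (\<forall>j::nat. \<exists>l::real. AE t in lebesgue.
      (SUP (x1, x2)\<in>distinct_pairs j. ereal (\<bar>f t x2 - f t x1\<bar> / \<bar>x2 - x1\<bar>)) \<le> ereal l)"

definition cond_f4 :: "(real \<Rightarrow> real \<Rightarrow> real) \<Rightarrow> bool" where
  "cond_f4 f \<longleftrightarrow> (AE t in lebesgue. f t C1_differentiable_on UNIV)"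

definition cond_f5 :: "(real \<Rightarrow> real \<Rightarrow> real) \<Rightarrow> bool" where
  "cond_f5 f \<longleftrightarrow> cond_f3 (x_deriv f)"

text \<open>A bound on \<open>limsup f(t,x)/x\<^sup>2\<close> that is uniform in \<open>t\<close> is a bound on the
  limsup of the supremum over \<open>t\<close>.\<close>

definition cond_f6 :: "(real \<Rightarrow> real \<Rightarrow> real) \<Rightarrow> bool" where
  "cond_f6 f \<longleftrightarrow> (\<exists>R::real set. \<exists>\<delta>>0. - R \<in> null_sets lebesgue \<and>
      Limsup at_top (\<lambda>x. SUP t\<in>R. ereal (f t x / x\<^sup>2)) < ereal (- \<delta>) \<and>
      Limsup at_bot (\<lambda>x. SUP t\<in>R. ereal (f t x / x\<^sup>2)) < ereal (- \<delta>))"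

definition cond_f7 :: "(real \<Rightarrow> real \<Rightarrow> real) \<Rightarrow> bool" where
  "cond_f7 f \<longleftrightarrow> (\<forall>j::nat. \<exists>\<delta>>0. AE t in lebesgue.
      (SUP (x1, x2)\<in>distinct_pairs j. ereal ((x_deriv f t x2 - x_deriv f t x1) / (x2 - x1)))
        < ereal (- \<delta>))"

text \<open>Degenerate intervals \<open>(u, u)\<close> are allowed in \<open>D\<close>; they contribute nothing to either sum.\<close>

definition abs_continuous_on_interval :: "real \<Rightarrow> real \<Rightarrow> (real \<Rightarrow> real) \<Rightarrow> bool" where
  "abs_continuous_on_interval c d x \<longleftrightarrow>
     (\<forall>\<epsilon>>0. \<exists>\<delta>>0. \<forall>D::(real \<times> real) set.
        finite D \<and> (\<forall>(u, v)\<in>D. c \<le> u \<and> u \<le> v \<and> v \<le> d) \<and>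
        disjoint_family_on (\<lambda>(u, v). {u<..<v}) D \<and> (\<Sum>(u, v)\<in>D. v - u) < \<delta>
        \<longrightarrow> (\<Sum>(u, v)\<in>D. \<bar>x v - x u\<bar>) < \<epsilon>)"

definition caratheodory_solution :: "(real \<Rightarrow> real \<Rightarrow> real) \<Rightarrow> real set \<Rightarrow> (real \<Rightarrow> real) \<Rightarrow> bool" where
  "caratheodory_solution f I x \<longleftrightarrow>
     is_interval I \<and>
     (\<forall>c d. {c..d} \<subseteq> I \<longrightarrow> abs_continuous_on_interval c d x) \<and>
     (AE t in lebesgue. t \<in> I \<longrightarrow> (x has_real_derivative f t (x t)) (at t within I))"

definition maximal_solution ::
    "(real \<Rightarrow> real \<Rightarrow> real) \<Rightarrow> real \<Rightarrow> real \<Rightarrow> real set \<Rightarrow> (real \<Rightarrow> real) \<Rightarrow> bool" where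
  "maximal_solution f s x0 I x \<longleftrightarrow>
     caratheodory_solution f I x \<and> s \<in> I \<and> x s = x0 \<and>
     (\<forall>J y. caratheodory_solution f J y \<and> I \<subseteq> J \<and> (\<forall>t\<in>I. y t = x t) \<longrightarrow> J = I)"

text \<open>\<open>sol_dom f s x0\<close> and \<open>sol f t s x0\<close> are the interval of definition and the value
  \<open>x(t,s,x0)\<close> of the maximal solution, which is unique under the conditions above.
  The value is unspecified for \<open>t\<close> outside \<open>sol_dom f s x0\<close>.\<close>

definition sol_dom :: "(real \<Rightarrow> real \<Rightarrow> real) \<Rightarrow> real \<Rightarrow> real \<Rightarrow> real set" where
  "sol_dom f s x0 = {t. \<exists>I x. maximal_solution f s x0 I x \<and> t \<in> I}"

definition sol :: "(real \<Rightarrow> real \<Rightarrow> real) \<Rightarrow> real \<Rightarrow> real \<Rightarrow> real \<Rightarrow> real" where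
  "sol f t s x0 = (THE v. \<exists>I x. maximal_solution f s x0 I x \<and> t \<in> I \<and> v = x t)"

definition bounded_solution :: "(real \<Rightarrow> real \<Rightarrow> real) \<Rightarrow> (real \<Rightarrow> real) \<Rightarrow> bool" where
  "bounded_solution f b \<longleftrightarrow> caratheodory_solution f UNIV b \<and> bounded (range b)"

definition extremal_bounded_solutions ::
    "(real \<Rightarrow> real \<Rightarrow> real) \<Rightarrow> (real \<Rightarrow> real) \<Rightarrow> (real \<Rightarrow> real) \<Rightarrow> bool" where
  "extremal_bounded_solutions f r a \<longleftrightarrow>
     bounded_solution f r \<and> bounded_solution f a \<and> (\<forall>t. r t \<le> a t) \<and>
     (\<forall>s x0. sol_dom f s x0 = UNIV \<and> bounded (range (\<lambda>t. sol f t s x0))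
              \<longleftrightarrow> r s \<le> x0 \<and> x0 \<le> a s)"

text \<open>The integrals are with respect to \<open>lebesgue\<close> rather than \<open>lborel\<close>: as \<open>x_deriv f t\<close> is
  meaningful only for almost every \<open>t\<close>, the integrand need not be Borel measurable.
  Interval integrals are oriented, so that for \<open>t \<le> s\<close> the integral from \<open>s\<close> to \<open>t\<close> is minus the
  integral from \<open>t\<close> to \<open>s\<close>.\<close>

definition attractive_pair ::
    "(real \<Rightarrow> real \<Rightarrow> real) \<Rightarrow> (real \<Rightarrow> real) \<Rightarrow> real \<Rightarrow> real \<Rightarrow> bool" where
  "attractive_pair f b k \<beta> \<longleftrightarrow> k \<ge> 1 \<and> \<beta> > 0 \<and>
     (\<forall>s t. t \<ge> s \<longrightarrow>
        exp (interval_lebesgue_integral lebesgue (ereal s) (ereal t) (\<lambda>l. x_deriv f l (b l)))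
          \<le> k * exp (- \<beta> * (t - s)))"

definition repulsive_pair ::
    "(real \<Rightarrow> real \<Rightarrow> real) \<Rightarrow> (real \<Rightarrow> real) \<Rightarrow> real \<Rightarrow> real \<Rightarrow> bool" where
  "repulsive_pair f b k \<beta> \<longleftrightarrow> k \<ge> 1 \<and> \<beta> > 0 \<and>
     (\<forall>s t. t \<le> s \<longrightarrow>
        exp (interval_lebesgue_integral lebesgue (ereal s) (ereal t) (\<lambda>l. x_deriv f l (b l)))
          \<le> k * exp (\<beta> * (t - s)))"

definition dichotomy_pair ::
    "(real \<Rightarrow> real \<Rightarrow> real) \<Rightarrow> (real \<Rightarrow> real) \<Rightarrow> real \<Rightarrow> real \<Rightarrow> bool" where
  "dichotomy_pair f b k \<beta> \<longleftrightarrow> attractive_pair f b k \<beta> \<or> repulsive_pair f b k \<beta>"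

definition hyperbolic_attractive :: "(real \<Rightarrow> real \<Rightarrow> real) \<Rightarrow> (real \<Rightarrow> real) \<Rightarrow> bool" where
  "hyperbolic_attractive f b \<longleftrightarrow> bounded_solution f b \<and> (\<exists>k \<beta>. attractive_pair f b k \<beta>)"

definition hyperbolic_repulsive :: "(real \<Rightarrow> real \<Rightarrow> real) \<Rightarrow> (real \<Rightarrow> real) \<Rightarrow> bool" where
  "hyperbolic_repulsive f b \<longleftrightarrow> bounded_solution f b \<and> (\<exists>k \<beta>. repulsive_pair f b k \<beta>)"

definition hyperbolic :: "(real \<Rightarrow> real \<Rightarrow> real) \<Rightarrow> (real \<Rightarrow> real) \<Rightarrow> bool" where
  "hyperbolic f b \<longleftrightarrow> hyperbolic_attractive f b \<or> hyperbolic_repulsive f b"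

definition uniformly_separated :: "(real \<Rightarrow> real) \<Rightarrow> (real \<Rightarrow> real) \<Rightarrow> bool" where
  "uniformly_separated x1 x2 \<longleftrightarrow> (INF t. \<bar>x1 t - x2 t\<bar>) > 0"

end

theory Submission
  imports Defs
begin

text \<open>Let \<open>p < q\<close> be two solutions with gap \<open>w = q - p\<close>. Then \<open>(ln w)'\<close> is the slope of
  \<open>f(t,\<cdot>)\<close> between \<open>p\<close> and \<open>q\<close>; by d-concavity it lies between \<open>f\<^sub>x(t,q) + \<delta>w/2\<close> and
  \<open>f\<^sub>x(t,p) - \<delta>w/2\<close>, and it differs from either derivative by at most \<open>Lw\<close>. Integrating, a gap that is
  bounded away from \<open>0\<close> forces \<open>q\<close> to be attractive and \<open>p\<close> to be repulsive, and two distinct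
  hyperbolic solutions are of these types in this order and have a gap bounded away from \<open>0\<close>.
  For a solution \<open>x\<close> between \<open>r\<close> and \<open>a\<close> the slopes over \<open>[r,x]\<close> and \<open>[x,a]\<close> differ by at least
  \<open>\<delta>(a-r)/2\<close>, so \<open>(x-r)/(a-x)\<close> grows exponentially; this makes \<open>a-x\<close> integrable in time, and
  the linear rate at \<open>a\<close> is inherited up to a constant factor.\<close>

text \<open>Two obstacles shape the development. Derivatives and bounds hold only for almost every
  time, so each differential inequality is used in integrated form, off a null set. The gauge
  integral suits this: the derivative of an absolutely continuous function is integrable in that
  sense, with no prior measurability argument, and this applies to the logarithm of a gap. Moreover
  the estimates concern \<open>sol\<close>, so uniqueness, existence and gluing of solutions must
  come first. Existence is one-sided: a solution starting above \<open>r\<close> is followed forward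
  and one starting below \<open>a\<close> backward, since a solution outside the band between
  \<open>r\<close> and \<open>a\<close> may blow up in the other direction. The change (t, x) to
  (-t, -x) preserves the conditions, turns attractive into repulsive solutions and exchanges
  \<open>a\<close> with \<open>r\<close>. This is why most lemmas come in mirrored pairs; the two
  halves are proved by parallel arguments.\<close>

section \<open>Absolute continuity and Lebesgue differentiation\<close>

text \<open>In a fine tagged division the cells tagged off \<open>E\<close> have small error by
  differentiability at the tag. The cells tagged in \<open>E\<close> are forced into an open set
  \<open>U\<close> of measure below \<open>\<delta>\<close>, where absolute continuity makes the
  total increment of \<open>x\<close> small.\<close>

lemma abs_continuous_has_integral:
  fixes x h :: "real \<Rightarrow> real"
  assumes ac: "abs_continuous_on_interval c d x" and "c \<le> d" and E: "negligible E"
    and der: "\<And>t. t \<in> {c..d} - E \<Longrightarrow> (x has_real_derivative h t) (at t within {c..d})"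
  shows "(h has_integral x d - x c) {c..d}"
proof -
  \<comment> \<open>With value 0 on \<open>E\<close>, a cell tagged there contributes nothing to the
    Riemann sum, and its error is just the increment of \<open>x\<close>. Values of \<open>h\<close>
    on \<open>E\<close> could be arbitrarily large.\<close>
  define g where "g t = (if t \<in> E then 0 else h t)" for t
  have "(g has_integral x d - x c) {c..d}"
    unfolding has_integral_real
  proof (intro allI impI)
    fix e :: real assume "e > 0"
    then have e2: "e/2 > 0" by simp
    obtain \<delta> where \<delta>: "\<delta> > 0" and ac\<delta>: "\<And>D. finite D \<Longrightarrow> (\<forall>(u, v)\<in>D. c \<le> u \<and> u \<le> v \<and> v \<le> d) \<Longrightarrow>
        disjoint_family_on (\<lambda>(u, v). {u<..<v}) D \<Longrightarrow> (\<Sum>(u, v)\<in>D. v - u) < \<delta>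
        \<Longrightarrow> (\<Sum>(u, v)\<in>D. \<bar>x v - x u\<bar>) < e/2"
      using ac e2 unfolding abs_continuous_on_interval_def by meson
    have E0: "E \<in> null_sets lebesgue" using E negligible_iff_null_sets by blast
    obtain U where U: "open U" "E \<subseteq> U" "U - E \<in> lmeasurable" "emeasure lebesgue (U - E) < ennreal \<delta>"
      using sets_lebesgue_outer_open[of E \<delta>] E0 \<delta> by auto
    have "U \<in> lmeasurable"
      using U(2,3) E0 fmeasurable.Un[of "U - E" lebesgue E] by (simp add: Un_absorb1 Un_Diff_cancel2 sup.commute negligible_imp_measurable[OF E])
    moreover have "measure lebesgue U = measure lebesgue (U - E)"
      using E0 U(1) by (simp add: measure_Diff_null_set)
    ultimately have U: "open U" "E \<subseteq> U" "U \<in> lmeasurable" "measure lebesgue U < \<delta>"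
      using U by (auto simp: emeasure_eq_measure2 ennreal_less_iff)
    define e' where "e' = e / (2 * (d - c + 1))"
    have e': "e' > 0" "e' * (d - c) < e/2"
      using \<open>e > 0\<close> \<open>c \<le> d\<close> by (auto simp: e'_def field_simps)
    have "\<exists>\<eta>>0. \<forall>y\<in>{c..d}. \<bar>y - t\<bar> < \<eta> \<longrightarrow> \<bar>x y - x t - h t * (y - t)\<bar> \<le> e' * \<bar>y - t\<bar>"
      if "t \<in> {c..d} - E" for t
      using der[OF that] e'(1)
      unfolding has_field_derivative_def has_derivative_within_alt by (auto simp: mult.commute)
    then obtain \<eta> where \<eta>: "\<And>t. t \<in> {c..d} - E \<Longrightarrow> \<eta> t > 0"
      "\<And>t y. t \<in> {c..d} - E \<Longrightarrow> y \<in> {c..d} \<Longrightarrow> \<bar>y - t\<bar> < \<eta> t \<Longrightarrow> \<bar>x y - x t - h t * (y - t)\<bar> \<le> e' * \<bar>y - t\<bar>"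
      by metis
    define \<gamma> where "\<gamma> t = (if t \<in> E then U else if t \<in> {c..d} then ball t (\<eta> t) else UNIV)" for t
    have "gauge \<gamma>"
      using U \<eta>(1) by (auto simp: gauge_def \<gamma>_def)
    moreover have "norm ((\<Sum>(t, k)\<in>\<D>. measure lborel k *\<^sub>R g t) - (x d - x c)) < e"
      if \<D>: "\<D> tagged_division_of {c..d}" and fine: "\<gamma> fine \<D>" for \<D>
    proof -
      have fin: "finite \<D>" using \<D> by blast
      have K: "\<exists>u v. k = {u..v} \<and> u \<le> t \<and> t \<le> v \<and> c \<le> u \<and> v \<le> d" if "(t, k) \<in> \<D>" for t k
      proof -
        have "t \<in> k" "k \<subseteq> {c..d}" "\<exists>a b. k = cbox a b"
          using tagged_division_ofD(2-4)[OF \<D>] that by auto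
        then show ?thesis by auto
      qed
      have dist_int: "interior k1 \<inter> interior k2 = {}" if "(t1, k1) \<in> \<D>" "(t2, k2) \<in> \<D>" "(t1, k1) \<noteq> (t2, k2)" for t1 k1 t2 k2
        using tagged_division_ofD(5)[OF \<D>] that by blast
      define DE where "DE = {p \<in> \<D>. fst p \<in> E}"
      define DN where "DN = {p \<in> \<D>. fst p \<notin> E}"
      have split: "\<D> = DE \<union> DN" "DE \<inter> DN = {}" "finite DE" "finite DN" using fin by (auto simp: DE_def DN_def)
      define T where "T = (\<lambda>(t, k). measure lborel k *\<^sub>R g t - (x (Sup k) - x (Inf k)))"
      have "(\<Sum>(t, k)\<in>\<D>. x (Sup k) - x (Inf k)) = x d - x c"
        by (rule additive_tagged_division_1[OF \<open>c \<le> d\<close> \<D>])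
      then have "(\<Sum>(t, k)\<in>\<D>. measure lborel k *\<^sub>R g t) - (x d - x c) = (\<Sum>p\<in>\<D>. T p)"
        by (simp add: T_def sum_subtractf split_def)
      also have "\<dots> = (\<Sum>p\<in>DE. T p) + (\<Sum>p\<in>DN. T p)"
        using split by (simp add: sum.union_disjoint)
      finally have eq: "(\<Sum>(t, k)\<in>\<D>. measure lborel k *\<^sub>R g t) - (x d - x c) = (\<Sum>p\<in>DE. T p) + (\<Sum>p\<in>DN. T p)" .
      have "\<bar>\<Sum>p\<in>DN. T p\<bar> \<le> (\<Sum>p\<in>DN. \<bar>T p\<bar>)" by (rule sum_abs)
      also have "\<dots> \<le> (\<Sum>(t, k)\<in>DN. e' * measure lborel k)"
      proof (rule sum_mono, clarify)
        fix t k assume "(t, k) \<in> DN"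
        then have tk: "(t, k) \<in> \<D>" "t \<notin> E" by (auto simp: DN_def)
        obtain u v where uv: "k = {u..v}" "u \<le> t" "t \<le> v" "c \<le> u" "v \<le> d" using K[OF tk(1)] by blast
        have t: "t \<in> {c..d} - E" using uv tk by auto
        have "{u..v} \<subseteq> ball t (\<eta> t)"
          using fineD[OF fine tk(1)] t uv by (auto simp: \<gamma>_def split: if_splits)
        moreover have "u \<in> {u..v}" "v \<in> {u..v}" using uv by auto
        ultimately have "u \<in> ball t (\<eta> t)" "v \<in> ball t (\<eta> t)" by blast+
        then have "\<bar>u - t\<bar> < \<eta> t" "\<bar>v - t\<bar> < \<eta> t" by (auto simp: dist_real_def)
        then have "\<bar>x u - x t - h t * (u - t)\<bar> \<le> e' * \<bar>u - t\<bar>" "\<bar>x v - x t - h t * (v - t)\<bar> \<le> e' * \<bar>v - t\<bar>"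
          using uv by (intro \<eta>(2)[OF t]; simp)+
        then have "\<bar>h t * (v - u) - (x v - x u)\<bar> \<le> e' * (v - u)"
          using uv by (simp add: algebra_simps abs_if split: if_splits)
        moreover have "Sup k = v" "Inf k = u" "measure lborel k = v - u" using uv by auto
        ultimately show "\<bar>T (t, k)\<bar> \<le> e' * measure lborel k"
          using tk by (simp add: T_def g_def mult.commute)
      qed
      also have "\<dots> \<le> (\<Sum>(t, k)\<in>\<D>. e' * measure lborel k)"
        using fin e' by (intro sum_mono2) (auto simp: DN_def)
      also have "\<dots> = e' * measure lborel {c..d}"
        using additive_content_tagged_division[of \<D> c d] \<D>
        by (simp add: sum_distrib_left[symmetric] split_def)
      also have "\<dots> < e/2" using e' \<open>c \<le> d\<close> by simp
      finally have N: "\<bar>\<Sum>p\<in>DN. T p\<bar> < e/2" .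
      define D where "D = (\<lambda>(t, k). (Inf k, Sup k)) ` DE"
      have DE_K: "\<exists>u v. k = {u..v} \<and> u \<le> t \<and> t \<le> v \<and> c \<le> u \<and> v \<le> d \<and> {u..v} \<subseteq> U" if "(t, k) \<in> DE" for t k
        using that K[of t k] fineD[OF fine, of t k] by (auto simp: DE_def \<gamma>_def)
      have D1: "\<exists>t. (t, {u..v}) \<in> DE \<and> u \<le> v \<and> c \<le> u \<and> v \<le> d \<and> {u..v} \<subseteq> U" if "(u, v) \<in> D" for u v
        using that DE_K by (fastforce simp: D_def)
      have finD: "finite D" using split by (simp add: D_def)
      have dis: "disjoint_family_on (\<lambda>(u, v). {u<..<v}) D"
        unfolding disjoint_family_on_def
      proof (intro ballI impI)
        fix p q assume "p \<in> D" "q \<in> D" "p \<noteq> q"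
        moreover obtain u v u' v' where [simp]: "p = (u, v)" "q = (u', v')" by (cases p, cases q)
        ultimately have "(u, v) \<in> D" "(u', v') \<in> D" "\<not> (u = u' \<and> v = v')" by auto
        then obtain t t' where "(t, {u..v}) \<in> DE" "(t', {u'..v'}) \<in> DE" "{u..v} \<noteq> {u'..v'}"
          using D1 by (metis Icc_eq_Icc)
        then have "interior {u..v} \<inter> interior {u'..v'} = {}"
          by (intro dist_int[of t _ t']) (simp_all add: DE_def)
        then have "{u<..<v} \<inter> {u'<..<v'} = {}" by (simp only: interior_atLeastAtMost_real)
        then show "(case p of (u, v) \<Rightarrow> {u<..<v}) \<inter> (case q of (u, v) \<Rightarrow> {u<..<v}) = {}" by simp
      qed
      have "(\<Sum>(u, v)\<in>D. v - u) = (\<Sum>p\<in>D. measure lebesgue (case p of (u, v) \<Rightarrow> {u<..<v}))"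
        using D1 by (intro sum.cong) auto
      also have "\<dots> = measure lebesgue (\<Union>p\<in>D. case p of (u, v) \<Rightarrow> {u<..<v})"
        using finD dis by (intro measure_finite_Union[symmetric]) (auto dest!: D1)
      also have "\<dots> \<le> measure lebesgue U"
      proof (rule measure_mono_fmeasurable)
        show "(\<Union>p\<in>D. case p of (u, v) \<Rightarrow> {u<..<v}) \<subseteq> U"
        proof clarsimp
          fix u v z assume "(u, v) \<in> D" "u < z" "z < v"
          then show "z \<in> U" using D1[of u v] by (auto simp: subset_iff)
        qed
        show "(\<Union>p\<in>D. case p of (u, v) \<Rightarrow> {u<..<v}) \<in> sets lebesgue"
          using finD by (intro sets.finite_UN) auto
      qed (rule U)
      finally have "(\<Sum>(u, v)\<in>D. v - u) < \<delta>" using U by simp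
      then have "(\<Sum>(u, v)\<in>D. \<bar>x v - x u\<bar>) < e/2"
        by (intro ac\<delta>[OF finD _ dis]) (auto dest!: D1)
      moreover have "(\<Sum>(u, v)\<in>D. \<bar>x v - x u\<bar>) = (\<Sum>p\<in>DE. \<bar>T p\<bar>)"
        unfolding D_def
      proof (subst sum.reindex_nontrivial)
        show "finite DE" by (rule split)
        \<comment> \<open>\<open>D\<close> is a set of pairs, so tagged cells with equal endpoints
          are merged. Such cells have disjoint interiors, hence are single points with increment 0,
          and the sum is unchanged.\<close>
        fix p q assume pq: "p \<in> DE" "q \<in> DE" "p \<noteq> q"
          "(case p of (t, k) \<Rightarrow> (Inf k, Sup k)) = (case q of (t, k) \<Rightarrow> (Inf k, Sup k))"
        obtain t k t' k' where [simp]: "p = (t, k)" "q = (t', k')" by (cases p, cases q)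
        obtain u v where k: "k = {u..v}" "u \<le> v" using DE_K[of t k] pq by auto
        obtain u' v' where k': "k' = {u'..v'}" "u' \<le> v'" using DE_K[of t' k'] pq by auto
        have eq: "u = u'" "v = v'" using pq k k' by auto
        have "interior k \<inter> interior k' = {}" using dist_int[of t k t' k'] pq by (auto simp: DE_def)
        then have "{u<..<v} = {}" using k k' eq by simp
        then have "u = v" using k by auto
        then show "(case case p of (t, k) \<Rightarrow> (Inf k, Sup k) of (u, v) \<Rightarrow> \<bar>x v - x u\<bar>) = 0"
          using k by simp
      next
        show "sum ((\<lambda>(u, v). \<bar>x v - x u\<bar>) \<circ> (\<lambda>(t, k). (Inf k, Sup k))) DE = (\<Sum>p\<in>DE. \<bar>T p\<bar>)"
          by (rule sum.cong) (auto simp: T_def g_def DE_def abs_minus_commute)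
      qed
      ultimately have "\<bar>\<Sum>p\<in>DE. T p\<bar> < e/2" using sum_abs[of T DE] by linarith
      with N eq show ?thesis by simp
    qed
    ultimately show "\<exists>\<gamma>. gauge \<gamma> \<and> (\<forall>\<D>. \<D> tagged_division_of {c..d} \<and> \<gamma> fine \<D> \<longrightarrow>
        norm ((\<Sum>(t, k)\<in>\<D>. measure lborel k *\<^sub>R g t) - (x d - x c)) < e)"
      by (intro exI[of _ \<gamma>] conjI allI impI) simp_all
  qed
  then show ?thesis
    by (rule has_integral_spike[OF E, rotated]) (simp add: g_def)
qed

lemma lipschitz_on_imp_abs_continuous:
  assumes "M-lipschitz_on {c..d} (x :: real \<Rightarrow> real)"
  shows "abs_continuous_on_interval c d x"
  unfolding abs_continuous_on_interval_def
proof (intro allI impI)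
  fix e :: real assume "e > 0"
  have M: "M \<ge> 0" using assms lipschitz_on_nonneg by blast
  show "\<exists>\<delta>>0. \<forall>D. finite D \<and> (\<forall>(u, v)\<in>D. c \<le> u \<and> u \<le> v \<and> v \<le> d) \<and>
        disjoint_family_on (\<lambda>(u, v). {u<..<v}) D \<and> (\<Sum>(u, v)\<in>D. v - u) < \<delta>
        \<longrightarrow> (\<Sum>(u, v)\<in>D. \<bar>x v - x u\<bar>) < e"
  proof (intro exI[of _ "e / (M + 1)"] conjI allI impI)
    show "e / (M + 1) > 0" using \<open>e > 0\<close> M by simp
    fix D assume D: "finite D \<and> (\<forall>(u, v)\<in>D. c \<le> u \<and> u \<le> v \<and> v \<le> d) \<and>
        disjoint_family_on (\<lambda>(u, v). {u<..<v}) D \<and> (\<Sum>(u, v)\<in>D. v - u) < e / (M + 1)"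
    have "(\<Sum>(u, v)\<in>D. \<bar>x v - x u\<bar>) \<le> (\<Sum>(u, v)\<in>D. M * (v - u))"
    proof (rule sum_mono, clarify)
      fix u v assume "(u, v) \<in> D"
      then have "c \<le> u" "u \<le> v" "v \<le> d" using D by auto
      then show "\<bar>x v - x u\<bar> \<le> M * (v - u)"
        using lipschitz_on_normD[OF assms, of v u] by simp
    qed
    also have "\<dots> = M * (\<Sum>(u, v)\<in>D. v - u)" by (simp add: sum_distrib_left split_def)
    also have "\<dots> \<le> M * (e / (M + 1))" using D M by (intro mult_left_mono) auto
    also have "\<dots> < e" using \<open>e > 0\<close> M by (simp add: field_simps)
    finally show "(\<Sum>(u, v)\<in>D. \<bar>x v - x u\<bar>) < e" .
  qed
qed

text \<open>At a point of \<open>B n\<close> arbitrarily short intervals violate the derivative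
  estimate by more than \<open>1 / Suc n\<close> times their length. Vitali's theorem selects
  disjoint ones that cover almost all of \<open>B n\<close>, and Henstock's lemma bounds the sum of
  the violations, hence the total length.\<close>

lemma integral_differentiable_off_negligible:
  fixes h :: "real \<Rightarrow> real"
  assumes h: "h integrable_on {c..d}"
  obtains E where "negligible E"
    "\<And>t. t \<in> {c<..<d} - E \<Longrightarrow> ((\<lambda>u. integral {c..u} h) has_real_derivative h t) (at t)"
proof -
  define F where "F u = integral {c..u} h" for u
  have F: "F v - F u = integral {u..v} h" if "c \<le> u" "u \<le> v" "v \<le> d" for u v
    using Henstock_Kurzweil_Integration.integral_combine[of c u v h] integrable_subinterval_real[OF h, of c v] that
    by (simp add: F_def)
  define bad where "bad n t y \<longleftrightarrow> y \<in> {c<..<d} \<and> y \<noteq> t \<and> \<bar>F y - F t - h t * (y - t)\<bar> > \<bar>y - t\<bar> / real (Suc n)" for n t y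
  define B where "B n = {t \<in> {c<..<d}. \<forall>\<eta>>0. \<exists>y. bad n t y \<and> \<bar>y - t\<bar> < \<eta>}" for n
  have neg: "negligible (B n)" for n
    unfolding negligible_outer_le
  proof (intro allI impI)
    fix e :: real assume "e > 0"
    \<comment> \<open>The factor \<open>1 / Suc n\<close> of \<open>bad\<close> cancels against this
      one, which leaves total length at most \<open>e\<close>.\<close>
    then have en: "e / Suc n > 0" by simp
    have h': "h integrable_on cbox c d" using h by simp
    obtain \<gamma> where \<gamma>: "gauge \<gamma>" and Hen: "\<And>p. p tagged_partial_division_of (cbox c d) \<Longrightarrow> \<gamma> fine p \<Longrightarrow>
        (\<Sum>(t, k)\<in>p. norm (measure lborel k *\<^sub>R h t - integral k h)) < e / Suc n"
      using Henstock_lemma[OF h' en] by auto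
    \<comment> \<open>The interval between \<open>t\<close> and \<open>y\<close>, written as a ball
      around its midpoint because the covering theorem takes closed balls. The pair is kept as index
      so that \<open>t\<close> can serve as the tag.\<close>
    define I where "I = (\<lambda>(t::real, y). cball ((t + y) / 2) (\<bar>y - t\<bar> / 2))"
    have I: "I (t, y) = {min t y..max t y}" for t y
      by (auto simp: I_def cball_eq_atLeastAtMost abs_if field_simps)
    define K where "K = {(t, y). t \<in> B n \<and> bad n t y \<and> I (t, y) \<subseteq> \<gamma> t}"
    obtain C where C: "countable C" "C \<subseteq> K"
      "pairwise (\<lambda>i j. disjnt (cball ((fst i + snd i) / 2) (\<bar>snd i - fst i\<bar> / 2)) (cball ((fst j + snd j) / 2) (\<bar>snd j - fst j\<bar> / 2))) C"
      "negligible (B n - (\<Union>i\<in>C. cball ((fst i + snd i) / 2) (\<bar>snd i - fst i\<bar> / 2)))"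
    proof (rule Vitali_covering_theorem_cballs[of K "\<lambda>i. \<bar>snd i - fst i\<bar> / 2" "B n" "\<lambda>i. (fst i + snd i) / 2"])
      show "0 < \<bar>snd i - fst i\<bar> / 2" if "i \<in> K" for i
        using that by (auto simp: K_def bad_def)
      fix t \<delta> :: real assume t: "t \<in> B n" and "0 < \<delta>"
      obtain \<eta> where \<eta>: "\<eta> > 0" "ball t \<eta> \<subseteq> \<gamma> t"
        using \<gamma> unfolding gauge_def by (meson openE)
      obtain y where y: "bad n t y" "\<bar>y - t\<bar> < min \<eta> \<delta>"
      proof -
        have "\<forall>\<eta>>0. \<exists>y. bad n t y \<and> \<bar>y - t\<bar> < \<eta>" using t by (simp add: B_def)
        moreover have "min \<eta> \<delta> > 0" using \<eta> \<open>0 < \<delta>\<close> by simp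
        ultimately show ?thesis using that by blast
      qed
      have "I (t, y) \<subseteq> ball t \<eta>"
        using y(2) by (auto simp: I dist_real_def)
      then have "(t, y) \<in> K" using t y \<eta> by (auto simp: K_def)
      moreover have "t \<in> I (t, y)" by (auto simp: I)
      ultimately show "\<exists>i. i \<in> K \<and> t \<in> cball ((fst i + snd i) / 2) (\<bar>snd i - fst i\<bar> / 2) \<and> \<bar>snd i - fst i\<bar> / 2 < \<delta>"
        using y(2) \<open>0 < \<delta>\<close> by (intro exI[of _ "(t, y)"]) (simp add: I_def)
    qed
    have disj: "disjnt (I i) (I j)" if "i \<in> C" "j \<in> C" "i \<noteq> j" for i j
      using C(3) that by (simp add: pairwise_def I_def split_def)
    have negN: "negligible (B n - (\<Union>i\<in>C. I i))"
      using C(4) by (simp add: I_def split_def)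
    \<comment> \<open>Henstock's lemma applies to finite partial divisions. A bound that is uniform
      over the finite subfamilies passes to the countable union.\<close>
    have bound: "measure lebesgue (\<Union>i\<in>C'. I i) \<le> e" if C': "C' \<subseteq> C" "finite C'" for C'
    proof -
      define p where "p = (\<lambda>i. (fst i, I i)) ` C'"
      have inj: "inj_on (\<lambda>i. (fst i, I i)) C'"
      proof (rule inj_onI)
        fix i j assume ij: "i \<in> C'" "j \<in> C'" "(fst i, I i) = (fst j, I j)"
        have "fst i \<in> I i" by (cases i) (auto simp: I)
        then have "\<not> disjnt (I i) (I j)" using ij by (auto simp: disjnt_def)
        then show "i = j" using disj[of i j] ij C' by auto
      qed
      have Kp: "t \<in> {c<..<d} \<and> bad n t y \<and> I (t, y) \<subseteq> \<gamma> t" if "(t, y) \<in> C'" for t y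
        using that C' C(2) by (auto simp: K_def B_def)
      have "p tagged_partial_division_of (cbox c d)"
        unfolding tagged_partial_division_of_def
      proof (intro conjI allI impI)
        show "finite p" using C' by (simp add: p_def)
        fix t k assume "(t, k) \<in> p"
        then obtain y where y: "(t, y) \<in> C'" "k = I (t, y)" by (force simp: p_def)
        show "t \<in> k" "\<exists>a b. k = cbox a b" using y by (auto simp: I)
        show "k \<subseteq> cbox c d" using y Kp[OF y(1)] by (auto simp: I bad_def)
      next
        fix t1 k1 t2 k2 assume "(t1, k1) \<in> p \<and> (t2, k2) \<in> p \<and> (t1, k1) \<noteq> (t2, k2)"
        then obtain i j where ij: "i \<in> C'" "j \<in> C'" "i \<noteq> j" "k1 = I i" "k2 = I j"
          by (auto simp: p_def)
        then have "disjnt k1 k2" using disj[of i j] C' by blast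
        then show "interior k1 \<inter> interior k2 = {}"
          using interior_subset[of k1] interior_subset[of k2] by (auto simp: disjnt_def)
      qed
      moreover have "\<gamma> fine p"
      proof (rule fineI)
        fix t k assume "(t, k) \<in> p"
        then obtain y where y: "(t, y) \<in> C'" "k = I (t, y)" by (force simp: p_def)
        then show "k \<subseteq> \<gamma> t" using Kp[OF y(1)] by simp
      qed
      ultimately have "(\<Sum>(t, k)\<in>p. norm (measure lborel k *\<^sub>R h t - integral k h)) < e / Suc n"
        by (rule Hen)
      moreover have "(\<Sum>(t, k)\<in>p. norm (measure lborel k *\<^sub>R h t - integral k h))
        = (\<Sum>i\<in>C'. norm (measure lborel (I i) *\<^sub>R h (fst i) - integral (I i) h))"
        unfolding p_def by (subst sum.reindex[OF inj]) simp
      moreover have "(\<Sum>i\<in>C'. measure lebesgue (I i) / Suc n) \<le> (\<Sum>i\<in>C'. norm (measure lborel (I i) *\<^sub>R h (fst i) - integral (I i) h))"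
      proof (rule sum_mono)
        fix i assume "i \<in> C'"
        obtain t y where i: "i = (t, y)" by (cases i)
        have ty: "t \<in> {c<..<d}" "bad n t y" using Kp[of t y] \<open>i \<in> C'\<close> i by auto
        have m: "measure lborel (I i) = \<bar>y - t\<bar>" "measure lebesgue (I i) = \<bar>y - t\<bar>"
          using i by (auto simp: I)
        have "integral (I i) h = F (max t y) - F (min t y)"
          unfolding i I using ty by (subst F) (auto simp: bad_def)
        then have "norm (\<bar>y - t\<bar> * h t - integral (I i) h) = \<bar>F y - F t - h t * (y - t)\<bar>"
          by (cases "t \<le> y") (auto simp: max_def min_def abs_if algebra_simps)
        then show "measure lebesgue (I i) / Suc n \<le> norm (measure lborel (I i) *\<^sub>R h (fst i) - integral (I i) h)"
          using ty(2) m by (simp add: bad_def i)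
      qed
      moreover have "(\<Sum>i\<in>C'. measure lebesgue (I i) / Suc n) = (\<Sum>i\<in>C'. measure lebesgue (I i)) / Suc n"
        by (rule sum_divide_distrib[symmetric])
      ultimately have "(\<Sum>i\<in>C'. measure lebesgue (I i)) / Suc n < e / Suc n" by linarith
      then have "(\<Sum>i\<in>C'. measure lebesgue (I i)) \<le> e" by (simp add: divide_less_cancel del: of_nat_Suc)
      moreover have "measure lebesgue (\<Union>i\<in>C'. I i) \<le> (\<Sum>i\<in>C'. measure lebesgue (I i))"
        using C' by (intro measure_UNION_le) (auto simp: I_def)
      ultimately show ?thesis by linarith
    qed
    have UC: "(\<Union>i\<in>C. I i) \<in> lmeasurable" "measure lebesgue (\<Union>i\<in>C. I i) \<le> e"
      using fmeasurable_UN_bound[OF C(1) _ bound] measure_UN_bound[OF C(1) _ bound]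
      by (auto simp: I_def)
    show "\<exists>T. B n \<subseteq> T \<and> T \<in> lmeasurable \<and> measure lebesgue T \<le> e"
    proof (intro exI conjI)
      show "B n \<subseteq> (\<Union>i\<in>C. I i) \<union> (B n - (\<Union>i\<in>C. I i))" by blast
      show "(\<Union>i\<in>C. I i) \<union> (B n - (\<Union>i\<in>C. I i)) \<in> lmeasurable"
        using UC negligible_imp_measurable[OF negN] by blast
      show "measure lebesgue ((\<Union>i\<in>C. I i) \<union> (B n - (\<Union>i\<in>C. I i))) \<le> e"
        using UC negligible_imp_measurable[OF negN] negligible_imp_measure0[OF negN]
          measure_Un_le[of "\<Union>i\<in>C. I i" lebesgue "B n - (\<Union>i\<in>C. I i)"] by auto
    qed
  qed
  show ?thesis
  proof (rule that)
    show "negligible (\<Union>n. B n)" using neg by (rule negligible_Union_nat)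
    fix t assume t: "t \<in> {c<..<d} - (\<Union>n. B n)"
    show "((\<lambda>u. integral {c..u} h) has_real_derivative h t) (at t)"
      unfolding F_def[symmetric] has_field_derivative_def has_derivative_within_alt
    proof (intro conjI allI impI)
      show "bounded_linear ((*) (h t))" by (rule bounded_linear_mult_right)
      fix e :: real assume "e > 0"
      obtain n where n: "inverse (real (Suc n)) < e" using reals_Archimedean[OF \<open>e > 0\<close>] by auto
      have "t \<notin> B n" using t by auto
      moreover have "t \<in> {c<..<d}" using t by simp
      ultimately have "\<not> (\<forall>\<eta>>0. \<exists>y. bad n t y \<and> \<bar>y - t\<bar> < \<eta>)" by (simp only: B_def mem_Collect_eq simp_thms)
      then obtain \<eta> where \<eta>: "\<eta> > 0" "\<And>y. \<bar>y - t\<bar> < \<eta> \<Longrightarrow> \<not> bad n t y" by blast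
      \<comment> \<open>The distances to the endpoints enter because \<open>bad\<close> only speaks
        of \<open>y\<close> inside the open interval.\<close>
      define \<eta>' where "\<eta>' = min \<eta> (min (t - c) (d - t))"
      show "\<exists>\<delta>>0. \<forall>y\<in>UNIV. norm (y - t) < \<delta> \<longrightarrow> norm (F y - F t - h t * (y - t)) \<le> e * norm (y - t)"
      proof (intro exI[of _ \<eta>'] conjI ballI impI)
        show "\<eta>' > 0" using \<eta> t by (auto simp: \<eta>'_def)
        fix y assume y: "norm (y - t) < \<eta>'"
        then have "y \<in> {c<..<d}" "\<not> bad n t y" using \<eta>(2)[of y] by (auto simp: \<eta>'_def abs_if split: if_splits)
        then have "\<bar>F y - F t - h t * (y - t)\<bar> \<le> \<bar>y - t\<bar> * inverse (real (Suc n))"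
          unfolding bad_def by (cases "y = t") (auto simp: divide_inverse)
        also have "\<dots> \<le> \<bar>y - t\<bar> * e" using n by (intro mult_left_mono) auto
        finally show "norm (F y - F t - h t * (y - t)) \<le> e * norm (y - t)" by (simp add: mult.commute)
      qed
    qed
  qed
qed

section \<open>Uniqueness of Caratheodory solutions\<close>

lemma AE_lebesgue_iff_negligible:
  "(AE t in lebesgue. P t) \<longleftrightarrow> (\<exists>E. negligible E \<and> (\<forall>t. t \<notin> E \<longrightarrow> P t))"
  unfolding eventually_ae_filter negligible_iff_null_sets by auto

lemma abs_continuous_imp_continuous_on:
  assumes "abs_continuous_on_interval c d x"
  shows "continuous_on {c..d} x"
  unfolding continuous_on_iff
proof (intro ballI allI impI)
  fix t e :: real assume t: "t \<in> {c..d}" and "e > 0"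
  obtain \<delta> where \<delta>: "\<delta> > 0" and ac: "\<And>D. finite D \<Longrightarrow> (\<forall>(u, v)\<in>D. c \<le> u \<and> u \<le> v \<and> v \<le> d) \<Longrightarrow>
      disjoint_family_on (\<lambda>(u, v). {u<..<v}) D \<Longrightarrow> (\<Sum>(u, v)\<in>D. v - u) < \<delta>
      \<Longrightarrow> (\<Sum>(u, v)\<in>D. \<bar>x v - x u\<bar>) < e"
    using assms \<open>e > 0\<close> unfolding abs_continuous_on_interval_def by meson
  show "\<exists>\<delta>>0. \<forall>y\<in>{c..d}. dist y t < \<delta> \<longrightarrow> dist (x y) (x t) < e"
  proof (intro exI[of _ \<delta>] conjI ballI impI)
    fix y assume y: "y \<in> {c..d}" "dist y t < \<delta>"
    have "(\<Sum>(u, v)\<in>{(min y t, max y t)}. \<bar>x v - x u\<bar>) < e"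
      using y t by (intro ac) (auto simp: disjoint_family_on_def dist_real_def)
    then show "dist (x y) (x t) < e"
      by (auto simp: dist_real_def min_def max_def split: if_splits)
  qed (rule \<delta>)
qed

lemma lipschitz_has_integral:
  fixes \<phi> h :: "real \<Rightarrow> real"
  assumes "M-lipschitz_on {c..d} \<phi>" "c \<le> d" "negligible E"
    "\<And>t. t \<in> {c..d} - E \<Longrightarrow> (\<phi> has_real_derivative h t) (at t within {c..d})"
  shows "(h has_integral \<phi> d - \<phi> c) {c..d}"
  using abs_continuous_has_integral[OF lipschitz_on_imp_abs_continuous] assms by blast

lemma has_integral_bound_negligible:
  fixes h :: "real \<Rightarrow> real"
  assumes h: "(h has_integral i) {c..d}" and "c \<le> d" and E: "negligible E"
    and bd: "\<And>t. t \<in> {c..d} - E \<Longrightarrow> \<bar>h t\<bar> \<le> B" and "B \<ge> 0"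
  shows "\<bar>i\<bar> \<le> B * (d - c)"
proof -
  define g where "g t = (if t \<in> E then 0 else h t)" for t
  have "(g has_integral i) {c..d}"
    by (rule has_integral_spike[OF E _ h]) (simp add: g_def)
  then show ?thesis
    using has_integral_bound[of B g i c d] bd \<open>B \<ge> 0\<close> \<open>c \<le> d\<close> by (simp add: g_def)
qed

lemma has_integral_mono_negligible:
  fixes h g :: "real \<Rightarrow> real"
  assumes "(h has_integral i) S" "(g has_integral j) S" and E: "negligible E"
    and le: "\<And>t. t \<in> S - E \<Longrightarrow> h t \<le> g t"
  shows "i \<le> j"
proof (rule has_integral_le)
  show "((\<lambda>t. if t \<in> E then g t else h t) has_integral i) S"
    by (rule has_integral_spike[OF E _ assms(1)]) simp
qed (use assms in auto)

text \<open>Applied to logarithms of gaps: these remain Lipschitz, so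
  \<open>lipschitz_has_integral\<close> recovers their increments from their almost everywhere
  derivatives.\<close>

lemma lipschitz_on_compose_differentiable:
  fixes \<phi> :: "real \<Rightarrow> real" and G G' :: "real \<Rightarrow> real"
  assumes "M-lipschitz_on S \<phi>" "\<phi> ` S \<subseteq> {p..q}"
    and "\<And>z. z \<in> {p..q} \<Longrightarrow> (G has_real_derivative G' z) (at z)" "\<And>z. z \<in> {p..q} \<Longrightarrow> \<bar>G' z\<bar> \<le> K"
    and "K \<ge> 0"
  shows "(K * M)-lipschitz_on S (\<lambda>t. G (\<phi> t))"
proof (rule lipschitz_on_compose2[OF assms(1)])
  have "K-lipschitz_on {p..q} G"
  proof (rule lipschitz_onI)
    fix y z assume "y \<in> {p..q}" "z \<in> {p..q}"
    then show "dist (G y) (G z) \<le> K * dist y z"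
      unfolding dist_norm
      by (intro field_differentiable_bound[of "{p..q}" G G'])
        (use assms in \<open>auto intro: has_field_derivative_at_within\<close>)
  qed fact
  then show "K-lipschitz_on (\<phi> ` S) G"
    using assms(2) lipschitz_on_subset by blast
qed

lemma is_interval_segment_subset:
  fixes s t :: real
  assumes "is_interval K" "s \<in> K" "t \<in> K"
  shows "{min s t..max s t} \<subseteq> K"
proof
  fix z assume "z \<in> {min s t..max s t}"
  then show "z \<in> K"
    using mem_is_interval_1_I[OF assms(1), of s t z] mem_is_interval_1_I[OF assms(1), of t s z] assms
    by (cases "s \<le> t") auto
qed

text \<open>One exceptional set serves all radii at once, while the bounds depend on the radius. The
  locale is instantiated both for the equation and for its truncation, whose bounds no longer depend
  on the radius.\<close>

locale caratheodory_rhs =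
  fixes F :: "real \<Rightarrow> real \<Rightarrow> real" and N :: "real set" and m l :: "real \<Rightarrow> real"
  assumes rhs_measurable: "(\<lambda>(t, x). F t x) \<in> borel_measurable borel"
    and negligible_N: "negligible N"
    and rhs_bound: "\<And>R t x. t \<notin> N \<Longrightarrow> \<bar>x\<bar> \<le> R \<Longrightarrow> \<bar>F t x\<bar> \<le> m R"
    and rhs_lipschitz: "\<And>R t x y. t \<notin> N \<Longrightarrow> \<bar>x\<bar> \<le> R \<Longrightarrow> \<bar>y\<bar> \<le> R \<Longrightarrow> \<bar>F t x - F t y\<bar> \<le> l R * \<bar>x - y\<bar>"
begin

lemma solution_continuous_on:
  "caratheodory_solution F I x \<Longrightarrow> {c..d} \<subseteq> I \<Longrightarrow> continuous_on {c..d} x"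
  unfolding caratheodory_solution_def using abs_continuous_imp_continuous_on by blast

lemma solution_bound:
  assumes "caratheodory_solution F I x" "{c..d} \<subseteq> I"
  obtains R where "R \<ge> 0" "\<And>t. t \<in> {c..d} \<Longrightarrow> \<bar>x t\<bar> \<le> R"
proof -
  have "bounded (x ` {c..d})"
    using solution_continuous_on[OF assms] compact_continuous_image compact_imp_bounded compact_Icc by blast
  then show ?thesis
    using that unfolding bounded_pos by (metis image_eqI less_imp_le real_norm_def)
qed

text \<open>The exceptional set absorbs \<open>N\<close>, so that off it the equation and the bounds
  on \<open>F\<close> hold together. The quantifier over \<open>S\<close> makes one such set serve
  all subintervals.\<close>

definition solution_off :: "real set \<Rightarrow> real set \<Rightarrow> (real \<Rightarrow> real) \<Rightarrow> bool" where
  "solution_off E I x \<longleftrightarrow> negligible E \<and> N \<subseteq> E \<and>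
    (\<forall>t S. t \<in> S \<longrightarrow> S \<subseteq> I \<longrightarrow> t \<notin> E \<longrightarrow> (x has_real_derivative F t (x t)) (at t within S))"

lemma solution_offD:
  assumes "solution_off E I x"
  shows "negligible E" "N \<subseteq> E"
    "t \<in> S \<Longrightarrow> S \<subseteq> I \<Longrightarrow> t \<notin> E \<Longrightarrow> (x has_real_derivative F t (x t)) (at t within S)"
  using assms unfolding solution_off_def by simp_all

lemma solution_derivative:
  assumes "caratheodory_solution F I x"
  obtains E where "solution_off E I x"
proof -
  obtain E where E: "negligible E" "\<And>t. t \<notin> E \<Longrightarrow> t \<in> I \<Longrightarrow> (x has_real_derivative F t (x t)) (at t within I)"
    using assms unfolding caratheodory_solution_def AE_lebesgue_iff_negligible by blast
  have "(x has_real_derivative F t (x t)) (at t within S)" if "t \<in> S" "S \<subseteq> I" "t \<notin> E \<union> N" for t S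
    using E(2)[of t] that DERIV_subset by blast
  then have "solution_off (E \<union> N) I x"
    using E negligible_N unfolding solution_off_def by simp
  then show ?thesis by (rule that)
qed

lemma solution_has_integral:
  assumes x: "caratheodory_solution F I x" and cd: "{c..d} \<subseteq> I" "c \<le> d"
  shows "((\<lambda>t. F t (x t)) has_integral x d - x c) {c..d}"
proof -
  obtain E where "solution_off E I x" by (rule solution_derivative[OF x])
  note E = solution_offD[OF this]
  have "abs_continuous_on_interval c d x"
    using x cd unfolding caratheodory_solution_def by blast
  then show ?thesis
    by (rule abs_continuous_has_integral[OF _ cd(2) E(1)]) (use cd in \<open>auto intro!: E(3)\<close>)
qed

text \<open>The right-hand side is bounded along a bounded solution. The gain over absolute
  continuity is that smooth functions of solutions are then again Lipschitz.\<close>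

lemma solution_lipschitz:
  assumes x: "caratheodory_solution F I x" and cd: "{c..d} \<subseteq> I"
    and R: "\<And>t. t \<in> {c..d} \<Longrightarrow> \<bar>x t\<bar> \<le> R"
  shows "\<bar>m R\<bar>-lipschitz_on {c..d} x"
proof (rule lipschitz_on_leI)
  fix u v assume uv: "u \<in> {c..d}" "v \<in> {c..d}" "u \<le> v"
  then have sub: "{u..v} \<subseteq> {c..d}" by auto
  have "((\<lambda>t. F t (x t)) has_integral x v - x u) {u..v}"
    using sub cd uv(3) by (intro solution_has_integral[OF x]) auto
  then have "\<bar>x v - x u\<bar> \<le> \<bar>m R\<bar> * (v - u)"
  proof (rule has_integral_bound_negligible[OF _ _ negligible_N])
    fix t assume "t \<in> {u..v} - N"
    then have "t \<notin> N" "\<bar>x t\<bar> \<le> R" using sub R by auto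
    then show "\<bar>F t (x t)\<bar> \<le> \<bar>m R\<bar>" using rhs_bound by fastforce
  qed (use uv in auto)
  then show "dist (x u) (x v) \<le> \<bar>m R\<bar> * dist u v"
    using uv by (simp add: dist_real_def abs_minus_commute)
qed simp

text \<open>A Gronwall argument that works in both time directions and needs no division by zero:
  with \<open>w = p - q\<close>, the derivative of \<open>ln (w\<^sup>2 + \<eta>)\<close> is at most
  \<open>2 * L\<close> in absolute value whatever \<open>\<eta> > 0\<close> is. If \<open>w\<close>
  vanishes at one end, \<open>w\<^sup>2 + \<eta>\<close> is at most \<open>\<eta>\<close> times a
  fixed factor; then \<open>\<eta>\<close> tends to 0.\<close>

lemma solution_unique:
  assumes p: "caratheodory_solution F I p" and q: "caratheodory_solution F J q"
    and cd: "{c..d} \<subseteq> I" "{c..d} \<subseteq> J" "c \<le> d" and eq: "p c = q c \<or> p d = q d" and t: "t \<in> {c..d}"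
  shows "p t = q t"
proof -
  obtain Rp where Rp: "\<And>t. t \<in> {c..d} \<Longrightarrow> \<bar>p t\<bar> \<le> Rp" using solution_bound[OF p cd(1)] by blast
  obtain Rq where Rq: "\<And>t. t \<in> {c..d} \<Longrightarrow> \<bar>q t\<bar> \<le> Rq" using solution_bound[OF q cd(2)] by blast
  define R where "R = max 0 (max Rp Rq)"
  have R: "\<bar>p t\<bar> \<le> R" "\<bar>q t\<bar> \<le> R" "R \<ge> 0" if "t \<in> {c..d}" for t
    using Rp[OF that] Rq[OF that] by (auto simp: R_def)
  obtain Ep where "solution_off Ep I p" by (rule solution_derivative[OF p])
  note Ep = solution_offD[OF this]
  obtain Eq where "solution_off Eq J q" by (rule solution_derivative[OF q])
  note Eq = solution_offD[OF this]
  define w where "w t = p t - q t" for t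
  define L where "L = \<bar>l R\<bar>"
  have wlip: "(\<bar>m R\<bar> + \<bar>m R\<bar>)-lipschitz_on {c..d} w"
    unfolding w_def
    by (intro lipschitz_on_diff solution_lipschitz[OF p cd(1)] solution_lipschitz[OF q cd(2)] R)
  have key: "\<bar>ln ((w v)\<^sup>2 + \<eta>) - ln ((w u)\<^sup>2 + \<eta>)\<bar> \<le> 2 * L * (v - u)"
    if uv: "c \<le> u" "u \<le> v" "v \<le> d" and \<eta>: "\<eta> > 0" for u v \<eta>
  proof -
    have sub: "{u..v} \<subseteq> {c..d}" using uv by auto
    have der: "((\<lambda>z. ln (z\<^sup>2 + \<eta>)) has_real_derivative 2 * z / (z\<^sup>2 + \<eta>)) (at z)" for z
      using \<eta> by (auto intro!: derivative_eq_intros simp: add_nonneg_pos)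
    have "(4 * R / \<eta> * (\<bar>m R\<bar> + \<bar>m R\<bar>))-lipschitz_on {u..v} (\<lambda>t. ln ((w t)\<^sup>2 + \<eta>))"
    proof (rule lipschitz_on_compose_differentiable[where p = "-(2*R)" and q = "2*R", OF _ _ der])
      show "(\<bar>m R\<bar> + \<bar>m R\<bar>)-lipschitz_on {u..v} w" using wlip sub lipschitz_on_subset by blast
      show "w ` {u..v} \<subseteq> {- (2 * R)..2 * R}"
      proof safe
        fix t assume "t \<in> {u..v}"
        then have "\<bar>p t\<bar> \<le> R" "\<bar>q t\<bar> \<le> R" using R sub by auto
        then show "w t \<in> {- (2 * R)..2 * R}" by (simp add: w_def abs_le_iff)
      qed
      show "0 \<le> 4 * R / \<eta>" using \<eta> R t by simp
      fix z assume "z \<in> {- (2 * R)..2 * R}"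
      then have "\<bar>2 * z\<bar> \<le> 4 * R" by (simp add: abs_le_iff)
      then have "\<bar>2 * z\<bar> / (z\<^sup>2 + \<eta>) \<le> 4 * R / \<eta>" using \<eta> R t by (intro frac_le) auto
      then show "\<bar>2 * z / (z\<^sup>2 + \<eta>)\<bar> \<le> 4 * R / \<eta>" using \<eta> by simp
    qed
    then have "((\<lambda>t. 2 * w t / ((w t)\<^sup>2 + \<eta>) * (F t (p t) - F t (q t))) has_integral ln ((w v)\<^sup>2 + \<eta>) - ln ((w u)\<^sup>2 + \<eta>)) {u..v}"
    proof (rule lipschitz_has_integral)
      show "negligible (Ep \<union> Eq)" using Ep Eq by simp
      fix t assume t: "t \<in> {u..v} - (Ep \<union> Eq)"
      have "(w has_real_derivative F t (p t) - F t (q t)) (at t within {u..v})"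
        unfolding w_def using t sub cd by (intro DERIV_diff Ep(3) Eq(3)) auto
      then show "((\<lambda>t. ln ((w t)\<^sup>2 + \<eta>)) has_real_derivative 2 * w t / ((w t)\<^sup>2 + \<eta>) * (F t (p t) - F t (q t))) (at t within {u..v})"
        using DERIV_chain2[OF der] by blast
    qed (use uv in auto)
    then show ?thesis
    proof (rule has_integral_bound_negligible[OF _ _ Ep(1)])
      fix t assume t: "t \<in> {u..v} - Ep"
      then have "\<bar>F t (p t) - F t (q t)\<bar> \<le> L * \<bar>w t\<bar>"
        using rhs_lipschitz[of t "p t" R "q t"] R[of t] sub Ep(2) unfolding L_def w_def
        by (smt (verit) DiffE mult_right_mono subsetD)
      then have "\<bar>2 * w t / ((w t)\<^sup>2 + \<eta>)\<bar> * \<bar>F t (p t) - F t (q t)\<bar> \<le> \<bar>2 * w t / ((w t)\<^sup>2 + \<eta>)\<bar> * (L * \<bar>w t\<bar>)"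
        by (intro mult_left_mono) auto
      also have "\<dots> = 2 * L * ((w t)\<^sup>2 / ((w t)\<^sup>2 + \<eta>))"
        using \<eta> by (simp add: abs_mult power2_eq_square)
      also have "\<dots> \<le> 2 * L * 1"
        using \<eta> by (intro mult_left_mono) (auto simp: L_def add_nonneg_pos divide_le_eq_1)
      finally show "\<bar>2 * w t / ((w t)\<^sup>2 + \<eta>) * (F t (p t) - F t (q t))\<bar> \<le> 2 * L"
        by (simp add: abs_mult)
    qed (use uv in \<open>auto simp: L_def\<close>)
  qed
  obtain s where s: "s = c \<or> s = d" "w s = 0" using eq by (auto simp: w_def)
  have "(w t)\<^sup>2 \<le> \<eta>" if "\<eta> > 0" for \<eta>
  proof -
    \<comment> \<open>Divided by the largest growth factor over the interval, so that the final
      bound is exactly \<open>\<eta>\<close>.\<close>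
    define \<eta>' where "\<eta>' = \<eta> / exp (2 * L * (d - c))"
    have \<eta>': "\<eta>' > 0" using that by (simp add: \<eta>'_def)
    have "\<bar>ln ((w t)\<^sup>2 + \<eta>') - ln \<eta>'\<bar> \<le> 2 * L * \<bar>t - s\<bar>"
      using key[of s t \<eta>'] key[of t s \<eta>'] \<eta>' t s by (auto simp: abs_minus_commute)
    also have "\<dots> \<le> 2 * L * (d - c)"
      using t s by (intro mult_left_mono) (auto simp: L_def)
    finally have "ln ((w t)\<^sup>2 + \<eta>') \<le> 2 * L * (d - c) + ln \<eta>'" by linarith
    then have "exp (ln ((w t)\<^sup>2 + \<eta>')) \<le> exp (2 * L * (d - c) + ln \<eta>')" by simp
    moreover have "(w t)\<^sup>2 + \<eta>' > 0" using \<eta>' by (simp add: add_nonneg_pos)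
    ultimately have "(w t)\<^sup>2 + \<eta>' \<le> exp (2 * L * (d - c) + ln \<eta>')" by simp
    also have "\<dots> = \<eta>" using \<eta>' by (simp add: exp_add \<eta>'_def)
    finally show ?thesis using \<eta>' by linarith
  qed
  then have "(w t)\<^sup>2 \<le> 0" using field_le_epsilon[of "(w t)\<^sup>2" 0] by auto
  then show ?thesis by (simp add: w_def)
qed

lemma solution_unique':
  assumes p: "caratheodory_solution F I p" and q: "caratheodory_solution F J q"
    and st: "s \<in> I" "s \<in> J" "t \<in> I" "t \<in> J" and eq: "p s = q s"
  shows "p t = q t"
proof -
  have "{min s t..max s t} \<subseteq> I" "{min s t..max s t} \<subseteq> J"
    using p q st by (intro is_interval_segment_subset; simp add: caratheodory_solution_def)+
  then show ?thesis
    using solution_unique[OF p q, of "min s t" "max s t" t] eq by (auto simp: min_def max_def split: if_splits)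
qed

text \<open>A change of order would force a crossing by continuity, and solutions that cross once
  coincide.\<close>

lemma solution_less:
  assumes p: "caratheodory_solution F I p" and q: "caratheodory_solution F I q"
    and st: "s \<in> I" "t \<in> I" and less: "p s < q s"
  shows "p t < q t"
proof (rule ccontr)
  assume "\<not> p t < q t"
  have sub: "{min s t..max s t} \<subseteq> I"
    using p st by (intro is_interval_segment_subset) (auto simp: caratheodory_solution_def)
  have cont: "continuous_on {min s t..max s t} (\<lambda>u. q u - p u)"
    by (rule continuous_on_diff[OF solution_continuous_on[OF q sub] solution_continuous_on[OF p sub]])
  have "connected ((\<lambda>u. q u - p u) ` {min s t..max s t})"
    by (rule connected_continuous_image[OF cont connected_Icc])
  moreover have "q s - p s \<in> (\<lambda>u. q u - p u) ` {min s t..max s t}" "q t - p t \<in> (\<lambda>u. q u - p u) ` {min s t..max s t}" by auto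
  ultimately have "0 \<in> (\<lambda>u. q u - p u) ` {min s t..max s t}"
    unfolding connected_iff_interval using less \<open>\<not> p t < q t\<close> by (smt (verit))
  then obtain u where "u \<in> {min s t..max s t}" "p u = q u" by auto
  then have "p s = q s" using solution_unique'[OF p q, of u s] st sub by auto
  then show False using less by simp
qed

end

section \<open>Global solutions of the truncated equation\<close>

lemma set_integrable_bounded_off_negligible:
  fixes h :: "real \<Rightarrow> real"
  assumes "h \<in> borel_measurable lebesgue" "negligible E" "\<And>t. t \<notin> E \<Longrightarrow> t \<in> {c..d} \<Longrightarrow> \<bar>h t\<bar> \<le> B"
  shows "set_integrable lebesgue {c..d} h"
proof (rule set_integrable_bound)
  show "set_integrable lebesgue {c..d} (\<lambda>_. B)"
    using integrable_on_const[of "cbox c d" B] absolutely_integrable_on_const[of "{c..d}" B] by simp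
  show "set_borel_measurable lebesgue {c..d} h"
    unfolding set_borel_measurable_def
    by (intro borel_measurable_scaleR borel_measurable_indicator assms(1)) simp
  show "AE t in lebesgue. t \<in> {c..d} \<longrightarrow> norm (h t) \<le> norm B"
    unfolding AE_lebesgue_iff_negligible using assms(2,3) by fastforce
qed

lemma integrable_bounded_off_negligible:
  fixes h :: "real \<Rightarrow> real"
  assumes "h \<in> borel_measurable lebesgue" "negligible E" "\<And>t. t \<notin> E \<Longrightarrow> t \<in> {c..d} \<Longrightarrow> \<bar>h t\<bar> \<le> B"
  shows "h integrable_on {c..d}"
  using set_lebesgue_integral_eq_integral(1)[OF set_integrable_bounded_off_negligible[OF assms]] by simp

text \<open>The interval \<open>{s..t}\<close> is empty for t < s. The sign convention gives one
  primitive on both sides of \<open>s\<close>, as a Picard operator on the whole line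
  requires.\<close>

definition oriented_integral :: "(real \<Rightarrow> real) \<Rightarrow> real \<Rightarrow> real \<Rightarrow> real" where
  "oriented_integral h s t = (if s \<le> t then integral {s..t} h else - integral {t..s} h)"

lemma oriented_integral_diff:
  assumes h: "\<And>c d. h integrable_on {c..d}" and "u \<le> v"
  shows "oriented_integral h s v - oriented_integral h s u = integral {u..v} h"
proof -
  note ic = Henstock_Kurzweil_Integration.integral_combine[OF _ _ h]
  consider "s \<le> u" | "u < s" "s \<le> v" | "v < s" by linarith
  then show ?thesis
  proof cases
    case 1 then show ?thesis using ic[of s u v] \<open>u \<le> v\<close> by (simp add: oriented_integral_def)
  next
    case 2 then show ?thesis using ic[of u s v] by (simp add: oriented_integral_def)
  next
    case 3 then show ?thesis using ic[of u v s] \<open>u \<le> v\<close> by (simp add: oriented_integral_def)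
  qed
qed

lemma oriented_integral_bound:
  assumes h: "\<And>c d. h integrable_on {c..d}" and g: "(g has_integral j) {min s t..max s t}"
    and E: "negligible E" and le: "\<And>\<tau>. \<tau> \<notin> E \<Longrightarrow> \<bar>h \<tau>\<bar> \<le> g \<tau>"
  shows "\<bar>oriented_integral h s t\<bar> \<le> j"
proof -
  define i where "i = integral {min s t..max s t} h"
  have hi: "(h has_integral i) {min s t..max s t}" unfolding i_def using h by blast
  have "i \<le> j" by (rule has_integral_mono_negligible[OF hi g E]) (use le in \<open>simp add: abs_le_iff\<close>)
  moreover have "- i \<le> j"
    by (rule has_integral_mono_negligible[OF has_integral_neg[OF hi] g E]) (use le in \<open>simp add: abs_le_iff\<close>)
  moreover have "\<bar>oriented_integral h s t\<bar> = \<bar>i\<bar>"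
    by (auto simp: oriented_integral_def i_def min_def max_def)
  ultimately show ?thesis by linarith
qed

lemma oriented_integral_lipschitz:
  assumes h: "\<And>c d. h integrable_on {c..d}" and E: "negligible E"
    and bd: "\<And>\<tau>. \<tau> \<notin> E \<Longrightarrow> \<bar>h \<tau>\<bar> \<le> M" and "M \<ge> 0"
  shows "M-lipschitz_on S (oriented_integral h s)"
proof (rule lipschitz_on_leI)
  fix u v :: real assume "u \<le> v"
  have "\<bar>integral {u..v} h\<bar> \<le> M * (v - u)"
    using h \<open>u \<le> v\<close> \<open>M \<ge> 0\<close> bd
    by (intro has_integral_bound_negligible[OF integrable_integral _ E]) auto
  then show "dist (oriented_integral h s u) (oriented_integral h s v) \<le> M * dist u v"
    using oriented_integral_diff[OF h \<open>u \<le> v\<close>, of s] \<open>u \<le> v\<close> by (simp add: dist_real_def)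
qed (rule \<open>M \<ge> 0\<close>)

lemma oriented_integral_derivative:
  assumes h: "\<And>c d. h integrable_on {c..d}"
  obtains E where "negligible E" "\<And>t. t \<notin> E \<Longrightarrow> (oriented_integral h s has_real_derivative h t) (at t)"
proof -
  have "\<exists>E. negligible E \<and> (\<forall>t\<in>{- real n<..<real n} - E. ((\<lambda>u. integral {- real n..u} h) has_real_derivative h t) (at t))" for n
    using integral_differentiable_off_negligible[OF h[of "- real n" "real n"]] by metis
  then obtain E where E: "\<And>n. negligible (E n)"
    "\<And>n t. t \<in> {- real n<..<real n} - E n \<Longrightarrow> ((\<lambda>u. integral {- real n..u} h) has_real_derivative h t) (at t)"
    by metis
  show ?thesis
  proof (rule that)
    show "negligible (\<Union>n. E n)" using E(1) by (rule negligible_Union_nat)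
    fix t assume t: "t \<notin> (\<Union>n. E n)"
    obtain n where n: "\<bar>t\<bar> < real n" using reals_Archimedean2 by blast
    have "((\<lambda>u. oriented_integral h s (- real n) + integral {- real n..u} h) has_real_derivative 0 + h t) (at t)"
      using t n by (intro DERIV_add DERIV_const E(2)) auto
    then have "((\<lambda>u. oriented_integral h s (- real n) + integral {- real n..u} h) has_real_derivative h t) (at t)"
      by simp
    then show "(oriented_integral h s has_real_derivative h t) (at t)"
    proof (rule has_field_derivative_transform_within_open)
      show "open {- real n<..<real n}" "t \<in> {- real n<..<real n}" using n by auto
      fix u assume "u \<in> {- real n<..<real n}"
      then have "- real n \<le> u" by simp
      from oriented_integral_diff[OF h this, of s]
      show "oriented_integral h s (- real n) + integral {- real n..u} h = oriented_integral h s u" by simp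
    qed
  qed
qed

text \<open>Integrating the weight reproduces it with a factor \<open>1 / K\<close>; this factor is
  the source of the contraction.\<close>

lemma has_integral_exp_weight:
  fixes s t K :: real
  assumes "K > 0"
  shows "((\<lambda>\<tau>. exp (K * \<bar>\<tau> - s\<bar>)) has_integral (exp (K * \<bar>t - s\<bar>) - 1) / K) {min s t..max s t}"
proof (cases "s \<le> t")
  case True
  have "((\<lambda>\<tau>. exp (K * (\<tau> - s))) has_integral exp (K * (t - s)) / K - exp (K * (s - s)) / K) {s..t}"
    using assms True
    by (intro fundamental_theorem_of_calculus)
      (auto intro!: derivative_eq_intros simp: has_real_derivative_iff_has_vector_derivative[symmetric])
  then have "((\<lambda>\<tau>. exp (K * (\<tau> - s))) has_integral (exp (K * \<bar>t - s\<bar>) - 1) / K) {s..t}"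
    using True by (simp add: diff_divide_distrib)
  then show ?thesis
    using True by (subst has_integral_cong[where g = "\<lambda>\<tau>. exp (K * (\<tau> - s))"]) auto
next
  case False
  have "((\<lambda>\<tau>. exp (K * (s - \<tau>))) has_integral - exp (K * (s - s)) / K - - exp (K * (s - t)) / K) {t..s}"
    using assms False
    by (intro fundamental_theorem_of_calculus)
      (auto intro!: derivative_eq_intros simp: has_real_derivative_iff_has_vector_derivative[symmetric])
  then have "((\<lambda>\<tau>. exp (K * (s - \<tau>))) has_integral (exp (K * \<bar>t - s\<bar>) - 1) / K) {t..s}"
    using False by (simp add: diff_divide_distrib abs_if)
  then show ?thesis
    using False by (subst has_integral_cong[where g = "\<lambda>\<tau>. exp (K * (s - \<tau>))"]) auto
qed

lemma measurable_rhs_along: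
  fixes F :: "real \<Rightarrow> real \<Rightarrow> real"
  assumes F: "(\<lambda>(t, x). F t x) \<in> borel_measurable borel" and u: "continuous_on UNIV u"
  shows "(\<lambda>t. F t (u t)) \<in> borel_measurable borel"
proof -
  have "(\<lambda>t. (t, u t)) \<in> borel_measurable borel"
    using u by (intro borel_measurable_continuous_onI continuous_intros)
  from measurable_compose[OF this F] show ?thesis by simp
qed

text \<open>Banach's fixed point theorem applied to \<open>u(t) = exp(-K|t - s|) (x(t) - x0)\<close>: with the
  exponential weight the Picard operator contracts on the whole line at once.\<close>

lemma picard_global:
  fixes F :: "real \<Rightarrow> real \<Rightarrow> real"
  assumes meas: "(\<lambda>(t, x). F t x) \<in> borel_measurable borel" and N: "negligible N"
    and bd: "\<And>t x. t \<notin> N \<Longrightarrow> \<bar>F t x\<bar> \<le> M"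
    and lip: "\<And>t x y. t \<notin> N \<Longrightarrow> \<bar>F t x - F t y\<bar> \<le> L * \<bar>x - y\<bar>"
  obtains x where "caratheodory_solution F UNIV x" "x s = x0"
proof -
  obtain t0 where "t0 \<notin> N" using N by (metis UNIV_eq_I non_negligible_UNIV)
  have "M \<ge> 0" using bd[OF \<open>t0 \<notin> N\<close>, of 0] by linarith
  have "L \<ge> 0" using lip[OF \<open>t0 \<notin> N\<close>, of 1 0] by simp
  \<comment> \<open>Makes \<open>L / K\<close> at most 1/2, the contraction constant, and keeps
    \<open>K\<close> positive when \<open>L = 0\<close>.\<close>
  define K where "K = 2 * L + 1"
  have K: "K > 0" using \<open>L \<ge> 0\<close> by (simp add: K_def)
  have int: "(\<lambda>\<tau>. F \<tau> (y \<tau>)) integrable_on {c..d}" if "continuous_on UNIV y" for y c d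
    using measurable_rhs_along[OF meas that] bd
    by (intro integrable_bounded_off_negligible[OF _ N]) (auto intro: measurable_completion)
  have cont: "continuous_on UNIV (oriented_integral (\<lambda>\<tau>. F \<tau> (y \<tau>)) s)" if "continuous_on UNIV y" for y
    by (rule lipschitz_on_continuous_on[OF oriented_integral_lipschitz[OF int[OF that] N _ \<open>M \<ge> 0\<close>]]) (rule bd)
  define Y where "Y u \<tau> = x0 + exp (K * \<bar>\<tau> - s\<bar>) * apply_bcontfun u \<tau>" for u \<tau>
  have contY: "continuous_on UNIV (Y u)" for u
    unfolding Y_def by (intro continuous_intros continuous_on_apply_bcontfun)
  define G where "G u t = oriented_integral (\<lambda>\<tau>. F \<tau> (Y u \<tau>)) s t" for u t
  define T where "T u t = exp (- (K * \<bar>t - s\<bar>)) * G u t" for u t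
  have "T u \<in> bcontfun" for u
    unfolding bcontfun_def mem_Collect_eq
  proof
    have "continuous_on UNIV (G u)" unfolding G_def using cont[OF contY] by simp
    then show "continuous_on UNIV (T u)" unfolding T_def by (intro continuous_intros)
    show "bounded (range (T u))"
    proof (rule boundedI[of _ "M / K"])
      fix z assume "z \<in> range (T u)"
      then obtain t where z: "z = T u t" by auto
      have "((\<lambda>_. M) has_integral (max s t - min s t) *\<^sub>R M) {min s t..max s t}"
        by (rule has_integral_const_real[THEN has_integral_eq_rhs]) simp
      then have "\<bar>G u t\<bar> \<le> (max s t - min s t) *\<^sub>R M"
        unfolding G_def using bd by (intro oriented_integral_bound[OF int[OF contY] _ N])
      then have "\<bar>G u t\<bar> \<le> M * \<bar>t - s\<bar>" by (simp add: max_def min_def abs_if mult.commute split: if_splits)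
      also have "\<dots> = M / K * (K * \<bar>t - s\<bar>)" using K by simp
      also have "\<dots> \<le> M / K * exp (K * \<bar>t - s\<bar>)"
      proof (rule mult_left_mono)
        show "K * \<bar>t - s\<bar> \<le> exp (K * \<bar>t - s\<bar>)"
          using exp_ge_add_one_self[of "K * \<bar>t - s\<bar>"] by linarith
      qed (use K \<open>M \<ge> 0\<close> in auto)
      finally have "exp (- (K * \<bar>t - s\<bar>)) * \<bar>G u t\<bar> \<le> exp (- (K * \<bar>t - s\<bar>)) * (M / K * exp (K * \<bar>t - s\<bar>))"
        by (intro mult_left_mono) auto
      then show "norm z \<le> M / K" by (simp add: z T_def abs_mult exp_minus field_simps)
    qed
  qed
  then have app: "apply_bcontfun (Bcontfun (T u)) = T u" for u by (rule Bcontfun_inverse)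
  have "dist (Bcontfun (T u)) (Bcontfun (T v)) \<le> 1/2 * dist u v" for u v
  proof (rule dist_bound)
    fix t
    have G: "oriented_integral (\<lambda>\<tau>. F \<tau> (Y u \<tau>) - F \<tau> (Y v \<tau>)) s t = G u t - G v t"
      using int[OF contY] by (simp add: G_def oriented_integral_def integral_diff)
    have "\<bar>oriented_integral (\<lambda>\<tau>. F \<tau> (Y u \<tau>) - F \<tau> (Y v \<tau>)) s t\<bar> \<le> L * dist u v * ((exp (K * \<bar>t - s\<bar>) - 1) / K)"
    proof (rule oriented_integral_bound[OF _ _ N])
      show "(\<lambda>\<tau>. F \<tau> (Y u \<tau>) - F \<tau> (Y v \<tau>)) integrable_on {c..d}" for c d
        using int[OF contY] by (intro integrable_diff)
      show "((\<lambda>\<tau>. L * dist u v * exp (K * \<bar>\<tau> - s\<bar>)) has_integral L * dist u v * ((exp (K * \<bar>t - s\<bar>) - 1) / K)) {min s t..max s t}"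
        by (rule has_integral_mult_right[OF has_integral_exp_weight[OF K]])
      fix \<tau> assume "\<tau> \<notin> N"
      then have "\<bar>F \<tau> (Y u \<tau>) - F \<tau> (Y v \<tau>)\<bar> \<le> L * \<bar>Y u \<tau> - Y v \<tau>\<bar>" by (rule lip)
      also have "\<bar>Y u \<tau> - Y v \<tau>\<bar> = exp (K * \<bar>\<tau> - s\<bar>) * dist (u \<tau>) (v \<tau>)"
        by (simp add: Y_def dist_real_def right_diff_distrib[symmetric] abs_mult)
      also have "L * \<dots> \<le> L * (exp (K * \<bar>\<tau> - s\<bar>) * dist u v)"
        using \<open>L \<ge> 0\<close> dist_bounded[of u \<tau> v] by (intro mult_left_mono) auto
      finally show "\<bar>F \<tau> (Y u \<tau>) - F \<tau> (Y v \<tau>)\<bar> \<le> L * dist u v * exp (K * \<bar>\<tau> - s\<bar>)"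
        by (simp add: mult_ac)
    qed
    also have "L * dist u v * ((exp (K * \<bar>t - s\<bar>) - 1) / K) \<le> 1/2 * dist u v * exp (K * \<bar>t - s\<bar>)"
    proof -
      have "L / K \<le> 1/2" using K \<open>L \<ge> 0\<close> by (simp add: K_def field_simps)
      then have "L / K * (dist u v * (exp (K * \<bar>t - s\<bar>) - 1)) \<le> 1/2 * (dist u v * (exp (K * \<bar>t - s\<bar>) - 1))"
        using K by (intro mult_right_mono mult_nonneg_nonneg) auto
      also have "\<dots> \<le> 1/2 * (dist u v * exp (K * \<bar>t - s\<bar>))"
        by (intro mult_left_mono) auto
      finally show ?thesis by (simp add: mult_ac)
    qed
    finally have "\<bar>G u t - G v t\<bar> \<le> 1/2 * dist u v * exp (K * \<bar>t - s\<bar>)" by (simp only: G)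
    then have "exp (- (K * \<bar>t - s\<bar>)) * \<bar>G u t - G v t\<bar> \<le> exp (- (K * \<bar>t - s\<bar>)) * (1/2 * dist u v * exp (K * \<bar>t - s\<bar>))"
      by (intro mult_left_mono) auto
    also have "\<dots> = 1/2 * dist u v" by (simp add: exp_minus field_simps)
    finally show "dist (Bcontfun (T u) t) (Bcontfun (T v) t) \<le> 1/2 * dist u v"
      by (simp add: app T_def dist_real_def right_diff_distrib[symmetric] abs_mult)
  qed
  then obtain u where u: "Bcontfun (T u) = u"
    using banach_fix_type[of "1/2" "\<lambda>u. Bcontfun (T u)"] by auto
  have "Y u t = x0 + oriented_integral (\<lambda>\<tau>. F \<tau> (Y u \<tau>)) s t" for t
  proof -
    have "u t = T u t" using u app by metis
    then have "Y u t = x0 + exp (K * \<bar>t - s\<bar>) * T u t" by (simp add: Y_def)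
    then show ?thesis by (simp add: T_def G_def exp_minus field_simps)
  qed
  then have Yeq: "Y u = (\<lambda>t. x0 + oriented_integral (\<lambda>\<tau>. F \<tau> (Y u \<tau>)) s t)" by blast
  show ?thesis
  proof (rule that)
    show "Y u s = x0" by (subst Yeq) (simp add: oriented_integral_def)
    have "abs_continuous_on_interval c d (Y u)" for c d
    proof (rule lipschitz_on_imp_abs_continuous)
      have "(0 + M)-lipschitz_on {c..d} (\<lambda>t. x0 + oriented_integral (\<lambda>\<tau>. F \<tau> (Y u \<tau>)) s t)"
        using bd by (intro lipschitz_on_add lipschitz_on_constant oriented_integral_lipschitz[OF int[OF contY] N _ \<open>M \<ge> 0\<close>])
      then show "M-lipschitz_on {c..d} (Y u)" by (simp only: Yeq[symmetric] add_0)
    qed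
    moreover obtain E where E: "negligible E"
      "\<And>t. t \<notin> E \<Longrightarrow> (oriented_integral (\<lambda>\<tau>. F \<tau> (Y u \<tau>)) s has_real_derivative F t (Y u t)) (at t)"
      using oriented_integral_derivative[OF int[OF contY], where s = s] by metis
    have "(Y u has_real_derivative F t (Y u t)) (at t)" if "t \<notin> E" for t
      using DERIV_add[OF DERIV_const[of x0] E(2)[OF that]] by (simp only: Yeq[symmetric] add_0)
    then have "AE t in lebesgue. t \<in> UNIV \<longrightarrow> (Y u has_real_derivative F t (Y u t)) (at t)"
      unfolding AE_lebesgue_iff_negligible using E(1) by blast
    ultimately show "caratheodory_solution F UNIV (Y u)"
      by (simp add: caratheodory_solution_def)
  qed
qed

text \<open>Clamping the space variable turns the bounds at radius \<open>R\<close> into global ones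
  and does not affect solutions that stay in [-R, R].\<close>

definition truncate :: "real \<Rightarrow> (real \<Rightarrow> real \<Rightarrow> real) \<Rightarrow> real \<Rightarrow> real \<Rightarrow> real" where
  "truncate R F t x = F t (max (- R) (min R x))"

context caratheodory_rhs
begin

lemma caratheodory_rhs_truncate:
  assumes "R \<ge> 0"
  shows "caratheodory_rhs (truncate R F) N (\<lambda>_. m R) (\<lambda>_. \<bar>l R\<bar>)"
proof
  have "(\<lambda>p. (fst p, max (- R) (min R (snd p)))) \<in> borel_measurable (borel :: (real \<times> real) measure)"
    by (intro borel_measurable_continuous_onI continuous_intros)
  from measurable_compose[OF this rhs_measurable]
  show "(\<lambda>(t, x). truncate R F t x) \<in> borel_measurable borel" by (simp add: truncate_def split_def)
  show "negligible N" by (rule negligible_N)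
  show "\<bar>truncate R F t x\<bar> \<le> m R" if "t \<notin> N" for t x
    unfolding truncate_def using assms that by (intro rhs_bound) auto
  show "\<bar>truncate R F t x - truncate R F t y\<bar> \<le> \<bar>l R\<bar> * \<bar>x - y\<bar>" if "t \<notin> N" for t x y
  proof -
    have "\<bar>truncate R F t x - truncate R F t y\<bar> \<le> l R * \<bar>max (- R) (min R x) - max (- R) (min R y)\<bar>"
      unfolding truncate_def using assms that by (intro rhs_lipschitz) auto
    also have "\<dots> \<le> \<bar>l R\<bar> * \<bar>max (- R) (min R x) - max (- R) (min R y)\<bar>"
      by (intro mult_right_mono) auto
    also have "\<dots> \<le> \<bar>l R\<bar> * \<bar>x - y\<bar>"
      by (intro mult_left_mono) (auto simp: min_def max_def)
    finally show ?thesis .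
  qed
qed

lemma truncate_global_solution:
  assumes "R \<ge> 0"
  obtains x where "caratheodory_solution (truncate R F) UNIV x" "x s = x0"
proof -
  interpret T: caratheodory_rhs "truncate R F" N "\<lambda>_. m R" "\<lambda>_. \<bar>l R\<bar>"
    using assms by (rule caratheodory_rhs_truncate)
  show ?thesis
  proof (rule picard_global[OF T.rhs_measurable negligible_N])
    show "\<bar>truncate R F t x\<bar> \<le> m R" if "t \<notin> N" for t x using T.rhs_bound[OF that order_refl] .
    show "\<bar>truncate R F t x - truncate R F t y\<bar> \<le> \<bar>l R\<bar> * \<bar>x - y\<bar>" if "t \<notin> N" for t x y
      using T.rhs_lipschitz[OF that, of x "max \<bar>x\<bar> \<bar>y\<bar>" y] by simp
  qed (rule that)
qed

lemma solution_truncate_iff: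
  assumes J: "is_interval J" and bd: "\<And>t. t \<in> J \<Longrightarrow> \<bar>x t\<bar> \<le> R"
  shows "caratheodory_solution (truncate R F) J x \<longleftrightarrow> caratheodory_solution F J x"
proof -
  have eq: "truncate R F t (x t) = F t (x t)" if "t \<in> J" for t
  proof -
    have "max (- R) (min R (x t)) = x t" using bd[OF that] by auto
    then show ?thesis by (simp add: truncate_def)
  qed
  have "(AE t in lebesgue. t \<in> J \<longrightarrow> (x has_real_derivative truncate R F t (x t)) (at t within J))
    \<longleftrightarrow> (AE t in lebesgue. t \<in> J \<longrightarrow> (x has_real_derivative F t (x t)) (at t within J))"
    by (intro AE_cong imp_cong refl) (simp add: eq)
  then show ?thesis unfolding caratheodory_solution_def by blast
qed

end

lemma caratheodory_solution_subset:
  assumes "caratheodory_solution F I x" "is_interval J" "J \<subseteq> I"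
  shows "caratheodory_solution F J x"
  using assms unfolding caratheodory_solution_def
  by (auto elim!: eventually_mono intro: DERIV_subset)

section \<open>Maximal solutions\<close>

context caratheodory_rhs
begin

text \<open>All solutions through the initial point agree where they overlap and are glued on the
  union of their intervals. There may be uncountably many of them, each with its own exceptional
  set; the derivative is therefore taken from those reaching rational times, which already cover
  \<open>U\<close> up to finitely many points.\<close>

lemma maximal_extension:
  assumes y: "caratheodory_solution F J y" and "s \<in> J"
  obtains U X where "caratheodory_solution F U X"
    "\<And>K z. caratheodory_solution F K z \<Longrightarrow> s \<in> K \<Longrightarrow> z s = y s \<Longrightarrow> K \<subseteq> U \<and> (\<forall>t\<in>K. X t = z t)"
proof -
  define through where "through K z \<longleftrightarrow> caratheodory_solution F K z \<and> s \<in> K \<and> z s = y s" for K z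
  have J: "through J y" using y \<open>s \<in> J\<close> by (simp add: through_def)
  define U where "U = \<Union>{K. \<exists>z. through K z}"
  have "\<forall>t\<in>U. \<exists>K z. through K z \<and> t \<in> K" by (auto simp: U_def)
  then obtain I x where Ix: "\<And>t. t \<in> U \<Longrightarrow> through (I t) (x t)" "\<And>t. t \<in> U \<Longrightarrow> t \<in> I t"
    by metis
  define X where "X t = x t t" for t
  have XK: "K \<subseteq> U \<and> (\<forall>t\<in>K. X t = z t)" if "through K z" for K z
  proof
    show "K \<subseteq> U" using that by (auto simp: U_def)
    show "\<forall>t\<in>K. X t = z t"
    proof
      fix t assume "t \<in> K"
      then have "t \<in> U" using \<open>K \<subseteq> U\<close> by blast
      then show "X t = z t"
        using solution_unique'[of "I t" "x t" K z s t] Ix that \<open>t \<in> K\<close> by (simp add: through_def X_def)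
    qed
  qed
  have "s \<in> U" using XK[OF J] \<open>s \<in> J\<close> by blast
  have interval: "is_interval U"
    unfolding is_interval_connected_1 U_def
  proof (rule connected_Union)
    show "connected K" if "K \<in> {K. \<exists>z. through K z}" for K
      using that by (auto simp: through_def caratheodory_solution_def is_interval_connected_1)
    show "\<Inter> {K. \<exists>z. through K z} \<noteq> {}" by (auto simp: through_def)
  qed
  \<comment> \<open>Segments issuing from \<open>s\<close> suffice for absolute continuity: a
    compact interval in \<open>U\<close> lies in one of them or is the union of two that meet at
    \<open>s\<close>.\<close>
  have seg: "\<exists>M. M-lipschitz_on {min s t..max s t} X" if "t \<in> U" for t
  proof -
    have sol: "caratheodory_solution F (I t) (x t)" and "s \<in> I t" "is_interval (I t)"
      using Ix(1)[OF that] by (auto simp: through_def caratheodory_solution_def)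
    then have sub: "{min s t..max s t} \<subseteq> I t"
      using is_interval_segment_subset Ix(2)[OF that] by blast
    obtain R where "\<And>u. u \<in> {min s t..max s t} \<Longrightarrow> \<bar>x t u\<bar> \<le> R"
      using solution_bound[OF sol sub] by blast
    then have "\<bar>m R\<bar>-lipschitz_on {min s t..max s t} (x t)" by (rule solution_lipschitz[OF sol sub])
    then have "\<bar>m R\<bar>-lipschitz_on {min s t..max s t} X"
      by (rule lipschitz_on_transform) (use XK[OF Ix(1)[OF that]] sub in auto)
    then show ?thesis by blast
  qed
  have ac: "abs_continuous_on_interval c d X" if cd: "{c..d} \<subseteq> U" for c d
  proof -
    have "\<exists>M. M-lipschitz_on {c..d} X"
    proof (cases "c \<le> d")
      case True
      then have "c \<in> U" "d \<in> U" using cd by auto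
      obtain Mc Md where M: "Mc-lipschitz_on {min s c..max s c} X" "Md-lipschitz_on {min s d..max s d} X"
        using seg[OF \<open>c \<in> U\<close>] seg[OF \<open>d \<in> U\<close>] by blast
      consider "s < c" | "d < s" | "c \<le> s" "s \<le> d" by linarith
      then show ?thesis
      proof cases
        case 1
        then have "{c..d} \<subseteq> {min s d..max s d}" using True by auto
        then show ?thesis using M(2) lipschitz_on_subset by blast
      next
        case 2
        then have "{c..d} \<subseteq> {min s c..max s c}" using True by auto
        then show ?thesis using M(1) lipschitz_on_subset by blast
      next
        case 3
        have "Mc-lipschitz_on {c..s} X" "Md-lipschitz_on {s..d} X"
          using M 3 by (simp_all add: min_absorb2 max_absorb1 min_absorb1 max_absorb2)
        from lipschitz_on_concat_max[OF this refl]
        have "(max Mc Md)-lipschitz_on {c..d} (\<lambda>t. if t \<le> s then X t else X t)" .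
        then show ?thesis by auto
      qed
    next
      case False
      then show ?thesis by (intro exI[of _ 0]) simp
    qed
    then show ?thesis using lipschitz_on_imp_abs_continuous by blast
  qed
  have "\<exists>E. negligible E \<and> (\<forall>t. t \<notin> E \<longrightarrow> t \<in> U \<longrightarrow> (X has_real_derivative F t (X t)) (at t within U))"
  proof -
    have "\<exists>E. negligible E \<and> (\<forall>t S. t \<in> S \<longrightarrow> S \<subseteq> I q \<longrightarrow> t \<notin> E \<longrightarrow> (x q has_real_derivative F t (x q t)) (at t within S))" if "q \<in> U" for q
    proof -
      have "caratheodory_solution F (I q) (x q)" using Ix(1)[OF that] by (simp add: through_def)
      then obtain E where "solution_off E (I q) (x q)" by (rule solution_derivative)
      then show ?thesis unfolding solution_off_def by blast
    qed
    then obtain E where E: "\<And>q. q \<in> U \<Longrightarrow> negligible (E q)"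
      "\<And>q t S. q \<in> U \<Longrightarrow> t \<in> S \<Longrightarrow> S \<subseteq> I q \<Longrightarrow> t \<notin> E q \<Longrightarrow> (x q has_real_derivative F t (x q t)) (at t within S)"
      by metis
    \<comment> \<open>The initial time and the endpoints of \<open>U\<close>, if they belong to it.
      Every other point of \<open>U\<close> lies strictly between \<open>s\<close> and some rational
      point of \<open>U\<close>, where the derivative within \<open>U\<close> is two-sided.\<close>
    define Z where "Z = {s} \<union> {t \<in> U. \<forall>u\<in>U. u \<le> t} \<union> {t \<in> U. \<forall>u\<in>U. t \<le> u}"
    have "{t \<in> U. \<forall>u\<in>U. u \<le> t} \<subseteq> {Sup U}" "{t \<in> U. \<forall>u\<in>U. t \<le> u} \<subseteq> {Inf U}"
      by (auto intro!: cSup_eq_maximum[symmetric] cInf_eq_minimum[symmetric])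
    then have "Z \<subseteq> {s, Sup U, Inf U}" by (auto simp: Z_def)
    then have "finite Z" by (rule finite_subset) simp
    have inner: "(X has_real_derivative F t (X t)) (at t within U)"
      if q: "q \<in> U" and t: "t \<in> {min s q<..<max s q}" "t \<notin> E q" for t q
    proof -
      have "{min s q..max s q} \<subseteq> I q"
        using Ix(1)[OF q] Ix(2)[OF q] by (intro is_interval_segment_subset) (auto simp: through_def caratheodory_solution_def)
      then have sub: "{min s q<..<max s q} \<subseteq> I q"
        using greaterThanLessThan_subseteq_atLeastAtMost_iff by fastforce
      have eq: "X u = x q u" if "u \<in> {min s q<..<max s q}" for u
        using XK[OF Ix(1)[OF q]] sub that by blast
      have "(x q has_real_derivative F t (x q t)) (at t within {min s q<..<max s q})"
        by (rule E(2)[OF q t(1) sub t(2)])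
      then have "(x q has_real_derivative F t (X t)) (at t)"
        using t by (simp add: at_within_open[OF t(1)] eq)
      then have "(X has_real_derivative F t (X t)) (at t)"
        by (rule has_field_derivative_transform_within_open[OF _ open_greaterThanLessThan t(1)]) (simp add: eq)
      then show ?thesis by (rule has_field_derivative_at_within)
    qed
    show ?thesis
    proof (intro exI conjI allI impI)
      have "countable (\<rat> \<inter> U)" using countable_rat by blast
      then show "negligible (Z \<union> \<Union> (E ` (\<rat> \<inter> U)))"
        using E(1) negligible_finite[OF \<open>finite Z\<close>] by (intro negligible_Un negligible_countable_Union) auto
      fix t assume t: "t \<notin> Z \<union> \<Union> (E ` (\<rat> \<inter> U))" "t \<in> U"
      have "\<exists>q\<in>\<rat> \<inter> U. t \<in> {min s q<..<max s q}"
      proof (cases "s < t")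
        case True
        obtain u where u: "u \<in> U" "t < u" using t by (force simp: Z_def not_le)
        obtain q where q: "q \<in> \<rat>" "t < q" "q < u" using Rats_dense_in_real[OF u(2)] by blast
        then have "q \<in> U" using mem_is_interval_1_I[OF interval t(2) u(1)] by simp
        then show ?thesis using q True by (intro bexI[of _ q]) auto
      next
        case False
        then have "t < s" using t by (auto simp: Z_def)
        obtain u where u: "u \<in> U" "u < t" using t by (force simp: Z_def not_le)
        obtain q where q: "q \<in> \<rat>" "u < q" "q < t" using Rats_dense_in_real[OF u(2)] by blast
        then have "q \<in> U" using mem_is_interval_1_I[OF interval u(1) t(2)] by simp
        then show ?thesis using q \<open>t < s\<close> by (intro bexI[of _ q]) auto
      qed
      then obtain q where "q \<in> \<rat> \<inter> U" "t \<in> {min s q<..<max s q}" by blast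
      then show "(X has_real_derivative F t (X t)) (at t within U)" using inner[of q t] t by blast
    qed
  qed
  then have "caratheodory_solution F U X"
    using ac interval unfolding caratheodory_solution_def AE_lebesgue_iff_negligible by blast
  then show ?thesis using XK unfolding through_def by (rule that) blast
qed

text \<open>Any solution through the initial point extends to the glued one, which is maximal. So
  \<open>sol\<close> can be evaluated on whichever solution is at hand, with no knowledge of the
  maximal interval.\<close>

lemma sol_eq:
  assumes y: "caratheodory_solution F J y" and "s \<in> J" "t \<in> J"
  shows "t \<in> sol_dom F s (y s)" "sol F t s (y s) = y t"
proof -
  obtain U X where X: "caratheodory_solution F U X"
    and max: "\<And>K z. caratheodory_solution F K z \<Longrightarrow> s \<in> K \<Longrightarrow> z s = y s \<Longrightarrow> K \<subseteq> U \<and> (\<forall>t\<in>K. X t = z t)"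
    using maximal_extension[OF y \<open>s \<in> J\<close>] by blast
  have JU: "J \<subseteq> U" "\<And>t. t \<in> J \<Longrightarrow> X t = y t" using max[OF y \<open>s \<in> J\<close> refl] by auto
  have M: "maximal_solution F s (y s) U X"
    unfolding maximal_solution_def
  proof (intro conjI allI impI)
    show "s \<in> U" "X s = y s" using JU \<open>s \<in> J\<close> by auto
    fix K z assume "caratheodory_solution F K z \<and> U \<subseteq> K \<and> (\<forall>t\<in>U. z t = X t)"
    moreover from this have "s \<in> K" "z s = y s" using \<open>s \<in> U\<close> \<open>X s = y s\<close> by auto
    ultimately show "K = U" using max[of K z] by blast
  qed (rule X)
  have U: "t \<in> U" using JU \<open>t \<in> J\<close> by blast
  then show "t \<in> sol_dom F s (y s)" using M by (auto simp: sol_dom_def)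
  show "sol F t s (y s) = y t"
    unfolding sol_def
  proof (rule the_equality)
    show "\<exists>I x. maximal_solution F s (y s) I x \<and> t \<in> I \<and> y t = x t"
      using M U JU \<open>t \<in> J\<close> by force
    fix v assume "\<exists>I x. maximal_solution F s (y s) I x \<and> t \<in> I \<and> v = x t"
    then obtain I x where I: "caratheodory_solution F I x" "s \<in> I" "x s = y s" "t \<in> I" "v = x t"
      by (auto simp: maximal_solution_def)
    then show "v = y t" using max[OF I(1-3)] JU(2)[OF \<open>t \<in> J\<close>] by auto
  qed
qed

end

section \<open>d-concave right-hand sides\<close>

text \<open>\<open>coercive\<close> is the form in which the growth condition is used: wherever
  \<open>\<bar>x\<bar>\<close> exceeds \<open>\<rho>\<close>, solutions decrease in time. The
  constants \<open>L\<close> and \<open>\<delta>\<close> bound the second difference quotients of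
  \<open>f\<close> in space from the two sides.\<close>

locale dconcave_rhs = caratheodory_rhs f N m l for f :: "real \<Rightarrow> real \<Rightarrow> real" and N m l +
  fixes L \<delta> :: "real \<Rightarrow> real" and \<rho> :: real
  assumes x_deriv: "\<And>t x. t \<notin> N \<Longrightarrow> (f t has_real_derivative x_deriv f t x) (at x)"
    and x_deriv_lipschitz: "\<And>R t x y. t \<notin> N \<Longrightarrow> \<bar>x\<bar> \<le> R \<Longrightarrow> \<bar>y\<bar> \<le> R \<Longrightarrow>
      \<bar>x_deriv f t x - x_deriv f t y\<bar> \<le> L R * \<bar>x - y\<bar>"
    and x_deriv_decreasing: "\<And>R t x y. t \<notin> N \<Longrightarrow> \<bar>x\<bar> \<le> R \<Longrightarrow> \<bar>y\<bar> \<le> R \<Longrightarrow> x < y \<Longrightarrow>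
      x_deriv f t y - x_deriv f t x \<le> - \<delta> R * (y - x)"
    and \<delta>_pos: "\<And>R. \<delta> R > 0" and L_nonneg: "\<And>R. L R \<ge> 0"
    and coercive: "\<And>t x. t \<notin> N \<Longrightarrow> \<rho> \<le> \<bar>x\<bar> \<Longrightarrow> f t x < 0"
begin

text \<open>Strong concavity with modulus \<open>\<delta> R\<close>: after the tangent at
  \<open>x\<close> is subtracted and the quadratic term added, the derivative is still nonpositive
  to the right of \<open>x\<close>.\<close>

lemma tangent_upper:
  assumes t: "t \<notin> N" and R: "\<bar>x\<bar> \<le> R" "\<bar>y\<bar> \<le> R" and "x \<le> y"
  shows "f t y \<le> f t x + x_deriv f t x * (y - x) - \<delta> R / 2 * (y - x)\<^sup>2"
proof -
  define \<phi> where "\<phi> z = f t z - x_deriv f t x * (z - x) + \<delta> R / 2 * (z - x)\<^sup>2" for z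
  have "\<phi> y \<le> \<phi> x"
  proof (rule DERIV_nonpos_imp_nonincreasing[OF \<open>x \<le> y\<close>])
    fix z assume z: "x \<le> z" "z \<le> y"
    have "(\<phi> has_real_derivative (x_deriv f t z - x_deriv f t x + \<delta> R * (z - x))) (at z)"
      unfolding \<phi>_def by (auto intro!: derivative_eq_intros x_deriv[OF t] simp: algebra_simps diff_divide_distrib)
    moreover have "x_deriv f t z - x_deriv f t x + \<delta> R * (z - x) \<le> 0"
    proof (cases "x = z")
      case False
      have "\<bar>z\<bar> \<le> R" using R z by auto
      then show ?thesis using x_deriv_decreasing[OF t R(1), of z] False z by linarith
    qed simp
    ultimately show "\<exists>D. (\<phi> has_real_derivative D) (at z) \<and> D \<le> 0" by blast
  qed
  then show ?thesis by (simp add: \<phi>_def)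
qed

lemma tangent_lower:
  assumes t: "t \<notin> N" and R: "\<bar>x\<bar> \<le> R" "\<bar>y\<bar> \<le> R" and "x \<le> y"
  shows "f t x \<le> f t y - x_deriv f t y * (y - x) - \<delta> R / 2 * (y - x)\<^sup>2"
proof -
  define \<phi> where "\<phi> z = f t z + x_deriv f t y * (y - z) + \<delta> R / 2 * (y - z)\<^sup>2" for z
  have "\<phi> x \<le> \<phi> y"
  proof (rule DERIV_nonneg_imp_nondecreasing[OF \<open>x \<le> y\<close>])
    fix z assume z: "x \<le> z" "z \<le> y"
    have "(\<phi> has_real_derivative (x_deriv f t z - x_deriv f t y - \<delta> R * (y - z))) (at z)"
      unfolding \<phi>_def by (auto intro!: derivative_eq_intros x_deriv[OF t] simp: algebra_simps diff_divide_distrib)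
    moreover have "x_deriv f t z - x_deriv f t y - \<delta> R * (y - z) \<ge> 0"
    proof (cases "z = y")
      case False
      have "\<bar>z\<bar> \<le> R" using R z by auto
      then show ?thesis using x_deriv_decreasing[OF t _ R(2), of z] False z by linarith
    qed simp
    ultimately show "\<exists>D. (\<phi> has_real_derivative D) (at z) \<and> D \<ge> 0" by blast
  qed
  then show ?thesis by (simp add: \<phi>_def)
qed

definition slope :: "real \<Rightarrow> real \<Rightarrow> real \<Rightarrow> real" where
  "slope t x y = (f t y - f t x) / (y - x)"

text \<open>The first two bounds express strong concavity and serve when a lower bound on the gap is
  known. The last two follow from the mean value theorem and the Lipschitz bound on
  \<open>x_deriv\<close>; they serve when the gap is small or integrable in time.\<close>

lemma slope_bounds:
  assumes t: "t \<notin> N" and R: "\<bar>x\<bar> \<le> R" "\<bar>y\<bar> \<le> R" and "x < y"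
  shows "slope t x y \<le> x_deriv f t x - \<delta> R / 2 * (y - x)"
    "x_deriv f t y + \<delta> R / 2 * (y - x) \<le> slope t x y"
    "slope t x y \<le> x_deriv f t y + L R * (y - x)"
    "x_deriv f t x - L R * (y - x) \<le> slope t x y"
proof -
  have expand: "(A - c * D) * D = A * D - c * D\<^sup>2" "(A + c * D) * D = A * D + c * D\<^sup>2" for A c D :: real
    by (simp_all add: power2_eq_square algebra_simps)
  have "f t y - f t x \<le> (x_deriv f t x - \<delta> R / 2 * (y - x)) * (y - x)"
    "(x_deriv f t y + \<delta> R / 2 * (y - x)) * (y - x) \<le> f t y - f t x"
    unfolding expand using tangent_upper[OF t R] tangent_lower[OF t R] \<open>x < y\<close> by linarith+
  then show "slope t x y \<le> x_deriv f t x - \<delta> R / 2 * (y - x)"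
    "x_deriv f t y + \<delta> R / 2 * (y - x) \<le> slope t x y"
    unfolding slope_def using \<open>x < y\<close> by (simp_all only: pos_divide_le_eq pos_le_divide_eq diff_gt_0_iff_gt)
  obtain z where z: "x < z" "z < y" "f t y - f t x = (y - x) * x_deriv f t z"
    using MVT2[OF \<open>x < y\<close> x_deriv[OF t]] by blast
  then have "slope t x y = x_deriv f t z" using \<open>x < y\<close> by (simp add: slope_def)
  moreover have "\<bar>x_deriv f t z - x_deriv f t y\<bar> \<le> L R * (y - x)" "\<bar>x_deriv f t z - x_deriv f t x\<bar> \<le> L R * (y - x)"
  proof -
    have zR: "\<bar>z\<bar> \<le> R" using z R by auto
    have "\<bar>x_deriv f t z - x_deriv f t y\<bar> \<le> L R * \<bar>z - y\<bar>" by (rule x_deriv_lipschitz[OF t zR R(2)])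
    also have "\<dots> \<le> L R * (y - x)" using z L_nonneg by (intro mult_left_mono) auto
    finally show "\<bar>x_deriv f t z - x_deriv f t y\<bar> \<le> L R * (y - x)" .
    have "\<bar>x_deriv f t z - x_deriv f t x\<bar> \<le> L R * \<bar>z - x\<bar>" by (rule x_deriv_lipschitz[OF t zR R(1)])
    also have "\<dots> \<le> L R * (y - x)" using z L_nonneg by (intro mult_left_mono) auto
    finally show "\<bar>x_deriv f t z - x_deriv f t x\<bar> \<le> L R * (y - x)" .
  qed
  ultimately show "slope t x y \<le> x_deriv f t y + L R * (y - x)" "x_deriv f t x - L R * (y - x) \<le> slope t x y"
    by (simp_all add: abs_le_iff)
qed

text \<open>Both slopes are compared with the derivative at the common point \<open>y\<close>; the
  gains over the two pieces add up to one over the whole of [x, z].\<close>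

lemma slope_gap:
  assumes t: "t \<notin> N" and R: "\<bar>x\<bar> \<le> R" "\<bar>y\<bar> \<le> R" "\<bar>z\<bar> \<le> R" and "x < y" "y < z"
  shows "slope t y z + \<delta> R / 2 * (z - x) \<le> slope t x y"
  using slope_bounds(2)[OF t R(1,2) \<open>x < y\<close>] slope_bounds(1)[OF t R(2,3) \<open>y < z\<close>]
  unfolding right_diff_distrib by linarith

text \<open>The mean value theorem on a unit interval yields a point where the derivative is bounded
  by the Lipschitz constant of \<open>f\<close>. The auxiliary point \<open>x + 1\<close> is the
  reason for the radius \<open>R + 1\<close>.\<close>

lemma x_deriv_bound:
  assumes t: "t \<notin> N" and R: "\<bar>x\<bar> \<le> R"
  shows "\<bar>x_deriv f t x\<bar> \<le> l (R + 1) + L (R + 1)"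
proof -
  obtain z where z: "x < z" "z < x + 1" "f t (x + 1) - f t x = (x + 1 - x) * x_deriv f t z"
    using MVT2[of x "x + 1" "f t" "x_deriv f t"] x_deriv[OF t] by auto
  have "\<bar>f t (x + 1) - f t x\<bar> \<le> l (R + 1) * \<bar>x + 1 - x\<bar>"
    using R by (intro rhs_lipschitz[OF t]) auto
  moreover have "\<bar>x_deriv f t x - x_deriv f t z\<bar> \<le> L (R + 1) * \<bar>x - z\<bar>"
    using R z by (intro x_deriv_lipschitz[OF t]) auto
  moreover have "L (R + 1) * \<bar>x - z\<bar> \<le> L (R + 1) * 1"
    using z L_nonneg by (intro mult_left_mono) auto
  ultimately show ?thesis using z(3) by auto
qed

text \<open>Measurability is the issue, since \<open>x_deriv\<close> comes from a pointwise
  \<open>deriv\<close>. Off \<open>N\<close> it is the limit of the difference quotients with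
  increments \<open>1 / Suc n\<close>, and these are measurable along a continuous curve.\<close>

lemma set_integrable_x_deriv_along:
  assumes b: "continuous_on {c..d} b" and R: "\<And>t. t \<in> {c..d} \<Longrightarrow> \<bar>b t\<bar> \<le> R"
  shows "set_integrable lebesgue {c..d} (\<lambda>t. x_deriv f t (b t))"
proof (cases "c \<le> d")
  case True
  \<comment> \<open>Constant continuation beyond the endpoints, because
    \<open>measurable_rhs_along\<close> takes curves that are continuous on the whole line.\<close>
  define b' where "b' t = b (max c (min d t))" for t
  have b': "continuous_on UNIV b'"
    unfolding b'_def using True by (intro continuous_on_compose2[OF b] continuous_intros) auto
  have b'R: "\<bar>b' t\<bar> \<le> R" for t unfolding b'_def using True by (intro R) auto
  define u where "u n t = (if t \<in> N then 0 else (f t (b' t + 1 / real (Suc n)) - f t (b' t)) * real (Suc n))" for n t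
  define h where "h t = (if t \<in> N then 0 else x_deriv f t (b' t))" for t
  have N: "N \<in> sets lebesgue" using negligible_N by (simp add: negligible_iff_null_sets null_sets_def)
  have "h \<in> borel_measurable lebesgue"
  proof (rule borel_measurable_LIMSEQ_real)
    fix n
    have "(\<lambda>t. f t (b' t + 1 / real (Suc n))) \<in> borel_measurable borel" "(\<lambda>t. f t (b' t)) \<in> borel_measurable borel"
      by (intro measurable_rhs_along[OF rhs_measurable] continuous_intros b')+
    then have "(\<lambda>t. (f t (b' t + 1 / real (Suc n)) - f t (b' t)) * real (Suc n)) \<in> borel_measurable borel"
      by (intro borel_measurable_times borel_measurable_diff) auto
    then have "(\<lambda>t. (f t (b' t + 1 / real (Suc n)) - f t (b' t)) * real (Suc n)) \<in> borel_measurable lebesgue"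
      by (intro measurable_completion) simp
    then show "u n \<in> borel_measurable lebesgue"
      unfolding u_def using N by (intro measurable_If_set) auto
  next
    fix t
    show "(\<lambda>n. u n t) \<longlonglongrightarrow> h t"
    proof (cases "t \<in> N")
      case False
      have "((\<lambda>e. (f t (b' t + e) - f t (b' t)) / e) \<longlongrightarrow> x_deriv f t (b' t)) (at 0)"
        using x_deriv[OF False, of "b' t"] unfolding DERIV_def .
      then have "(\<lambda>n. (f t (b' t + inverse (real (Suc n))) - f t (b' t)) / inverse (real (Suc n))) \<longlonglongrightarrow> x_deriv f t (b' t)"
        by (rule filterlim_compose) (auto simp: filterlim_at intro!: always_eventually LIMSEQ_inverse_real_of_nat simp del: of_nat_Suc)
      then show ?thesis using False by (simp add: u_def h_def divide_inverse del: of_nat_Suc)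
    qed (simp add: u_def h_def)
  qed
  then have "set_integrable lebesgue {c..d} h"
    by (rule set_integrable_bounded_off_negligible[OF _ negligible_N, where B = "l (R + 1) + L (R + 1)"])
      (simp add: h_def x_deriv_bound b'R)
  then show ?thesis
    by (rule absolutely_integrable_spike[OF _ negligible_N]) (simp add: h_def b'_def)
qed simp

lemma integrable_x_deriv_along:
  assumes b: "caratheodory_solution f I b" and I: "{c..d} \<subseteq> I"
  shows "(\<lambda>t. x_deriv f t (b t)) integrable_on {c..d}"
proof -
  obtain R where "\<And>t. t \<in> {c..d} \<Longrightarrow> \<bar>b t\<bar> \<le> R" using solution_bound[OF b I] by blast
  from set_integrable_x_deriv_along[OF solution_continuous_on[OF b I] this]
  show ?thesis by (rule set_lebesgue_integral_eq_integral(1))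
qed

text \<open>Bridge from the oriented Lebesgue integrals of the definitions to the gauge integrals of
  the estimates; they agree because the integrand is Lebesgue integrable.\<close>

lemma interval_lebesgue_integral_x_deriv:
  assumes b: "caratheodory_solution f UNIV b" and "s \<le> t"
  shows "interval_lebesgue_integral lebesgue (ereal s) (ereal t) (\<lambda>u. x_deriv f u (b u)) = integral {s..t} (\<lambda>u. x_deriv f u (b u))"
    "interval_lebesgue_integral lebesgue (ereal t) (ereal s) (\<lambda>u. x_deriv f u (b u)) = - integral {s..t} (\<lambda>u. x_deriv f u (b u))"
proof -
  obtain R where "\<And>u. u \<in> {s..t} \<Longrightarrow> \<bar>b u\<bar> \<le> R" using solution_bound[OF b, of s t] by auto
  from set_integrable_x_deriv_along[OF solution_continuous_on[OF b] this]
  have "set_integrable lebesgue {s..t} (\<lambda>u. x_deriv f u (b u))" by simp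
  then have "set_integrable lebesgue {s<..<t} (\<lambda>u. x_deriv f u (b u))"
    by (rule set_integrable_subset) (auto simp: greaterThanLessThan_subseteq_atLeastAtMost_iff)
  then show "interval_lebesgue_integral lebesgue (ereal s) (ereal t) (\<lambda>u. x_deriv f u (b u)) = integral {s..t} (\<lambda>u. x_deriv f u (b u))"
    "interval_lebesgue_integral lebesgue (ereal t) (ereal s) (\<lambda>u. x_deriv f u (b u)) = - integral {s..t} (\<lambda>u. x_deriv f u (b u))"
    using \<open>s \<le> t\<close>
    by (auto simp: interval_lebesgue_integral_def set_lebesgue_integral_eq_integral(2) integral_open_interval_real)
qed

lemma attractive_pair_iff:
  assumes b: "caratheodory_solution f UNIV b"
  shows "attractive_pair f b k \<beta> \<longleftrightarrow> k \<ge> 1 \<and> \<beta> > 0 \<and>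
    (\<forall>s t. s \<le> t \<longrightarrow> integral {s..t} (\<lambda>u. x_deriv f u (b u)) \<le> ln k - \<beta> * (t - s))"
proof -
  have "exp z \<le> k * exp (- \<beta> * (t - s)) \<longleftrightarrow> z \<le> ln k - \<beta> * (t - s)" if "k \<ge> 1" for z s t
  proof -
    have "k * exp (- \<beta> * (t - s)) = exp (ln k - \<beta> * (t - s))" using that exp_add[of "ln k" "- \<beta> * (t - s)"] by simp
    then show ?thesis by simp
  qed
  then show ?thesis
    unfolding attractive_pair_def using interval_lebesgue_integral_x_deriv(1)[OF b] by auto
qed

text \<open>The roles of \<open>s\<close> and \<open>t\<close> are exchanged relative to
  \<open>repulsive_pair\<close>. Both kinds of dichotomy thus become linear inequalities for
  integrals taken forward in time.\<close>

lemma repulsive_pair_iff: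
  assumes b: "caratheodory_solution f UNIV b"
  shows "repulsive_pair f b k \<beta> \<longleftrightarrow> k \<ge> 1 \<and> \<beta> > 0 \<and>
    (\<forall>s t. s \<le> t \<longrightarrow> \<beta> * (t - s) - ln k \<le> integral {s..t} (\<lambda>u. x_deriv f u (b u)))"
proof -
  have "exp (- z) \<le> k * exp (\<beta> * (s - t)) \<longleftrightarrow> \<beta> * (t - s) - ln k \<le> z" if "k \<ge> 1" for z s t
  proof -
    have "k * exp (\<beta> * (s - t)) = exp (ln k + \<beta> * (s - t))" using that by (simp add: exp_add)
    then have "exp (- z) \<le> k * exp (\<beta> * (s - t)) \<longleftrightarrow> - z \<le> ln k + \<beta> * (s - t)" by simp
    then show ?thesis unfolding right_diff_distrib by linarith
  qed
  then show ?thesis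
    unfolding repulsive_pair_def
    by (auto simp: interval_lebesgue_integral_x_deriv(2)[OF b])
qed

text \<open>On a compact interval the gap lies between two positive bounds, so its logarithm is
  Lipschitz and equals the integral of its almost everywhere derivative.\<close>

lemma has_integral_slope:
  assumes p: "caratheodory_solution f I p" and q: "caratheodory_solution f I q"
    and I: "{c..d} \<subseteq> I" "c \<le> d" and less: "\<And>t. t \<in> {c..d} \<Longrightarrow> p t < q t"
  shows "((\<lambda>t. slope t (p t) (q t)) has_integral ln (q d - p d) - ln (q c - p c)) {c..d}"
proof -
  obtain Rp Rq where R: "\<And>t. t \<in> {c..d} \<Longrightarrow> \<bar>p t\<bar> \<le> Rp" "\<And>t. t \<in> {c..d} \<Longrightarrow> \<bar>q t\<bar> \<le> Rq"
    using solution_bound[OF p I(1)] solution_bound[OF q I(1)] by metis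
  define w where "w t = q t - p t" for t
  have cont: "continuous_on {c..d} w"
    unfolding w_def by (rule continuous_on_diff[OF solution_continuous_on[OF q I(1)] solution_continuous_on[OF p I(1)]])
  obtain t0 where t0: "t0 \<in> {c..d}" "\<And>t. t \<in> {c..d} \<Longrightarrow> w t0 \<le> w t"
    using continuous_attains_inf[OF compact_Icc _ cont] I(2) by (metis atLeastatMost_empty_iff2 not_le)
  obtain t1 where t1: "\<And>t. t \<in> {c..d} \<Longrightarrow> w t \<le> w t1"
    using continuous_attains_sup[OF compact_Icc _ cont] I(2) by (metis atLeastatMost_empty_iff2 not_le)
  have pos: "w t0 > 0" using less[OF t0(1)] by (simp add: w_def)
  obtain Ep where "solution_off Ep I p" by (rule solution_derivative[OF p])
  note Ep = solution_offD[OF this]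
  obtain Eq where "solution_off Eq I q" by (rule solution_derivative[OF q])
  note Eq = solution_offD[OF this]
  have der: "(ln has_real_derivative 1 / z) (at z)" if "z \<in> {w t0..w t1}" for z
    using that pos by (intro DERIV_ln_divide) auto
  have "(1 / w t0 * (\<bar>m Rq\<bar> + \<bar>m Rp\<bar>))-lipschitz_on {c..d} (\<lambda>t. ln (w t))"
  proof (rule lipschitz_on_compose_differentiable[OF _ _ der])
    show "(\<bar>m Rq\<bar> + \<bar>m Rp\<bar>)-lipschitz_on {c..d} w"
      unfolding w_def by (intro lipschitz_on_diff solution_lipschitz[OF p I(1)] solution_lipschitz[OF q I(1)] R)
    show "w ` {c..d} \<subseteq> {w t0..w t1}" using t0 t1 by auto
    show "\<bar>1 / z\<bar> \<le> 1 / w t0" if "z \<in> {w t0..w t1}" for z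
      using that pos by (simp add: frac_le)
  qed (use pos in auto)
  then have "((\<lambda>t. slope t (p t) (q t)) has_integral ln (w d) - ln (w c)) {c..d}"
  proof (rule lipschitz_has_integral[OF _ I(2)])
    show "negligible (Ep \<union> Eq)" using Ep Eq by simp
    fix t assume t: "t \<in> {c..d} - (Ep \<union> Eq)"
    have "(w has_real_derivative f t (q t) - f t (p t)) (at t within {c..d})"
      unfolding w_def using t I by (intro DERIV_diff Ep(3) Eq(3)) auto
    moreover have "w t \<in> {w t0..w t1}" using t t0(2) t1 by simp
    ultimately have "((\<lambda>t. ln (w t)) has_real_derivative 1 / w t * (f t (q t) - f t (p t))) (at t within {c..d})"
      by (rule DERIV_chain2[OF der, rotated])
    then show "((\<lambda>t. ln (w t)) has_real_derivative slope t (p t) (q t)) (at t within {c..d})"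
      by (simp add: slope_def w_def)
  qed
  then show ?thesis by (simp add: w_def)
qed

end

section \<open>Existence on half-lines: forward above \<open>r\<close>, backward below
  \<open>a\<close>\<close>

lemma last_crossing:
  fixes y :: "real \<Rightarrow> real"
  assumes y: "continuous_on {c..d} y" and "c \<le> d" "y c \<le> K" "K < y d"
  obtains t where "c \<le> t" "t < d" "y t \<le> K" "\<forall>u. t < u \<longrightarrow> u \<le> d \<longrightarrow> K < y u"
proof -
  define T where "T = {c..d} \<inter> y -` {..K}"
  have "closed T" unfolding T_def by (rule continuous_closed_preimage[OF y]) auto
  moreover have "bounded T" unfolding T_def by (rule bounded_subset[OF bounded_closed_interval[of c d]]) auto
  ultimately have "compact T" by (simp add: compact_eq_bounded_closed)
  moreover have "c \<in> T" using assms by (simp add: T_def)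
  ultimately obtain t where t: "t \<in> T" "\<And>u. u \<in> T \<Longrightarrow> u \<le> t"
    using compact_attains_sup[of T] by blast
  have "t \<noteq> d" using t(1) \<open>K < y d\<close> by (auto simp: T_def)
  then have "c \<le> t" "t < d" "y t \<le> K" using t(1) by (auto simp: T_def)
  then show ?thesis
  proof (rule that, intro allI impI)
    fix u assume u: "t < u" "u \<le> d"
    then have "u \<notin> T" using t(2)[of u] by auto
    then show "K < y u" using u \<open>c \<le> t\<close> by (auto simp: T_def)
  qed
qed

context dconcave_rhs
begin

text \<open>Outside [-R, R] the clamped argument is R or -R, where \<open>f\<close> is negative. The
  hypothesis covers open intervals only, as an excursion starts at a crossing time; the proof adds
  the endpoints to the null set.\<close>

lemma truncate_solution_decreasing:
  assumes y: "caratheodory_solution (truncate R f) UNIV y" and R: "R \<ge> 0" "R \<ge> \<rho>" and "c \<le> d"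
    and out: "\<And>t. t \<in> {c<..<d} \<Longrightarrow> R \<le> \<bar>y t\<bar>"
  shows "y d \<le> y c"
proof -
  interpret T: caratheodory_rhs "truncate R f" N "\<lambda>_. m R" "\<lambda>_. \<bar>l R\<bar>"
    using R(1) by (rule caratheodory_rhs_truncate)
  have "y d - y c \<le> 0"
  proof (rule has_integral_mono_negligible[OF T.solution_has_integral[OF y _ \<open>c \<le> d\<close>] has_integral_0])
    show "negligible (insert c (insert d N))" using negligible_N by simp
    fix t assume t: "t \<in> {c..d} - insert c (insert d N)"
    then have "\<bar>max (- R) (min R (y t))\<bar> = R" using out[of t] R(1) by auto
    then show "truncate R f t (y t) \<le> 0"
      unfolding truncate_def using t R(2) by (intro coercive[THEN less_imp_le]) auto
  qed simp
  then show ?thesis by simp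
qed

text \<open>A solution of the truncated equation is caught between two barriers: \<open>r\<close>
  from below by order preservation, and the level \<open>R\<close> from above since it decreases
  there. Hence it stays in [-R, R] and solves the original equation.\<close>

lemma forward_solution:
  assumes r: "bounded_solution f r" and "r s \<le> x0"
  obtains y where "caratheodory_solution f {s..} y" "y s = x0"
proof -
  have rsol: "caratheodory_solution f UNIV r" using r by (simp add: bounded_solution_def)
  obtain Rr where Rr: "\<And>t. \<bar>r t\<bar> \<le> Rr" using r by (auto simp: bounded_solution_def bounded_iff)
  define R where "R = max \<bar>x0\<bar> (max \<rho> Rr)"
  have R: "R \<ge> 0" "\<rho> \<le> R" "\<bar>x0\<bar> \<le> R" "\<bar>r t\<bar> \<le> R" for t using Rr[of t] by (auto simp: R_def)
  interpret T: caratheodory_rhs "truncate R f" N "\<lambda>_. m R" "\<lambda>_. \<bar>l R\<bar>"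
    using R(1) by (rule caratheodory_rhs_truncate)
  obtain y where y: "caratheodory_solution (truncate R f) UNIV y" "y s = x0"
    by (rule truncate_global_solution[OF R(1)])
  have ys: "y s \<le> R" "- y s \<le> R" using y(2) R(3) by auto
  have rT: "caratheodory_solution (truncate R f) UNIV r"
    using rsol R(4) by (subst solution_truncate_iff) auto
  have "\<bar>y t\<bar> \<le> R" if st: "t \<in> {s..}" for t
  proof -
    have "r t \<le> y t" using T.solution_less[OF y(1) rT, of t s] y(2) \<open>r s \<le> x0\<close> by force
    moreover have "y t \<le> R"
    proof (rule ccontr)
      assume "\<not> y t \<le> R"
      then obtain u where u: "s \<le> u" "u < t" "y u \<le> R" "\<forall>v. u < v \<longrightarrow> v \<le> t \<longrightarrow> R < y v"
        using last_crossing[OF T.solution_continuous_on[OF y(1)], of s t R] st ys by auto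
      have "R \<le> \<bar>y v\<bar>" if "v \<in> {u<..<t}" for v using u(4)[rule_format, of v] that by auto
      then have "y t \<le> y u"
        using u by (intro truncate_solution_decreasing[OF y(1) R(1,2)]) auto
      then show False using u \<open>\<not> y t \<le> R\<close> by simp
    qed
    ultimately show ?thesis using R(4)[of t] by simp
  qed
  then have "caratheodory_solution f {s..} y"
    using solution_truncate_iff[of "{s..}" y R] caratheodory_solution_subset[OF y(1), of "{s..}"]
    by (simp add: is_interval_ci)
  then show ?thesis using y(2) by (rule that)
qed

text \<open>Backward in time a negative \<open>f\<close> pushes solutions upwards. The level -R is
  now a barrier from below, and escape at the top is prevented by \<open>a\<close>.\<close>

lemma backward_solution:
  assumes a: "bounded_solution f a" and "x0 \<le> a s"
  obtains y where "caratheodory_solution f {..s} y" "y s = x0"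
proof -
  have asol: "caratheodory_solution f UNIV a" using a by (simp add: bounded_solution_def)
  obtain Ra where Ra: "\<And>t. \<bar>a t\<bar> \<le> Ra" using a by (auto simp: bounded_solution_def bounded_iff)
  define R where "R = max \<bar>x0\<bar> (max \<rho> Ra)"
  have R: "R \<ge> 0" "\<rho> \<le> R" "\<bar>x0\<bar> \<le> R" "\<bar>a t\<bar> \<le> R" for t using Ra[of t] by (auto simp: R_def)
  interpret T: caratheodory_rhs "truncate R f" N "\<lambda>_. m R" "\<lambda>_. \<bar>l R\<bar>"
    using R(1) by (rule caratheodory_rhs_truncate)
  obtain y where y: "caratheodory_solution (truncate R f) UNIV y" "y s = x0"
    by (rule truncate_global_solution[OF R(1)])
  have ys: "y s \<le> R" "- y s \<le> R" using y(2) R(3) by auto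
  have aT: "caratheodory_solution (truncate R f) UNIV a"
    using asol R(4) by (subst solution_truncate_iff) auto
  have "\<bar>y t\<bar> \<le> R" if st: "t \<in> {..s}" for t
  proof -
    have "y t \<le> a t" using T.solution_less[OF aT y(1), of t s] y(2) \<open>x0 \<le> a s\<close> by force
    moreover have "- R \<le> y t"
    proof (rule ccontr)
      assume "\<not> - R \<le> y t"
      have "continuous_on {- s..- t} (\<lambda>u. - y (- u))"
        by (intro continuous_on_minus continuous_on_compose2[OF T.solution_continuous_on[OF y(1), of t s]] continuous_on_id) auto
      \<comment> \<open>Reflecting both time and space turns the first passage below -R backward in
        time into an upward passage above \<open>R\<close>, to which \<open>last_crossing\<close>
        applies.\<close>
      then obtain u where u: "- s \<le> u" "u < - t" "- y (- u) \<le> R" "\<forall>v. u < v \<longrightarrow> v \<le> - t \<longrightarrow> R < - y (- v)"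
        using last_crossing[of "- s" "- t" "\<lambda>u. - y (- u)" R] st ys \<open>\<not> - R \<le> y t\<close> by auto
      have "R \<le> \<bar>y v\<bar>" if "v \<in> {t<..<- u}" for v using u(4)[rule_format, of "- v"] that by auto
      then have "y (- u) \<le> y t"
        using u by (intro truncate_solution_decreasing[OF y(1) R(1,2)]) auto
      then show False using u \<open>\<not> - R \<le> y t\<close> by simp
    qed
    ultimately show ?thesis using R(4)[of t] by simp
  qed
  then have "caratheodory_solution f {..s} y"
    using solution_truncate_iff[of "{..s}" y R] caratheodory_solution_subset[OF y(1), of "{..s}"]
    by (simp add: is_interval_ic)
  then show ?thesis using y(2) by (rule that)
qed

section \<open>Integrated slope bounds for the logarithm of a gap\<close>

context
  fixes p q :: "real \<Rightarrow> real" and I :: "real set" and c d R :: real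
  assumes p: "caratheodory_solution f I p" and q: "caratheodory_solution f I q"
    and I: "{c..d} \<subseteq> I" and cd: "c \<le> d"
    and less: "\<And>t. t \<in> {c..d} \<Longrightarrow> p t < q t"
    and R: "\<And>t. t \<in> {c..d} \<Longrightarrow> \<bar>p t\<bar> \<le> R" "\<And>t. t \<in> {c..d} \<Longrightarrow> \<bar>q t\<bar> \<le> R"
begin

private lemmas slope_integral = has_integral_slope[OF p q I cd less]
private lemmas p_integral = integrable_integral[OF integrable_x_deriv_along[OF p I]]
private lemmas q_integral = integrable_integral[OF integrable_x_deriv_along[OF q I]]

private lemma const_integral: "((\<lambda>_. K :: real) has_integral K * (d - c)) {c..d}"
  using has_integral_const_real[of K c d] cd by (simp add: mult.commute)

text \<open>The case \<open>\<eta> = 0\<close> is used as well: it compares the gap with the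
  linearized equation by concavity alone, at no loss in the constants.\<close>

lemma log_gap_upper_of_separated:
  assumes "\<And>t. t \<in> {c..d} \<Longrightarrow> \<eta> \<le> q t - p t"
  shows "ln (q d - p d) - ln (q c - p c) \<le> integral {c..d} (\<lambda>t. x_deriv f t (p t)) - \<delta> R / 2 * \<eta> * (d - c)"
proof (rule has_integral_mono_negligible[OF slope_integral has_integral_diff[OF p_integral const_integral] negligible_N])
  fix t assume t: "t \<in> {c..d} - N"
  have "slope t (p t) (q t) \<le> x_deriv f t (p t) - \<delta> R / 2 * (q t - p t)"
    using t by (intro slope_bounds R less) auto
  moreover have "\<delta> R / 2 * \<eta> \<le> \<delta> R / 2 * (q t - p t)"
    using t assms[of t] \<delta>_pos[of R] by (intro mult_left_mono) auto
  ultimately show "slope t (p t) (q t) \<le> x_deriv f t (p t) - \<delta> R / 2 * \<eta>" by linarith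
qed

lemma log_gap_lower_of_separated:
  assumes "\<And>t. t \<in> {c..d} \<Longrightarrow> \<eta> \<le> q t - p t"
  shows "integral {c..d} (\<lambda>t. x_deriv f t (q t)) + \<delta> R / 2 * \<eta> * (d - c) \<le> ln (q d - p d) - ln (q c - p c)"
proof (rule has_integral_mono_negligible[OF has_integral_add[OF q_integral const_integral] slope_integral negligible_N])
  fix t assume t: "t \<in> {c..d} - N"
  have "x_deriv f t (q t) + \<delta> R / 2 * (q t - p t) \<le> slope t (p t) (q t)"
    using t by (intro slope_bounds R less) auto
  moreover have "\<delta> R / 2 * \<eta> \<le> \<delta> R / 2 * (q t - p t)"
    using t assms[of t] \<delta>_pos[of R] by (intro mult_left_mono) auto
  ultimately show "x_deriv f t (q t) + \<delta> R / 2 * \<eta> \<le> slope t (p t) (q t)" by linarith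
qed

text \<open>The bound \<open>\<omega>\<close> may vary in time. It is constant when separation is
  proved from hyperbolicity, and exponentially decaying in the convergence estimates, where the loss
  stays bounded on arbitrarily long intervals.\<close>

lemma log_gap_upper_of_close:
  assumes \<omega>: "(\<omega> has_integral B) {c..d}" and "\<And>t. t \<in> {c..d} \<Longrightarrow> q t - p t \<le> \<omega> t"
  shows "ln (q d - p d) - ln (q c - p c) \<le> integral {c..d} (\<lambda>t. x_deriv f t (q t)) + L R * B"
proof (rule has_integral_mono_negligible[OF slope_integral has_integral_add[OF q_integral has_integral_mult_right[OF \<omega>]] negligible_N])
  fix t assume t: "t \<in> {c..d} - N"
  have "slope t (p t) (q t) \<le> x_deriv f t (q t) + L R * (q t - p t)"
    using t by (intro slope_bounds R less) auto
  moreover have "L R * (q t - p t) \<le> L R * \<omega> t"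
    using t assms(2)[of t] L_nonneg by (intro mult_left_mono) auto
  ultimately show "slope t (p t) (q t) \<le> x_deriv f t (q t) + L R * \<omega> t" by linarith
qed

lemma log_gap_lower_of_close:
  assumes \<omega>: "(\<omega> has_integral B) {c..d}" and "\<And>t. t \<in> {c..d} \<Longrightarrow> q t - p t \<le> \<omega> t"
  shows "integral {c..d} (\<lambda>t. x_deriv f t (p t)) - L R * B \<le> ln (q d - p d) - ln (q c - p c)"
proof (rule has_integral_mono_negligible[OF has_integral_diff[OF p_integral has_integral_mult_right[OF \<omega>]] slope_integral negligible_N])
  fix t assume t: "t \<in> {c..d} - N"
  have "x_deriv f t (p t) - L R * (q t - p t) \<le> slope t (p t) (q t)"
    using t by (intro slope_bounds R less) auto
  moreover have "L R * (q t - p t) \<le> L R * \<omega> t"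
    using t assms(2)[of t] L_nonneg by (intro mult_left_mono) auto
  ultimately show "x_deriv f t (p t) - L R * \<omega> t \<le> slope t (p t) (q t)" by linarith
qed

end

lemma log_ratio_growth:
  assumes sol: "caratheodory_solution f I p" "caratheodory_solution f I x" "caratheodory_solution f I q"
    and I: "{c..d} \<subseteq> I" "c \<le> d"
    and less: "\<And>t. t \<in> {c..d} \<Longrightarrow> p t < x t" "\<And>t. t \<in> {c..d} \<Longrightarrow> x t < q t"
    and R: "\<And>t. t \<in> {c..d} \<Longrightarrow> \<bar>p t\<bar> \<le> R" "\<And>t. t \<in> {c..d} \<Longrightarrow> \<bar>q t\<bar> \<le> R"
    and \<eta>: "\<And>t. t \<in> {c..d} \<Longrightarrow> \<eta> \<le> q t - p t"
  shows "\<delta> R / 2 * \<eta> * (d - c) \<le> (ln (x d - p d) - ln (x c - p c)) - (ln (q d - x d) - ln (q c - x c))"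
proof (rule has_integral_mono_negligible[OF _ has_integral_diff[OF has_integral_slope[OF sol(1,2) I less(1)]
      has_integral_slope[OF sol(2,3) I less(2)]] negligible_N])
  show "((\<lambda>_. \<delta> R / 2 * \<eta>) has_integral \<delta> R / 2 * \<eta> * (d - c)) {c..d}"
    using has_integral_const_real[of "\<delta> R / 2 * \<eta>" c d] I(2) by (simp add: mult.commute)
  fix t assume t: "t \<in> {c..d} - N"
  have "\<bar>x t\<bar> \<le> R" using less[of t] R[of t] t by auto
  then have "slope t (x t) (q t) + \<delta> R / 2 * (q t - p t) \<le> slope t (p t) (x t)"
    using t by (intro slope_gap R less) auto
  moreover have "\<delta> R / 2 * \<eta> \<le> \<delta> R / 2 * (q t - p t)"
    using t \<eta>[of t] \<delta>_pos[of R] by (intro mult_left_mono) auto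
  ultimately show "\<delta> R / 2 * \<eta> \<le> slope t (p t) (x t) - slope t (x t) (q t)" by linarith
qed

end

section \<open>Hyperbolicity and uniform separation\<close>

lemma le_mult_exp_of_ln_diff_le:
  fixes u v k z :: real
  assumes "u > 0" "v > 0" "k > 0" "ln u - ln v \<le> ln k + z"
  shows "u \<le> k * exp z * v"
proof -
  have "u = exp (ln u)" using assms by simp
  also have "\<dots> \<le> exp (ln k + z + ln v)" unfolding exp_le_cancel_iff using assms(4) by linarith
  also have "\<dots> = k * exp z * v" using assms by (simp add: exp_add)
  finally show ?thesis .
qed

lemma has_integral_exp_decay:
  fixes C \<gamma> c d :: real
  assumes "\<gamma> > 0" "c \<le> d"
  shows "((\<lambda>t. C * exp (- \<gamma> * (t - c))) has_integral C * (1 - exp (- \<gamma> * (d - c))) / \<gamma>) {c..d}"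
    "((\<lambda>t. C * exp (- \<gamma> * (d - t))) has_integral C * (1 - exp (- \<gamma> * (d - c))) / \<gamma>) {c..d}"
proof -
  have "((\<lambda>t. C * exp (- \<gamma> * (t - c))) has_integral (- C * exp (- \<gamma> * (d - c)) / \<gamma>) - (- C * exp (- \<gamma> * (c - c)) / \<gamma>)) {c..d}"
    using assms by (intro fundamental_theorem_of_calculus)
      (auto intro!: derivative_eq_intros simp: has_real_derivative_iff_has_vector_derivative[symmetric])
  then show "((\<lambda>t. C * exp (- \<gamma> * (t - c))) has_integral C * (1 - exp (- \<gamma> * (d - c))) / \<gamma>) {c..d}"
    by (rule has_integral_eq_rhs) (simp add: right_diff_distrib diff_divide_distrib)
  have "((\<lambda>t. C * exp (- \<gamma> * (d - t))) has_integral (C * exp (- \<gamma> * (d - d)) / \<gamma>) - (C * exp (- \<gamma> * (d - c)) / \<gamma>)) {c..d}"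
    using assms by (intro fundamental_theorem_of_calculus)
      (auto intro!: derivative_eq_intros simp: has_real_derivative_iff_has_vector_derivative[symmetric])
  then show "((\<lambda>t. C * exp (- \<gamma> * (d - t))) has_integral C * (1 - exp (- \<gamma> * (d - c))) / \<gamma>) {c..d}"
    by (rule has_integral_eq_rhs) (simp add: right_diff_distrib diff_divide_distrib)
qed

context dconcave_rhs
begin

lemma bounded_solution_pair_bound:
  assumes "bounded_solution f p" "bounded_solution f q"
  obtains R where "R > 0" "\<And>t. \<bar>p t\<bar> \<le> R" "\<And>t. \<bar>q t\<bar> \<le> R"
proof -
  obtain Rp Rq where "\<And>t. \<bar>p t\<bar> \<le> Rp" "\<And>t. \<bar>q t\<bar> \<le> Rq"
    using assms by (auto simp: bounded_solution_def bounded_iff)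
  then have "max 1 (max Rp Rq) > 0" "\<bar>p t\<bar> \<le> max 1 (max Rp Rq)" "\<bar>q t\<bar> \<le> max 1 (max Rp Rq)" for t
    by (simp_all add: le_max_iff_disj)
  then show ?thesis by (rule that)
qed

lemma bounded_solution_cases:
  assumes "bounded_solution f p" "bounded_solution f q"
  obtains "p = q" | "\<forall>t. p t < q t" | "\<forall>t. q t < p t"
proof -
  have sol: "caratheodory_solution f UNIV p" "caratheodory_solution f UNIV q"
    using assms by (auto simp: bounded_solution_def)
  have "p = q" if "p 0 = q 0"
    using solution_unique'[OF sol _ _ _ _ that] by auto
  moreover have "\<forall>t. p t < q t" if "p 0 < q 0"
    using solution_less[OF sol _ _ that] by auto
  moreover have "\<forall>t. q t < p t" if "q 0 < p 0"
    using solution_less[OF sol(2,1) _ _ that] by auto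
  ultimately show ?thesis using that by (metis linorder_neqE_linordered_idom)
qed

text \<open>The logarithm of the gap stays between \<open>ln \<eta>\<close> and
  \<open>ln (2 * R)\<close>, so its increments are at most \<open>ln k\<close> with
  \<open>k = 2 * R / \<eta>\<close>. Strong concavity separates these increments from the integral
  of either derivative by a drift with rate
  \<open>\<beta> = \<delta> R / 2 * \<eta>\<close>.\<close>

lemma hyperbolic_of_separated:
  assumes p: "bounded_solution f p" and q: "bounded_solution f q"
    and "\<eta> > 0" and sep: "\<And>t. \<eta> \<le> q t - p t"
  shows "hyperbolic_attractive f q" "hyperbolic_repulsive f p"
proof -
  have sol: "caratheodory_solution f UNIV p" "caratheodory_solution f UNIV q"
    using p q by (auto simp: bounded_solution_def)
  obtain R where R: "R > 0" "\<And>t. \<bar>p t\<bar> \<le> R" "\<And>t. \<bar>q t\<bar> \<le> R"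
    using bounded_solution_pair_bound[OF p q] by blast
  have less: "p t < q t" for t using sep[of t] \<open>\<eta> > 0\<close> by linarith
  have upper: "q t - p t \<le> 2 * R" for t using R(2)[of t] R(3)[of t] by linarith
  define k where "k = 2 * R / \<eta>"
  define \<beta> where "\<beta> = \<delta> R / 2 * \<eta>"
  have k: "k \<ge> 1" using order_trans[OF sep upper] \<open>\<eta> > 0\<close> by (simp add: k_def)
  have \<beta>: "\<beta> > 0" using \<delta>_pos \<open>\<eta> > 0\<close> by (simp add: \<beta>_def)
  have ln_gap: "ln \<eta> \<le> ln (q t - p t)" "ln (q t - p t) \<le> ln (2 * R)" for t
    using sep[of t] upper[of t] \<open>\<eta> > 0\<close> by (auto intro!: ln_mono)
  have ln_k: "ln k = ln (2 * R) - ln \<eta>" using R(1) \<open>\<eta> > 0\<close> by (simp add: k_def ln_div)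
  have "integral {s..t} (\<lambda>u. x_deriv f u (q u)) \<le> ln k - \<beta> * (t - s)" if "s \<le> t" for s t
    using log_gap_lower_of_separated[OF sol subset_UNIV that less R(2,3) sep]
      ln_gap[of s] ln_gap[of t] ln_k by (simp add: \<beta>_def)
  then have "attractive_pair f q k \<beta>" unfolding attractive_pair_iff[OF sol(2)] using k \<beta> by blast
  then show "hyperbolic_attractive f q" using q by (auto simp: hyperbolic_attractive_def)
  have "\<beta> * (t - s) - ln k \<le> integral {s..t} (\<lambda>u. x_deriv f u (p u))" if "s \<le> t" for s t
    using log_gap_upper_of_separated[OF sol subset_UNIV that less R(2,3) sep]
      ln_gap[of s] ln_gap[of t] ln_k by (simp add: \<beta>_def)
  then have "repulsive_pair f p k \<beta>" unfolding repulsive_pair_iff[OF sol(1)] using k \<beta> by blast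
  then show "hyperbolic_repulsive f p" using p by (auto simp: hyperbolic_repulsive_def)
qed

text \<open>By concavity the gap grows at most like the linearization along \<open>p\<close> and at
  least like that along \<open>q\<close>. Attractive \<open>p\<close> would make it unbounded
  backward in time, repulsive \<open>q\<close> forward in time.\<close>

lemma hyperbolic_type_of_ordered:
  assumes p: "bounded_solution f p" and q: "bounded_solution f q" and less: "\<And>t. p t < q t"
  shows "\<not> hyperbolic_attractive f p" "\<not> hyperbolic_repulsive f q"
proof -
  have sol: "caratheodory_solution f UNIV p" "caratheodory_solution f UNIV q"
    using p q by (auto simp: bounded_solution_def)
  obtain R where R: "R > 0" "\<And>t. \<bar>p t\<bar> \<le> R" "\<And>t. \<bar>q t\<bar> \<le> R"
    using bounded_solution_pair_bound[OF p q] by blast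
  have "q t - p t \<le> 2 * R" for t using R(2)[of t] R(3)[of t] by linarith
  then have ln_gap: "ln (q t - p t) \<le> ln (2 * R)" for t
    using less[of t] by (auto intro!: ln_mono)
  have "0 \<le> q t - p t" for t using less[of t] by simp
  note gap = log_gap_upper_of_separated[OF sol subset_UNIV _ less R(2,3) this]
    log_gap_lower_of_separated[OF sol subset_UNIV _ less R(2,3) this]
  show "\<not> hyperbolic_attractive f p"
  proof
    assume "hyperbolic_attractive f p"
    then obtain k \<beta> where k: "k \<ge> 1" "\<beta> > 0" and dich: "\<And>s t. s \<le> t \<Longrightarrow>
        integral {s..t} (\<lambda>u. x_deriv f u (p u)) \<le> ln k - \<beta> * (t - s)"
      unfolding hyperbolic_attractive_def attractive_pair_iff[OF sol(1)] by blast
    \<comment> \<open>After time \<open>T\<close> backward the logarithm of the gap would exceed its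
      upper bound \<open>ln (2 * R)\<close> by at least 1.\<close>
    define T where "T = (ln (2 * R) - ln (q 0 - p 0) + ln k + 1) / \<beta>"
    have "T \<ge> 0" using ln_gap[of 0] k by (simp add: T_def)
    have "\<beta> * T = ln (2 * R) - ln (q 0 - p 0) + ln k + 1" using k by (simp add: T_def)
    then show False
      using gap(1)[of "- T" 0] dich[of "- T" 0] ln_gap[of "- T"] \<open>T \<ge> 0\<close> by simp
  qed
  show "\<not> hyperbolic_repulsive f q"
  proof
    assume "hyperbolic_repulsive f q"
    then obtain k \<beta> where k: "k \<ge> 1" "\<beta> > 0" and dich: "\<And>s t. s \<le> t \<Longrightarrow>
        \<beta> * (t - s) - ln k \<le> integral {s..t} (\<lambda>u. x_deriv f u (q u))"
      unfolding hyperbolic_repulsive_def repulsive_pair_iff[OF sol(2)] by blast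
    define T where "T = (ln (2 * R) - ln (q 0 - p 0) + ln k + 1) / \<beta>"
    have "T \<ge> 0" using ln_gap[of 0] k by (simp add: T_def)
    have "\<beta> * T = ln (2 * R) - ln (q 0 - p 0) + ln k + 1" using k by (simp add: T_def)
    then show False
      using gap(2)[of 0 T] dich[of 0 T] ln_gap[of T] \<open>T \<ge> 0\<close> by simp
  qed
qed

text \<open>If the gap stayed small on a long interval, its logarithm would have to grow along \<open>p\<close> and
  decay along \<open>q\<close> at once; and a gap that is not small at some later time within a fixed
  distance cannot have been arbitrarily small before.\<close>

lemma separated_of_hyperbolic:
  assumes p: "hyperbolic_repulsive f p" and q: "hyperbolic_attractive f q" and less: "\<And>t. p t < q t"
  obtains \<eta> where "\<eta> > 0" "\<And>t. \<eta> \<le> q t - p t"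
proof -
  have bd: "bounded_solution f p" "bounded_solution f q"
    using p q by (auto simp: hyperbolic_repulsive_def hyperbolic_attractive_def)
  then have sol: "caratheodory_solution f UNIV p" "caratheodory_solution f UNIV q"
    by (auto simp: bounded_solution_def)
  obtain R where R: "R > 0" "\<And>t. \<bar>p t\<bar> \<le> R" "\<And>t. \<bar>q t\<bar> \<le> R"
    using bounded_solution_pair_bound[OF bd] by blast
  obtain k\<^sub>p \<beta>\<^sub>p where kp: "k\<^sub>p \<ge> 1" "\<beta>\<^sub>p > 0" and dichp: "\<And>s t. s \<le> t \<Longrightarrow>
      \<beta>\<^sub>p * (t - s) - ln k\<^sub>p \<le> integral {s..t} (\<lambda>u. x_deriv f u (p u))"
    using p unfolding hyperbolic_repulsive_def repulsive_pair_iff[OF sol(1)] by blast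
  obtain k\<^sub>q \<beta>\<^sub>q where kq: "k\<^sub>q \<ge> 1" "\<beta>\<^sub>q > 0" and dichq: "\<And>s t. s \<le> t \<Longrightarrow>
      integral {s..t} (\<lambda>u. x_deriv f u (q u)) \<le> ln k\<^sub>q - \<beta>\<^sub>q * (t - s)"
    using q unfolding hyperbolic_attractive_def attractive_pair_iff[OF sol(2)] by blast
  \<comment> \<open>While the gap stays below \<open>\<omega>\<close>, the two nonlinear errors
    together cost at most half of \<open>(\<beta>\<^sub>p + \<beta>\<^sub>q) * T\<close>. The other
    half equals \<open>ln k\<^sub>p + ln k\<^sub>q + 1\<close>, one more than the dichotomies
    allow.\<close>
  define T where "T = 2 * (ln k\<^sub>p + ln k\<^sub>q + 1) / (\<beta>\<^sub>p + \<beta>\<^sub>q)"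
  define \<omega> where "\<omega> = (\<beta>\<^sub>p + \<beta>\<^sub>q) / (4 * (L R + 1))"
  have "T \<ge> 0" using kp kq by (simp add: T_def)
  have L: "L R \<ge> 0" by (rule L_nonneg)
  have "\<omega> > 0" using kp kq L by (simp add: \<omega>_def)
  \<comment> \<open>The least value the gap at \<open>s\<close> can have if it exceeds
    \<open>\<omega>\<close> at some time in [s, s + T]: its growth in between is bounded with
    \<open>k\<^sub>q\<close> and the crude gap bound \<open>2 * R\<close>.\<close>
  define \<eta> where "\<eta> = exp (ln \<omega> - ln k\<^sub>q - L R * (2 * R * T))"
  have const: "((\<lambda>_. K) has_integral K * (t - s)) {s..t}" if "s \<le> t" for K s t :: real
    using has_integral_const_real[of K s t] that by (simp add: mult.commute)
  have "\<eta> \<le> q s - p s" for s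
  proof -
    have "\<exists>t\<in>{s..s + T}. \<omega> < q t - p t"
    proof (rule ccontr)
      assume "\<not> (\<exists>t\<in>{s..s + T}. \<omega> < q t - p t)"
      then have small: "q t - p t \<le> \<omega>" if "t \<in> {s..s + T}" for t using that by (auto simp: not_less)
      have sT: "s \<le> s + T" using \<open>T \<ge> 0\<close> by simp
      have "ln (q (s + T) - p (s + T)) - ln (q s - p s) \<le> ln k\<^sub>q - \<beta>\<^sub>q * T + L R * (\<omega> * T)"
        using log_gap_upper_of_close[OF sol subset_UNIV sT less R(2,3) const[OF sT] small] dichq[OF sT] by simp
      moreover have "\<beta>\<^sub>p * T - ln k\<^sub>p - L R * (\<omega> * T) \<le> ln (q (s + T) - p (s + T)) - ln (q s - p s)"
        using log_gap_lower_of_close[OF sol subset_UNIV sT less R(2,3) const[OF sT] small] dichp[OF sT] by simp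
      moreover have "(\<beta>\<^sub>p + \<beta>\<^sub>q) * T = 2 * (ln k\<^sub>p + ln k\<^sub>q + 1)" using kp kq by (simp add: T_def)
      moreover have "L R * (\<omega> * T) \<le> (\<beta>\<^sub>p + \<beta>\<^sub>q) * T / 4"
      proof -
        have "L R * \<omega> \<le> (L R + 1) * \<omega>" using \<open>\<omega> > 0\<close> by simp
        also have "\<dots> = (\<beta>\<^sub>p + \<beta>\<^sub>q) / 4" using L by (simp add: \<omega>_def field_simps)
        finally have "L R * \<omega> * T \<le> (\<beta>\<^sub>p + \<beta>\<^sub>q) / 4 * T" using \<open>T \<ge> 0\<close> by (rule mult_right_mono)
        then show ?thesis by (simp add: mult.assoc)
      qed
      ultimately show False by (simp add: distrib_right)
    qed
    then obtain t where t: "s \<le> t" "t \<le> s + T" "\<omega> < q t - p t" by auto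
    have "q u - p u \<le> 2 * R" for u using R(2)[of u] R(3)[of u] by linarith
    from log_gap_upper_of_close[OF sol subset_UNIV t(1) less R(2,3) const[OF t(1)] this]
    have "ln (q t - p t) - ln (q s - p s) \<le> ln k\<^sub>q - \<beta>\<^sub>q * (t - s) + L R * (2 * R * (t - s))"
      using dichq[OF t(1)] by simp
    moreover have "\<beta>\<^sub>q * (t - s) \<ge> 0" using kq t by simp
    moreover have "L R * (2 * R * (t - s)) \<le> L R * (2 * R * T)"
      using L R(1) t by (intro mult_left_mono) auto
    moreover have "ln \<omega> \<le> ln (q t - p t)" using t \<open>\<omega> > 0\<close> by (intro ln_mono) auto
    ultimately have "ln \<omega> - ln k\<^sub>q - L R * (2 * R * T) \<le> ln (q s - p s)" by linarith
    then have "\<eta> \<le> exp (ln (q s - p s))" unfolding \<eta>_def by simp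
    then show ?thesis using less[of s] by simp
  qed
  then show ?thesis using that[of \<eta>] by (simp add: \<eta>_def)
qed

section \<open>Exponential convergence to \<open>a\<close> forward and to \<open>r\<close> backward
  in time\<close>

lemma attraction_from_above:
  assumes a: "caratheodory_solution f UNIV a" and pair: "attractive_pair f a k \<beta>"
    and y: "caratheodory_solution f {s..} y" and "a s \<le> y s" and "s \<le> t"
  shows "\<bar>a t - y t\<bar> \<le> k * exp (- \<beta> * (t - s)) * \<bar>a s - y s\<bar>"
proof (cases "a s = y s")
  case True
  then have "a t = y t" using solution_unique'[OF a y] \<open>s \<le> t\<close> by auto
  then show ?thesis using True by simp
next
  case False
  have a': "caratheodory_solution f {s..} a"
    by (rule caratheodory_solution_subset[OF a]) (auto simp: is_interval_ci)
  have less: "a u < y u" if "u \<in> {s..t}" for u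
    using solution_less[OF a' y, of s u] False \<open>a s \<le> y s\<close> that by auto
  have sub: "{s..t} \<subseteq> {s..}" by auto
  obtain R\<^sub>a where Ra: "\<And>u. u \<in> {s..t} \<Longrightarrow> \<bar>a u\<bar> \<le> R\<^sub>a" using solution_bound[OF a' sub] by blast
  obtain R\<^sub>y where Ry: "\<And>u. u \<in> {s..t} \<Longrightarrow> \<bar>y u\<bar> \<le> R\<^sub>y" using solution_bound[OF y sub] by blast
  \<comment> \<open>With separation 0 only concavity is used: above \<open>a\<close> the gap is
    dominated by the linearization along \<open>a\<close> itself, and the pair (k, \<beta>) is
    inherited unchanged.\<close>
  have "ln (y t - a t) - ln (y s - a s) \<le> integral {s..t} (\<lambda>u. x_deriv f u (a u)) - \<delta> (max R\<^sub>a R\<^sub>y) / 2 * 0 * (t - s)"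
    using Ra Ry less
    by (intro log_gap_upper_of_separated[OF a' y sub \<open>s \<le> t\<close>]) (auto simp: le_max_iff_disj less_imp_le)
  also have "\<dots> \<le> ln k + (- \<beta> * (t - s))"
    using pair \<open>s \<le> t\<close> unfolding attractive_pair_iff[OF a] by simp
  finally have "y t - a t \<le> k * exp (- \<beta> * (t - s)) * (y s - a s)"
    using less[of s] less[of t] \<open>s \<le> t\<close> pair
    by (intro le_mult_exp_of_ln_diff_le) (auto simp: attractive_pair_def)
  then show ?thesis using less[of s] less[of t] \<open>s \<le> t\<close> by (simp add: abs_if)
qed

lemma repulsion_from_below:
  assumes r: "caratheodory_solution f UNIV r" and pair: "repulsive_pair f r k \<beta>"
    and y: "caratheodory_solution f {..s} y" and "y s \<le> r s" and "t \<le> s"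
  shows "\<bar>r t - y t\<bar> \<le> k * exp (\<beta> * (t - s)) * \<bar>r s - y s\<bar>"
proof (cases "r s = y s")
  case True
  then have "r t = y t" using solution_unique'[OF r y] \<open>t \<le> s\<close> by auto
  then show ?thesis using True by simp
next
  case False
  have r': "caratheodory_solution f {..s} r"
    by (rule caratheodory_solution_subset[OF r]) (auto simp: is_interval_ic)
  have less: "y u < r u" if "u \<in> {t..s}" for u
    using solution_less[OF y r', of s u] False \<open>y s \<le> r s\<close> that by auto
  have sub: "{t..s} \<subseteq> {..s}" by auto
  obtain R\<^sub>r where Rr: "\<And>u. u \<in> {t..s} \<Longrightarrow> \<bar>r u\<bar> \<le> R\<^sub>r" using solution_bound[OF r' sub] by blast
  obtain R\<^sub>y where Ry: "\<And>u. u \<in> {t..s} \<Longrightarrow> \<bar>y u\<bar> \<le> R\<^sub>y" using solution_bound[OF y sub] by blast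
  have "integral {t..s} (\<lambda>u. x_deriv f u (r u)) + \<delta> (max R\<^sub>r R\<^sub>y) / 2 * 0 * (s - t) \<le> ln (r s - y s) - ln (r t - y t)"
    using Rr Ry less
    by (intro log_gap_lower_of_separated[OF y r' sub \<open>t \<le> s\<close>]) (auto simp: le_max_iff_disj less_imp_le)
  moreover have "\<beta> * (s - t) - ln k \<le> integral {t..s} (\<lambda>u. x_deriv f u (r u))"
    using pair \<open>t \<le> s\<close> unfolding repulsive_pair_iff[OF r] by simp
  ultimately have "ln (r t - y t) - ln (r s - y s) \<le> ln k + \<beta> * (t - s)"
    unfolding right_diff_distrib by linarith
  then have "r t - y t \<le> k * exp (\<beta> * (t - s)) * (r s - y s)"
    using less[of s] less[of t] \<open>t \<le> s\<close> pair
    by (intro le_mult_exp_of_ln_diff_le) (auto simp: repulsive_pair_def)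
  then show ?thesis using less[of s] less[of t] \<open>t \<le> s\<close> by (simp add: abs_if)
qed

text \<open>This is \<open>exp (L \<integral>\<omega>)\<close> for the bound \<open>\<omega>(t) = ((2R)\<^sup>2/\<epsilon>) exp(-\<gamma>|t - s|)\<close>, \<open>\<gamma> = \<delta>\<eta>/2\<close>, on the
  distance to the attracting solution.\<close>

definition transition_constant :: "real \<Rightarrow> real \<Rightarrow> real \<Rightarrow> real" where
  "transition_constant R \<eta> \<epsilon> = exp (L R * (2 * R * (2 * R) / \<epsilon> / (\<delta> R / 2 * \<eta>)))"

lemma transition_constant_ge_1:
  "\<eta> > 0 \<Longrightarrow> \<epsilon> > 0 \<Longrightarrow> transition_constant R \<eta> \<epsilon> \<ge> 1"
  using L_nonneg[of R] \<delta>_pos[of R] by (simp add: transition_constant_def)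

context
  fixes r a :: "real \<Rightarrow> real" and R \<eta> \<epsilon> :: real
  assumes r: "caratheodory_solution f UNIV r" and a: "caratheodory_solution f UNIV a"
    and R: "\<And>t. \<bar>r t\<bar> \<le> R" "\<And>t. \<bar>a t\<bar> \<le> R" "R > 0"
    and \<eta>: "\<eta> > 0" "\<And>t. \<eta> \<le> a t - r t" and \<epsilon>: "\<epsilon> > 0"
begin

private definition "\<gamma> = \<delta> R / 2 * \<eta>"
private definition "C = 2 * R * (2 * R) / \<epsilon>"

private lemma constants:
  "\<gamma> > 0" "C > 0" "ln C = ln (2 * R) + ln (2 * R) - ln \<epsilon>" "transition_constant R \<eta> \<epsilon> = exp (L R * (C / \<gamma>))"
proof -
  show "\<gamma> > 0" "C > 0" using \<eta>(1) \<epsilon> R(3) \<delta>_pos[of R] by (auto simp: \<gamma>_def C_def)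
  show "transition_constant R \<eta> \<epsilon> = exp (L R * (C / \<gamma>))"
    by (simp add: \<gamma>_def C_def transition_constant_def)
  have "2 * R > 0" "2 * R * (2 * R) > 0" using R(3) by auto
  then have "ln (2 * R * (2 * R) / \<epsilon>) = ln (2 * R * (2 * R)) - ln \<epsilon>" "ln (2 * R * (2 * R)) = ln (2 * R) + ln (2 * R)"
    using \<epsilon> by (metis ln_div ln_mult less_irrefl)+
  then show "ln C = ln (2 * R) + ln (2 * R) - ln \<epsilon>" by (simp only: C_def)
qed

private lemma tail: "L R * (C * (1 - exp z) / \<gamma>) \<le> L R * (C / \<gamma>)"
  using constants(1,2) L_nonneg[of R] by (intro mult_left_mono divide_right_mono) auto

text \<open>The ratio of the distances to \<open>r\<close> and to \<open>a\<close> grows exponentially by d-concavity, so the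
  distance to \<open>a\<close> is integrable in time and the linearization along \<open>a\<close> loses only a constant.\<close>

lemma attraction_between:
  assumes pair: "attractive_pair f a k \<beta>" and y: "caratheodory_solution f {s..} y"
    and start: "r s + \<epsilon> \<le> y s" "y s < a s" and "s \<le> t"
  shows "\<bar>a t - y t\<bar> \<le> k * transition_constant R \<eta> \<epsilon> * exp (- \<beta> * (t - s)) * \<bar>a s - y s\<bar>"
proof -
  have a': "caratheodory_solution f {s..} a" and r': "caratheodory_solution f {s..} r"
    using caratheodory_solution_subset[OF a] caratheodory_solution_subset[OF r] by (auto simp: is_interval_ci)
  have below: "y u < a u" and above: "r u < y u" if "s \<le> u" for u
    using solution_less[OF y a', of s u] solution_less[OF r' y, of s u] start \<epsilon> that by auto
  have Ry: "\<bar>y u\<bar> \<le> R" if "s \<le> u" for u using below[OF that] above[OF that] R(1)[of u] R(2)[of u] by linarith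
  \<comment> \<open>At time \<open>s\<close> the ratio of the distances to \<open>r\<close> and to
    \<open>a\<close> is at least \<open>\<epsilon> / (2 * R)\<close>. It grows at rate
    \<open>\<gamma>\<close> while its numerator stays below \<open>2 * R\<close>, which gives the
    constant \<open>C\<close>.\<close>
  have decay: "a u - y u \<le> C * exp (- \<gamma> * (u - s))" if "s \<le> u" for u
  proof -
    have "\<gamma> * (u - s) \<le> (ln (y u - r u) - ln (y s - r s)) - (ln (a u - y u) - ln (a s - y s))"
      unfolding \<gamma>_def using that below above R \<eta> by (intro log_ratio_growth[OF r' y a']) auto
    moreover have "ln (y u - r u) \<le> ln (2 * R)" "ln (a s - y s) \<le> ln (2 * R)" "ln \<epsilon> \<le> ln (y s - r s)"
      using below[of s] above[of u] Ry[of s] Ry[of u] R(1)[of u] R(2)[of s] start \<epsilon> that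
      by (auto intro!: ln_mono)
    ultimately have "ln (a u - y u) - ln 1 \<le> ln C + (- \<gamma> * (u - s))"
      using constants(3) by simp
    then show ?thesis
      using le_mult_exp_of_ln_diff_le[of "a u - y u" 1 C "- \<gamma> * (u - s)"] below[OF that] constants by simp
  qed
  have "ln (a t - y t) - ln (a s - y s) \<le> integral {s..t} (\<lambda>u. x_deriv f u (a u)) + L R * (C * (1 - exp (- \<gamma> * (t - s))) / \<gamma>)"
    using below Ry R(2) decay
    by (intro log_gap_upper_of_close[OF y a' _ \<open>s \<le> t\<close> _ _ _ has_integral_exp_decay(1)[OF constants(1) \<open>s \<le> t\<close>]]) auto
  also have "\<dots> \<le> (ln k - \<beta> * (t - s)) + L R * (C / \<gamma>)"
    using pair \<open>s \<le> t\<close> unfolding attractive_pair_iff[OF a] by (intro add_mono tail) simp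
  also have "\<dots> = ln (k * transition_constant R \<eta> \<epsilon>) + (- \<beta> * (t - s))"
    using pair constants(4) by (simp add: attractive_pair_def ln_mult)
  finally have "a t - y t \<le> k * transition_constant R \<eta> \<epsilon> * exp (- \<beta> * (t - s)) * (a s - y s)"
    using below[of s] below[of t] \<open>s \<le> t\<close> pair constants(4)
    by (intro le_mult_exp_of_ln_diff_le) (auto simp: attractive_pair_def)
  then show ?thesis using below[of s] below[of t] \<open>s \<le> t\<close> by (simp add: abs_if)
qed

text \<open>Read backward, the same ratio of distances tends to 0. Now \<open>a s - y s\<close>
  supplies the lower bound \<open>\<epsilon>\<close>, and the distance to \<open>r\<close> is the
  integrable one.\<close>

lemma repulsion_between:
  assumes pair: "repulsive_pair f r k \<beta>" and y: "caratheodory_solution f {..s} y"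
    and start: "y s \<le> a s - \<epsilon>" "r s < y s" and "t \<le> s"
  shows "\<bar>r t - y t\<bar> \<le> k * transition_constant R \<eta> \<epsilon> * exp (\<beta> * (t - s)) * \<bar>r s - y s\<bar>"
proof -
  have a': "caratheodory_solution f {..s} a" and r': "caratheodory_solution f {..s} r"
    using caratheodory_solution_subset[OF a] caratheodory_solution_subset[OF r] by (auto simp: is_interval_ic)
  have below: "y u < a u" and above: "r u < y u" if "u \<le> s" for u
    using solution_less[OF y a', of s u] solution_less[OF r' y, of s u] start \<epsilon> that by auto
  have Ry: "\<bar>y u\<bar> \<le> R" if "u \<le> s" for u using below[OF that] above[OF that] R(1)[of u] R(2)[of u] by linarith
  have decay: "y u - r u \<le> C * exp (- \<gamma> * (s - u))" if "u \<le> s" for u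
  proof -
    have "\<gamma> * (s - u) \<le> (ln (y s - r s) - ln (y u - r u)) - (ln (a s - y s) - ln (a u - y u))"
      unfolding \<gamma>_def using that below above R \<eta> by (intro log_ratio_growth[OF r' y a']) auto
    moreover have "ln (y s - r s) \<le> ln (2 * R)" "ln (a u - y u) \<le> ln (2 * R)" "ln \<epsilon> \<le> ln (a s - y s)"
      using below[of u] above[of s] Ry[of s] Ry[of u] R(1)[of s] R(2)[of u] start \<epsilon> that
      by (auto intro!: ln_mono)
    ultimately have "ln (y u - r u) - ln 1 \<le> ln C + (- \<gamma> * (s - u))"
      using constants(3) by simp
    then show ?thesis
      using le_mult_exp_of_ln_diff_le[of "y u - r u" 1 C "- \<gamma> * (s - u)"] above[OF that] constants by simp
  qed
  have "integral {t..s} (\<lambda>u. x_deriv f u (r u)) - L R * (C * (1 - exp (- \<gamma> * (s - t))) / \<gamma>) \<le> ln (y s - r s) - ln (y t - r t)"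
    using above Ry R(1) decay
    by (intro log_gap_lower_of_close[OF r' y _ \<open>t \<le> s\<close> _ _ _ has_integral_exp_decay(2)[OF constants(1) \<open>t \<le> s\<close>]]) auto
  moreover have "\<beta> * (s - t) - ln k \<le> integral {t..s} (\<lambda>u. x_deriv f u (r u))"
    using pair \<open>t \<le> s\<close> unfolding repulsive_pair_iff[OF r] by simp
  ultimately have "ln (y t - r t) - ln (y s - r s) \<le> (ln k + L R * (C / \<gamma>)) + \<beta> * (t - s)"
    using tail[of "- \<gamma> * (s - t)"] unfolding right_diff_distrib by linarith
  also have "ln k + L R * (C / \<gamma>) = ln (k * transition_constant R \<eta> \<epsilon>)"
    using pair constants(4) by (simp add: repulsive_pair_def ln_mult)
  finally have "y t - r t \<le> k * transition_constant R \<eta> \<epsilon> * exp (\<beta> * (t - s)) * (y s - r s)"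
    using above[of s] above[of t] \<open>t \<le> s\<close> pair constants(4)
    by (intro le_mult_exp_of_ln_diff_le) (auto simp: repulsive_pair_def)
  then show ?thesis using above[of s] above[of t] \<open>t \<le> s\<close> by (simp add: abs_if)
qed

end

end

section \<open>Consequences for the extremal bounded solutions\<close>

context dconcave_rhs
begin

text \<open>Extremality is stated through \<open>sol\<close>; by \<open>sol_eq\<close> the maximal
  solution through a point of \<open>b\<close> is \<open>b\<close> itself, so the criterion applies
  at every time.\<close>

lemma bounded_solution_between:
  assumes "extremal_bounded_solutions f r a" and b: "bounded_solution f b"
  shows "r t \<le> b t \<and> b t \<le> a t"
proof -
  have sol: "caratheodory_solution f UNIV b" using b by (simp add: bounded_solution_def)
  have "sol_dom f t (b t) = UNIV" "\<And>u. sol f u t (b t) = b u"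
    using sol_eq[OF sol, of t] by auto
  then have "sol_dom f t (b t) = UNIV \<and> bounded (range (\<lambda>u. sol f u t (b t)))"
    using b by (simp add: bounded_solution_def)
  then show ?thesis using assms(1) unfolding extremal_bounded_solutions_def by blast
qed

lemma hyperbolic_ordered:
  assumes p: "hyperbolic f p" and q: "hyperbolic f q" and less: "\<And>t. p t < q t"
  shows "hyperbolic_repulsive f p" "hyperbolic_attractive f q"
proof -
  have "bounded_solution f p" "bounded_solution f q"
    using p q by (auto simp: hyperbolic_def hyperbolic_attractive_def hyperbolic_repulsive_def)
  from hyperbolic_type_of_ordered[OF this less]
  show "hyperbolic_repulsive f p" "hyperbolic_attractive f q"
    using p q by (auto simp: hyperbolic_def)
qed

text \<open>Two hyperbolic solutions are ordered and have a gap bounded below. Both lie between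
  \<open>r\<close> and \<open>a\<close>, whose gap is at least as large.\<close>

lemma separated_of_two_hyperbolic:
  assumes ext: "extremal_bounded_solutions f r a"
    and hyp: "hyperbolic f b1" "hyperbolic f b2" and "b1 \<noteq> b2"
  shows "(INF t. a t - r t) > 0"
proof -
  have *: "(INF t. a t - r t) > 0" if p: "hyperbolic f p" and q: "hyperbolic f q" and less: "\<forall>t. p t < q t" for p q
  proof -
    obtain \<eta> where \<eta>: "\<eta> > 0" "\<And>t. \<eta> \<le> q t - p t"
      using separated_of_hyperbolic[OF hyperbolic_ordered[OF p q]] less by blast
    have "bounded_solution f p" "bounded_solution f q"
      using p q by (auto simp: hyperbolic_def hyperbolic_attractive_def hyperbolic_repulsive_def)
    then have "r t \<le> p t" "q t \<le> a t" for t using bounded_solution_between[OF ext] by auto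
    then have "\<eta> \<le> a t - r t" for t using \<eta>(2)[of t] by (meson diff_mono order_trans)
    then have "\<eta> \<le> (INF t. a t - r t)" by (intro cINF_greatest) auto
    then show ?thesis using \<eta>(1) by linarith
  qed
  have "bounded_solution f b1" "bounded_solution f b2"
    using hyp by (auto simp: hyperbolic_def hyperbolic_attractive_def hyperbolic_repulsive_def)
  then show ?thesis
    by (rule bounded_solution_cases) (use *[OF hyp] *[OF hyp(2,1)] \<open>b1 \<noteq> b2\<close> in auto)
qed

context
  fixes a r :: "real \<Rightarrow> real" and \<eta> :: real
  assumes ext: "extremal_bounded_solutions f r a"
    and \<eta>: "\<eta> > 0" "\<And>t. \<eta> \<le> a t - r t"
begin

private lemma bounded_sols: "bounded_solution f r" "bounded_solution f a"
  using ext by (auto simp: extremal_bounded_solutions_def)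

private lemma sols: "caratheodory_solution f UNIV r" "caratheodory_solution f UNIV a"
  using bounded_sols by (auto simp: bounded_solution_def)

private lemma less: "r t < a t"
  using \<eta>(1) \<eta>(2)[of t] by linarith

private lemma hyp: "hyperbolic_attractive f a" "hyperbolic_repulsive f r"
  using hyperbolic_of_separated[OF bounded_sols \<eta>] by auto

text \<open>A dichotomy pair may be of either kind by definition; the order of \<open>r\<close> and
  \<open>a\<close> excludes the wrong one, so the estimates hold for every given pair.\<close>

private lemma dichotomy_pairs:
  "dichotomy_pair f a k \<beta> \<Longrightarrow> attractive_pair f a k \<beta>" "dichotomy_pair f r k \<beta> \<Longrightarrow> repulsive_pair f r k \<beta>"
  using hyperbolic_type_of_ordered[OF bounded_sols less] bounded_sols
  by (auto simp: dichotomy_pair_def hyperbolic_attractive_def hyperbolic_repulsive_def)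

text \<open>Membership in \<open>sol_dom\<close> accompanies the value because \<open>sol\<close> is
  unspecified outside that set.\<close>

lemma sol_above:
  assumes "r s \<le> x0" "s \<le> t"
  obtains y where "caratheodory_solution f {s..} y" "y s = x0" "t \<in> sol_dom f s x0" "sol f t s x0 = y t"
proof -
  obtain y where y: "caratheodory_solution f {s..} y" "y s = x0"
    using forward_solution[where s = s, OF bounded_sols(1) assms(1)] by blast
  then show ?thesis using that[OF y] sol_eq[OF y(1), of s t] assms by auto
qed

lemma sol_below:
  assumes "x0 \<le> a s" "t \<le> s"
  obtains y where "caratheodory_solution f {..s} y" "y s = x0" "t \<in> sol_dom f s x0" "sol f t s x0 = y t"
proof -
  obtain y where y: "caratheodory_solution f {..s} y" "y s = x0"
    using backward_solution[where s = s, OF bounded_sols(2) assms(1)] by blast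
  then show ?thesis using that[OF y] sol_eq[OF y(1), of s t] assms by auto
qed

lemma attraction_estimate_above:
  assumes "dichotomy_pair f a k \<beta>" "a s \<le> x0" "s \<le> t"
  shows "t \<in> sol_dom f s x0 \<and> \<bar>a t - sol f t s x0\<bar> \<le> k * exp (- \<beta> * (t - s)) * \<bar>a s - x0\<bar>"
proof -
  have "r s \<le> x0" using less[of s] assms by simp
  then obtain y where y: "caratheodory_solution f {s..} y" "y s = x0" "t \<in> sol_dom f s x0" "sol f t s x0 = y t"
    using sol_above assms(3) by blast
  then show ?thesis
    using attraction_from_above[OF sols(2) dichotomy_pairs(1)[OF assms(1)] y(1) _ assms(3)] assms by simp
qed

lemma repulsion_estimate_below:
  assumes "dichotomy_pair f r k \<beta>" "x0 \<le> r s" "t \<le> s"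
  shows "t \<in> sol_dom f s x0 \<and> \<bar>r t - sol f t s x0\<bar> \<le> k * exp (\<beta> * (t - s)) * \<bar>r s - x0\<bar>"
proof -
  have "x0 \<le> a s" using less[of s] assms by simp
  then obtain y where y: "caratheodory_solution f {..s} y" "y s = x0" "t \<in> sol_dom f s x0" "sol f t s x0 = y t"
    using sol_below assms(3) by blast
  then show ?thesis
    using repulsion_from_below[OF sols(1) dichotomy_pairs(2)[OF assms(1)] y(1) _ assms(3)] assms by simp
qed

lemma attraction_estimate:
  assumes pair: "dichotomy_pair f a k \<beta>" and \<beta>': "\<beta>' \<in> {0<..<\<beta>}" and "\<epsilon> > 0"
  shows "\<exists>k'\<ge>1. \<forall>s t x0. x0 \<ge> r s + \<epsilon> \<and> t \<ge> s \<longrightarrow>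
    t \<in> sol_dom f s x0 \<and> \<bar>a t - sol f t s x0\<bar> \<le> k' * exp (- \<beta>' * (t - s)) * \<bar>a s - x0\<bar>"
proof -
  obtain R where R: "R > 0" "\<And>t. \<bar>r t\<bar> \<le> R" "\<And>t. \<bar>a t\<bar> \<le> R"
    using bounded_solution_pair_bound[OF bounded_sols] by blast
  note pair' = dichotomy_pairs(1)[OF pair]
  then have "k \<ge> 1" by (simp add: attractive_pair_def)
  define K where "K = transition_constant R \<eta> \<epsilon>"
  have "K \<ge> 1" unfolding K_def by (rule transition_constant_ge_1[OF \<eta>(1) \<open>\<epsilon> > 0\<close>])
  have "k * 1 \<le> k * K" using \<open>K \<ge> 1\<close> \<open>k \<ge> 1\<close> by (intro mult_left_mono) auto
  then have kK: "k \<le> k * K" "1 \<le> k * K" using \<open>k \<ge> 1\<close> by linarith+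
  show ?thesis
  proof (intro exI[of _ "k * K"] conjI allI impI)
    fix s t x0 assume "x0 \<ge> r s + \<epsilon> \<and> t \<ge> s"
    then have st: "r s + \<epsilon> \<le> x0" "s \<le> t" by auto
    \<comment> \<open>Proved with the rate \<open>\<beta>\<close> of the given pair; the rate
      \<open>\<beta>'\<close> then follows from monotonicity of the exponential for
      \<open>t \<ge> s\<close>.\<close>
    have est: "t \<in> sol_dom f s x0 \<and> \<bar>a t - sol f t s x0\<bar> \<le> k * K * exp (- \<beta> * (t - s)) * \<bar>a s - x0\<bar>"
    proof (cases "a s \<le> x0")
      case True
      have "k * exp (- \<beta> * (t - s)) * \<bar>a s - x0\<bar> \<le> k * K * exp (- \<beta> * (t - s)) * \<bar>a s - x0\<bar>"
        using kK by (intro mult_right_mono) auto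
      then show ?thesis using attraction_estimate_above[OF pair True st(2)] by auto
    next
      case False
      have "r s \<le> x0" using st(1) \<open>\<epsilon> > 0\<close> by simp
      then obtain y where y: "caratheodory_solution f {s..} y" "y s = x0" "t \<in> sol_dom f s x0" "sol f t s x0 = y t"
        using sol_above st(2) by blast
      then show ?thesis
        using attraction_between[OF sols R(2,3,1) \<eta> \<open>\<epsilon> > 0\<close> pair' y(1) _ _ st(2)] st(1) False
        by (simp add: K_def)
    qed
    then show "t \<in> sol_dom f s x0" by simp
    have "exp (- \<beta> * (t - s)) \<le> exp (- \<beta>' * (t - s))"
      using \<beta>' st(2) by (auto intro!: mult_right_mono)
    then have "k * K * exp (- \<beta> * (t - s)) * \<bar>a s - x0\<bar> \<le> k * K * exp (- \<beta>' * (t - s)) * \<bar>a s - x0\<bar>"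
      using kK by (intro mult_right_mono mult_left_mono) auto
    then show "\<bar>a t - sol f t s x0\<bar> \<le> k * K * exp (- \<beta>' * (t - s)) * \<bar>a s - x0\<bar>" using est by linarith
  qed (rule kK)
qed

lemma repulsion_estimate:
  assumes pair: "dichotomy_pair f r k \<beta>" and \<beta>': "\<beta>' \<in> {0<..<\<beta>}" and "\<epsilon> > 0"
  shows "\<exists>k'\<ge>1. \<forall>s t x0. x0 \<le> a s - \<epsilon> \<and> t \<le> s \<longrightarrow>
    t \<in> sol_dom f s x0 \<and> \<bar>r t - sol f t s x0\<bar> \<le> k' * exp (\<beta>' * (t - s)) * \<bar>r s - x0\<bar>"
proof -
  obtain R where R: "R > 0" "\<And>t. \<bar>r t\<bar> \<le> R" "\<And>t. \<bar>a t\<bar> \<le> R"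
    using bounded_solution_pair_bound[OF bounded_sols] by blast
  note pair' = dichotomy_pairs(2)[OF pair]
  then have "k \<ge> 1" by (simp add: repulsive_pair_def)
  define K where "K = transition_constant R \<eta> \<epsilon>"
  have "K \<ge> 1" unfolding K_def by (rule transition_constant_ge_1[OF \<eta>(1) \<open>\<epsilon> > 0\<close>])
  have "k * 1 \<le> k * K" using \<open>K \<ge> 1\<close> \<open>k \<ge> 1\<close> by (intro mult_left_mono) auto
  then have kK: "k \<le> k * K" "1 \<le> k * K" using \<open>k \<ge> 1\<close> by linarith+
  show ?thesis
  proof (intro exI[of _ "k * K"] conjI allI impI)
    fix s t x0 assume "x0 \<le> a s - \<epsilon> \<and> t \<le> s"
    then have st: "x0 \<le> a s - \<epsilon>" "t \<le> s" by auto
    have est: "t \<in> sol_dom f s x0 \<and> \<bar>r t - sol f t s x0\<bar> \<le> k * K * exp (\<beta> * (t - s)) * \<bar>r s - x0\<bar>"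
    proof (cases "x0 \<le> r s")
      case True
      have "k * exp (\<beta> * (t - s)) * \<bar>r s - x0\<bar> \<le> k * K * exp (\<beta> * (t - s)) * \<bar>r s - x0\<bar>"
        using kK by (intro mult_right_mono) auto
      then show ?thesis using repulsion_estimate_below[OF pair True st(2)] by auto
    next
      case False
      have "x0 \<le> a s" using st(1) \<open>\<epsilon> > 0\<close> by simp
      then obtain y where y: "caratheodory_solution f {..s} y" "y s = x0" "t \<in> sol_dom f s x0" "sol f t s x0 = y t"
        using sol_below st(2) by blast
      then show ?thesis
        using repulsion_between[OF sols R(2,3,1) \<eta> \<open>\<epsilon> > 0\<close> pair' y(1) _ _ st(2)] st(1) False
        by (simp add: K_def)
    qed
    then show "t \<in> sol_dom f s x0" by simp
    have "exp (\<beta> * (t - s)) \<le> exp (\<beta>' * (t - s))"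
      using \<beta>' st(2) by (auto intro!: mult_right_mono_neg)
    then have "k * K * exp (\<beta> * (t - s)) * \<bar>r s - x0\<bar> \<le> k * K * exp (\<beta>' * (t - s)) * \<bar>r s - x0\<bar>"
      using kK by (intro mult_right_mono mult_left_mono) auto
    then show "\<bar>r t - sol f t s x0\<bar> \<le> k * K * exp (\<beta>' * (t - s)) * \<bar>r s - x0\<bar>" using est by linarith
  qed (rule kK)
qed

lemma strictly_between:
  assumes b: "bounded_solution f b"
  shows "b \<noteq> a \<Longrightarrow> b t < a t" "b \<noteq> r \<Longrightarrow> r t < b t"
  using bounded_solution_cases[OF b bounded_sols(2)] bounded_solution_cases[OF b bounded_sols(1)]
    bounded_solution_between[OF ext b] by (metis not_less)+

text \<open>Any other bounded solution lies strictly between \<open>r\<close> and \<open>a\<close>.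
  Being below \<open>a\<close> it cannot be attractive, and being above \<open>r\<close> it cannot
  be repulsive.\<close>

lemma hyperbolic_iff:
  "hyperbolic f b \<longleftrightarrow> b = a \<or> b = r"
proof
  assume b: "hyperbolic f b"
  then have bs: "bounded_solution f b"
    by (auto simp: hyperbolic_def hyperbolic_attractive_def hyperbolic_repulsive_def)
  show "b = a \<or> b = r"
  proof (rule ccontr)
    assume "\<not> (b = a \<or> b = r)"
    then have "\<And>t. b t < a t" "\<And>t. r t < b t" using strictly_between[OF bs] by auto
    from hyperbolic_type_of_ordered(1)[OF bs bounded_sols(2) this(1)]
      hyperbolic_type_of_ordered(2)[OF bounded_sols(1) bs this(2)]
    show False using b by (simp add: hyperbolic_def)
  qed
next
  assume "b = a \<or> b = r"
  then show "hyperbolic f b" using hyp by (auto simp: hyperbolic_def)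
qed

text \<open>Uniform separation makes both solutions hyperbolic, and \<open>hyperbolic_iff\<close>
  leaves only \<open>a\<close> and \<open>r\<close> for them.\<close>

lemma uniformly_separated_iff:
  "bounded_solution f b1 \<and> bounded_solution f b2 \<and> uniformly_separated b1 b2 \<longleftrightarrow> {b1, b2} = {a, r}"
proof
  assume "bounded_solution f b1 \<and> bounded_solution f b2 \<and> uniformly_separated b1 b2"
  then have b: "bounded_solution f b1" "bounded_solution f b2" and sep: "(INF t. \<bar>b1 t - b2 t\<bar>) > 0"
    by (auto simp: uniformly_separated_def)
  define \<kappa> where "\<kappa> = (INF t. \<bar>b1 t - b2 t\<bar>)"
  have \<kappa>: "\<kappa> > 0" "\<kappa> \<le> \<bar>b1 t - b2 t\<bar>" for t
    using sep unfolding \<kappa>_def by (auto intro!: cINF_lower bdd_belowI[of _ 0])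
  have "b1 \<noteq> b2" using \<kappa>(1) \<kappa>(2)[of 0] by auto
  moreover have "hyperbolic f b1 \<and> hyperbolic f b2"
    using b
  proof (rule bounded_solution_cases)
    assume "\<forall>t. b1 t < b2 t"
    then have "\<kappa> \<le> b2 t - b1 t" for t using \<kappa>(2)[of t] by (metis abs_minus_commute abs_of_pos diff_gt_0_iff_gt)
    from hyperbolic_of_separated[OF b \<kappa>(1) this] show ?thesis by (simp add: hyperbolic_def)
  next
    assume "\<forall>t. b2 t < b1 t"
    then have "\<kappa> \<le> b1 t - b2 t" for t using \<kappa>(2)[of t] by (metis abs_of_pos diff_gt_0_iff_gt)
    from hyperbolic_of_separated[OF b(2,1) \<kappa>(1) this] show ?thesis by (simp add: hyperbolic_def)
  qed (use \<open>b1 \<noteq> b2\<close> in simp)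
  ultimately show "{b1, b2} = {a, r}" unfolding hyperbolic_iff by auto
next
  assume "{b1, b2} = {a, r}"
  then have b: "b1 = a \<and> b2 = r \<or> b1 = r \<and> b2 = a" by (auto simp: doubleton_eq_iff)
  then have "\<eta> \<le> \<bar>b1 t - b2 t\<bar>" for t using \<eta>(2)[of t] by auto
  then have "\<eta> \<le> (INF t. \<bar>b1 t - b2 t\<bar>)" by (intro cINF_greatest) auto
  then have "uniformly_separated b1 b2" using \<eta>(1) by (simp add: uniformly_separated_def)
  then show "bounded_solution f b1 \<and> bounded_solution f b2 \<and> uniformly_separated b1 b2"
    using b bounded_sols by auto
qed

end

end

section \<open>From the conditions (f1)-(f7) to the constants of \<open>dconcave_rhs\<close>\<close>

lemma SUP_ereal_leD:
  assumes "(SUP x\<in>A. ereal (g x)) \<le> ereal c" "x \<in> A"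
  shows "g x \<le> c"
  using assms by (auto simp: SUP_le_iff)

text \<open>The conditions are indexed by natural numbers and the locales by real radii; rounding up
  translates between them.\<close>

lemma abs_le_nat_ceiling:
  assumes "\<bar>x\<bar> \<le> R"
  shows "x \<in> {- real (nat \<lceil>R\<rceil>)..real (nat \<lceil>R\<rceil>)}"
  using assms real_nat_ceiling_ge[of R] unfolding atLeastAtMost_iff by linarith

text \<open>The constants are chosen for each \<open>j\<close> before \<open>t\<close> is
  considered; as there are countably many \<open>j\<close>, their null sets merge into one.\<close>

lemma AE_lebesgue_choice:
  assumes "\<forall>j::nat. \<exists>c. Q c \<and> (AE t in lebesgue. P j c t)"
  obtains E c where "negligible E" "\<forall>j. Q (c j)" "\<forall>j t. t \<notin> E \<longrightarrow> P j (c j) t"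
proof -
  from choice[OF assms] obtain c where c: "\<forall>j. Q (c j) \<and> (AE t in lebesgue. P j (c j) t)" by blast
  then have "AE t in lebesgue. \<forall>j. P j (c j) t" by (simp add: AE_all_countable)
  then obtain E where "negligible E" "\<forall>t. t \<notin> E \<longrightarrow> (\<forall>j. P j (c j) t)"
    unfolding AE_lebesgue_iff_negligible by blast
  then show ?thesis using c by (intro that[of E c]) auto
qed

lemma AE_lebesgue_choice':
  assumes "\<forall>j::nat. \<exists>c. AE t in lebesgue. P j c t"
  obtains E c where "negligible E" "\<forall>j t. t \<notin> E \<longrightarrow> P j (c j) t"
  using AE_lebesgue_choice[of "\<lambda>_. True" P] assms by auto

definition lipschitz_off :: "real set \<Rightarrow> (real \<Rightarrow> real) \<Rightarrow> (real \<Rightarrow> real \<Rightarrow> real) \<Rightarrow> bool" where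
  "lipschitz_off E l F \<longleftrightarrow> (\<forall>R t x y. t \<notin> E \<longrightarrow> \<bar>x\<bar> \<le> R \<longrightarrow> \<bar>y\<bar> \<le> R \<longrightarrow> \<bar>F t x - F t y\<bar> \<le> l R * \<bar>x - y\<bar>)"

lemma cond_f3_lipschitz:
  assumes "cond_f3 F"
  obtains E l where "negligible E" "lipschitz_off E l F" "\<forall>R. l R \<ge> 0"
proof -
  obtain E l where "negligible E" "\<forall>j t. t \<notin> E \<longrightarrow>
      (SUP (x1, x2)\<in>distinct_pairs j. ereal (\<bar>F t x2 - F t x1\<bar> / \<bar>x2 - x1\<bar>)) \<le> ereal (l j)"
    using assms unfolding cond_f3_def by (rule AE_lebesgue_choice')
  note E = this(1) this(2)[rule_format]
  show ?thesis
  proof (rule that)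
    show "negligible E" by (rule E(1))
    \<comment> \<open>For \<open>j = 0\<close> the supremum runs over the empty set, and the
      condition then allows a negative constant; hence the absolute value.\<close>
    show "\<forall>R. \<bar>l (nat \<lceil>R\<rceil>)\<bar> \<ge> 0" by simp
    show "lipschitz_off E (\<lambda>R. \<bar>l (nat \<lceil>R\<rceil>)\<bar>) F"
      unfolding lipschitz_off_def
    proof (intro allI impI)
      fix R t x y :: real assume t: "t \<notin> E" and R: "\<bar>x\<bar> \<le> R" "\<bar>y\<bar> \<le> R"
      show "\<bar>F t x - F t y\<bar> \<le> \<bar>l (nat \<lceil>R\<rceil>)\<bar> * \<bar>x - y\<bar>"
      proof (cases "x = y")
        case False
        have "(y, x) \<in> distinct_pairs (nat \<lceil>R\<rceil>)"
          using abs_le_nat_ceiling[OF R(1)] abs_le_nat_ceiling[OF R(2)] False by (simp add: distinct_pairs_def)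
        then have "\<bar>F t x - F t y\<bar> / \<bar>x - y\<bar> \<le> l (nat \<lceil>R\<rceil>)"
          using E(2)[OF t, of "nat \<lceil>R\<rceil>"] by (fastforce simp: SUP_le_iff)
        also have "\<dots> \<le> \<bar>l (nat \<lceil>R\<rceil>)\<bar>" by simp
        finally show ?thesis using False by (simp add: divide_le_eq)
      qed simp
    qed
  qed
qed

lemma cond_f7_decreasing:
  assumes "cond_f7 f"
  obtains E \<delta> where "negligible E" "\<forall>R. \<delta> R > 0"
    "\<forall>R t x y. t \<notin> E \<longrightarrow> \<bar>x\<bar> \<le> R \<longrightarrow> \<bar>y\<bar> \<le> R \<longrightarrow> x < y \<longrightarrow> x_deriv f t y - x_deriv f t x \<le> - \<delta> R * (y - x)"
proof -
  obtain E \<delta> where "negligible E" "\<forall>j. \<delta> j > 0" "\<forall>j t. t \<notin> E \<longrightarrow>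
      (SUP (x1, x2)\<in>distinct_pairs j. ereal ((x_deriv f t x2 - x_deriv f t x1) / (x2 - x1))) < ereal (- \<delta> j)"
    using assms unfolding cond_f7_def by (rule AE_lebesgue_choice)
  note E = this(1) this(2,3)[rule_format]
  show ?thesis
  proof (rule that)
    show "negligible E" by (rule E(1))
    show "\<forall>R. \<delta> (nat \<lceil>R\<rceil>) > 0" using E(2) by blast
    show "\<forall>R t x y. t \<notin> E \<longrightarrow> \<bar>x\<bar> \<le> R \<longrightarrow> \<bar>y\<bar> \<le> R \<longrightarrow> x < y \<longrightarrow> x_deriv f t y - x_deriv f t x \<le> - \<delta> (nat \<lceil>R\<rceil>) * (y - x)"
    proof (intro allI impI)
      fix R t x y :: real assume t: "t \<notin> E" and R: "\<bar>x\<bar> \<le> R" "\<bar>y\<bar> \<le> R" and "x < y"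
      have "(x, y) \<in> distinct_pairs (nat \<lceil>R\<rceil>)"
        using abs_le_nat_ceiling[OF R(1)] abs_le_nat_ceiling[OF R(2)] \<open>x < y\<close> by (simp add: distinct_pairs_def)
      then have "(x_deriv f t y - x_deriv f t x) / (y - x) \<le> - \<delta> (nat \<lceil>R\<rceil>)"
        using less_imp_le[OF E(3)[OF t, of "nat \<lceil>R\<rceil>"]] by (fastforce simp: SUP_le_iff)
      then show "x_deriv f t y - x_deriv f t x \<le> - \<delta> (nat \<lceil>R\<rceil>) * (y - x)"
        using \<open>x < y\<close> by (simp add: divide_le_eq)
    qed
  qed
qed

lemma cond_f6_coercive:
  assumes "cond_f6 f"
  obtains E \<rho> where "negligible E" "\<forall>t x. t \<notin> E \<longrightarrow> \<rho> \<le> \<bar>x\<bar> \<longrightarrow> f t x < 0"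
proof -
  obtain T \<delta> where T: "- T \<in> null_sets lebesgue" and "\<delta> > 0"
    and top: "Limsup at_top (\<lambda>x. SUP t\<in>T. ereal (f t x / x\<^sup>2)) < ereal (- \<delta>)"
    and bot: "Limsup at_bot (\<lambda>x. SUP t\<in>T. ereal (f t x / x\<^sup>2)) < ereal (- \<delta>)"
    using assms unfolding cond_f6_def by blast
  obtain u where u: "\<And>x. u \<le> x \<Longrightarrow> (SUP t\<in>T. ereal (f t x / x\<^sup>2)) < ereal (- \<delta>)"
    using Limsup_lessD[OF top] unfolding eventually_at_top_linorder by blast
  obtain v where v: "\<And>x. x \<le> v \<Longrightarrow> (SUP t\<in>T. ereal (f t x / x\<^sup>2)) < ereal (- \<delta>)"
    using Limsup_lessD[OF bot] unfolding eventually_at_bot_linorder by blast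
  show ?thesis
  proof (rule that)
    show "negligible (- T)" using T by (simp add: negligible_iff_null_sets)
    \<comment> \<open>The 1 keeps \<open>x\<close> away from 0, where the quotient by
      \<open>x\<^sup>2\<close> says nothing about the sign of \<open>f\<close>; \<open>- v\<close>
      turns the threshold at minus infinity into one for the absolute value.\<close>
    show "\<forall>t x. t \<notin> - T \<longrightarrow> max 1 (max u (- v)) \<le> \<bar>x\<bar> \<longrightarrow> f t x < 0"
    proof (intro allI impI)
      fix t x assume t: "t \<notin> - T" and x: "max 1 (max u (- v)) \<le> \<bar>x\<bar>"
      then have "u \<le> x \<or> x \<le> v" by (auto simp: abs_if split: if_splits)
      then have "(SUP t\<in>T. ereal (f t x / x\<^sup>2)) \<le> ereal (- \<delta>)" using u v less_imp_le by blast
      then have "f t x / x\<^sup>2 \<le> - \<delta>" by (rule SUP_ereal_leD) (use t in simp)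
      then have "f t x / x\<^sup>2 < 0" using \<open>\<delta> > 0\<close> by linarith
      moreover have "x\<^sup>2 > 0" using x by (cases "x = 0") auto
      ultimately show "f t x < 0" by (simp add: divide_less_0_iff)
    qed
  qed
qed

lemma dconcave_rhs_of_conditions:
  assumes "cond_f1 f" "cond_f2 f" "cond_f3 f" "cond_f4 f" "cond_f5 f" "cond_f6 f" "cond_f7 f"
  obtains N m l L \<delta> \<rho> where "dconcave_rhs f N m l L \<delta> \<rho>"
proof -
  obtain E\<^sub>2 m where "negligible E\<^sub>2" "\<forall>j t. t \<notin> E\<^sub>2 \<longrightarrow>
      (SUP x\<in>{- real j..real j}. ereal \<bar>f t x\<bar>) \<le> ereal (m j)"
    using assms(2) unfolding cond_f2_def by (rule AE_lebesgue_choice')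
  note E2 = this(1) this(2)[rule_format]
  obtain E\<^sub>3 l where E3: "negligible E\<^sub>3" "lipschitz_off E\<^sub>3 l f" "\<forall>R. l R \<ge> 0"
    by (rule cond_f3_lipschitz[OF assms(3)])
  obtain E\<^sub>4 where E4: "negligible E\<^sub>4" "\<forall>t. t \<notin> E\<^sub>4 \<longrightarrow> f t C1_differentiable_on UNIV"
    using assms(4) unfolding cond_f4_def AE_lebesgue_iff_negligible by blast
  obtain E\<^sub>5 L where E5: "negligible E\<^sub>5" "lipschitz_off E\<^sub>5 L (x_deriv f)" "\<forall>R. L R \<ge> 0"
    by (rule cond_f3_lipschitz[OF assms(5)[unfolded cond_f5_def]])
  obtain E\<^sub>6 \<rho> where E6: "negligible E\<^sub>6" "\<forall>t x. t \<notin> E\<^sub>6 \<longrightarrow> \<rho> \<le> \<bar>x\<bar> \<longrightarrow> f t x < 0"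
    by (rule cond_f6_coercive[OF assms(6)])
  obtain E\<^sub>7 \<delta> where E7: "negligible E\<^sub>7" "\<forall>R. \<delta> R > 0"
    "\<forall>R t x y. t \<notin> E\<^sub>7 \<longrightarrow> \<bar>x\<bar> \<le> R \<longrightarrow> \<bar>y\<bar> \<le> R \<longrightarrow> x < y \<longrightarrow> x_deriv f t y - x_deriv f t x \<le> - \<delta> R * (y - x)"
    by (rule cond_f7_decreasing[OF assms(7)])
  define N where "N = E\<^sub>2 \<union> E\<^sub>3 \<union> E\<^sub>4 \<union> E\<^sub>5 \<union> E\<^sub>6 \<union> E\<^sub>7"
  have "dconcave_rhs f N (\<lambda>R. m (nat \<lceil>R\<rceil>)) l L \<delta> \<rho>"
  proof
    show "(\<lambda>(t, x). f t x) \<in> borel_measurable borel" using assms(1) by (simp add: cond_f1_def)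
    show "negligible N"
      unfolding N_def using E2(1) E3(1) E4(1) E5(1) E6(1) E7(1) by simp
    fix R t x assume t: "t \<notin> N"
    show "\<bar>f t x\<bar> \<le> m (nat \<lceil>R\<rceil>)" if "\<bar>x\<bar> \<le> R"
      using SUP_ereal_leD[OF E2(2) abs_le_nat_ceiling[OF that]] t by (auto simp: N_def)
    have "f t differentiable (at x)"
      using E4(2) t by (auto simp: N_def C1_differentiable_on_eq)
    then show "(f t has_real_derivative x_deriv f t x) (at x)"
      unfolding x_deriv_def using DERIV_deriv_iff_real_differentiable by blast
  qed (use E3(2) E5(2,3) E6(2) E7(2,3) in \<open>auto simp: N_def lipschitz_off_def\<close>)
  then show ?thesis by (rule that)
qed

theorem theorem3p4:
  fixes f :: "real \<Rightarrow> real \<Rightarrow> real" and a r :: "real \<Rightarrow> real"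
  assumes "cond_f1 f" and "cond_f2 f" and "cond_f3 f" and "cond_f4 f"
    and "cond_f5 f" and "cond_f6 f" and "cond_f7 f"
    and "\<exists>b. bounded_solution f b"
    and "extremal_bounded_solutions f r a"
  shows
    "((INF t. a t - r t) > 0 \<longleftrightarrow> hyperbolic_attractive f a \<and> hyperbolic_repulsive f r) \<and>
     (hyperbolic_attractive f a \<and> hyperbolic_repulsive f r \<longleftrightarrow>
        (\<exists>b1 b2. b1 \<noteq> b2 \<and> hyperbolic f b1 \<and> hyperbolic f b2)) \<and>
     ((INF t. a t - r t) > 0 \<longrightarrow>
        (\<forall>ka \<beta>a. dichotomy_pair f a ka \<beta>a \<longrightarrow>
           (\<forall>\<beta>'\<in>{0<..<\<beta>a}. \<forall>\<epsilon>>0. \<exists>k\<epsilon>\<ge>1. \<forall>s t x0. x0 \<ge> r s + \<epsilon> \<and> t \<ge> s \<longrightarrow>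
              t \<in> sol_dom f s x0 \<and>
              \<bar>a t - sol f t s x0\<bar> \<le> k\<epsilon> * exp (- \<beta>' * (t - s)) * \<bar>a s - x0\<bar>) \<and>
           (\<forall>s t x0. x0 \<ge> a s \<and> t \<ge> s \<longrightarrow>
              t \<in> sol_dom f s x0 \<and>
              \<bar>a t - sol f t s x0\<bar> \<le> ka * exp (- \<beta>a * (t - s)) * \<bar>a s - x0\<bar>)) \<and>
        (\<forall>kr \<beta>r. dichotomy_pair f r kr \<beta>r \<longrightarrow>
           (\<forall>\<beta>'\<in>{0<..<\<beta>r}. \<forall>\<epsilon>>0. \<exists>k\<epsilon>\<ge>1. \<forall>s t x0. x0 \<le> a s - \<epsilon> \<and> t \<le> s \<longrightarrow>
              t \<in> sol_dom f s x0 \<and>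
              \<bar>r t - sol f t s x0\<bar> \<le> k\<epsilon> * exp (\<beta>' * (t - s)) * \<bar>r s - x0\<bar>) \<and>
           (\<forall>s t x0. x0 \<le> r s \<and> t \<le> s \<longrightarrow>
              t \<in> sol_dom f s x0 \<and>
              \<bar>r t - sol f t s x0\<bar> \<le> kr * exp (\<beta>r * (t - s)) * \<bar>r s - x0\<bar>)) \<and>
        (\<forall>b. hyperbolic f b \<longleftrightarrow> b = a \<or> b = r) \<and>
        (\<forall>b1 b2. bounded_solution f b1 \<and> bounded_solution f b2 \<and> uniformly_separated b1 b2
           \<longleftrightarrow> {b1, b2} = {a, r}))"
proof -
  obtain N m l L \<delta> \<rho> where "dconcave_rhs f N m l L \<delta> \<rho>"
    using dconcave_rhs_of_conditions[OF assms(1-7)] by blast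
  then interpret dconcave_rhs f N m l L \<delta> \<rho> .
  note ext = assms(9)
  have bs: "bounded_solution f r" "bounded_solution f a" and le: "\<And>t. r t \<le> a t"
    using ext by (auto simp: extremal_bounded_solutions_def)
  define \<eta> where "\<eta> = (INF t. a t - r t)"
  have \<eta>: "\<eta> \<le> a t - r t" for t
    unfolding \<eta>_def using le by (intro cINF_lower bdd_belowI[of _ 0]) auto
  \<comment> \<open>The equivalences are closed as a cycle: \<open>ab\<close> from (a) to (b),
    \<open>bc\<close> from (b) to (c), and \<open>ca\<close> back to (a).\<close>
  have ab: "hyperbolic_attractive f a \<and> hyperbolic_repulsive f r" if "\<eta> > 0"
    using hyperbolic_of_separated[OF bs that \<eta>] by simp
  have bc: "\<exists>b1 b2. b1 \<noteq> b2 \<and> hyperbolic f b1 \<and> hyperbolic f b2"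
    if h: "hyperbolic_attractive f a \<and> hyperbolic_repulsive f r"
  proof -
    \<comment> \<open>A solution that is both attractive and repulsive would satisfy
      \<open>(\<beta> + \<beta>') * T \<le> ln k + ln k'\<close> for every \<open>T \<ge> 0\<close>;
      the chosen \<open>T\<close> violates this by 1.\<close>
    have "a \<noteq> r"
    proof
      assume "a = r"
      then obtain k \<beta> k' \<beta>' where k: "attractive_pair f a k \<beta>" "repulsive_pair f a k' \<beta>'"
        using h by (auto simp: hyperbolic_attractive_def hyperbolic_repulsive_def)
      have sol: "caratheodory_solution f UNIV a" using bs by (simp add: bounded_solution_def)
      note k = k(1)[unfolded attractive_pair_iff[OF sol]] k(2)[unfolded repulsive_pair_iff[OF sol]]
      define T where "T = (ln k + ln k' + 1) / (\<beta> + \<beta>')"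
      have "T \<ge> 0" using k by (simp add: T_def)
      then have "\<beta>' * (T - 0) - ln k' \<le> ln k - \<beta> * (T - 0)" using k by (meson order_trans)
      moreover have "(\<beta> + \<beta>') * T = ln k + ln k' + 1" using k by (simp add: T_def)
      ultimately show False by (simp add: distrib_right)
    qed
    then show ?thesis using h unfolding hyperbolic_def by blast
  qed
  have ca: "\<eta> > 0" if "\<exists>b1 b2. b1 \<noteq> b2 \<and> hyperbolic f b1 \<and> hyperbolic f b2"
    using that separated_of_two_hyperbolic[OF ext] unfolding \<eta>_def by blast
  show ?thesis
    unfolding \<eta>_def[symmetric]
  proof (intro conjI impI)
    show "\<eta> > 0 \<longleftrightarrow> hyperbolic_attractive f a \<and> hyperbolic_repulsive f r" using ab bc ca by blast
    show "hyperbolic_attractive f a \<and> hyperbolic_repulsive f r \<longleftrightarrow> (\<exists>b1 b2. b1 \<noteq> b2 \<and> hyperbolic f b1 \<and> hyperbolic f b2)"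
      using ab bc ca by blast
    assume pos: "\<eta> > 0"
    show "\<forall>b. hyperbolic f b \<longleftrightarrow> b = a \<or> b = r"
      by (intro allI hyperbolic_iff[OF ext pos \<eta>])
    show "\<forall>b1 b2. bounded_solution f b1 \<and> bounded_solution f b2 \<and> uniformly_separated b1 b2 \<longleftrightarrow> {b1, b2} = {a, r}"
      by (intro allI uniformly_separated_iff[OF ext pos \<eta>])
  \<comment> \<open>What remains are the four estimates of (i); the two linear ones split into
    membership in \<open>sol_dom\<close> and the inequality.\<close>
  qed (intro allI impI conjI ballI attraction_estimate[OF ext _ \<eta>] repulsion_estimate[OF ext _ \<eta>];
      (elim conjE)?; (assumption | rule attraction_estimate_above[OF ext _ \<eta>, THEN conjunct1]
        attraction_estimate_above[OF ext _ \<eta>, THEN conjunct2]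
        repulsion_estimate_below[OF ext _ \<eta>, THEN conjunct1]
        repulsion_estimate_below[OF ext _ \<eta>, THEN conjunct2])+)+
qed

end
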